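(* Let $V : \mathbb{R}^{2} \to \{2^{k} \}_{k \in \mathbb{Z}_{+}}$ be such that $V = 2^{ \lfloor \log_2 v \rfloor }$ for a function $v:\mathbb{R}^2\to(0,\infty)$ that is one-Lipschitz, i.e. $|v(z)-v(z')|\le |z-z'|$ for all $z,z'\in\mathbb{R}^2$. For a Schwartz function $f$ on $\mathbb{R}^2$ define $$T_V f(x,y) = \iint_{\mathbb{R}^{2}} 1_{[0,1)}(|\eta|)\, 1_{[0,1)}\big(V(x,y) |\xi \eta |\big)\, \widehat{f}(\xi, \eta)\, e^{2\pi i (x \xi + y \eta)}\, d\eta\, d\xi .$$ Then $T_V$ is bounded in $L^{2}(\mathbb{R}^{2})$, i.e. there is a constant $C<\infty$ such that $\lVert T_V f\rVert_{L^2(\mathbb{R}^2)}\le C\lVert f\rVert_{L^2(\mathbb{R}^2)}$ for all Schwartz functions $f$ on $\mathbb{R}^2$.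
   Context: The Fourier transform of a Schwartz function $f$ on $\mathbb{R}^2$ is $\widehat{f}(\xi, \eta) = \iint_{\mathbb{R}^{2}} f(x,y) e^{-2\pi i (x \xi + y \eta)}\, dx\,dy$. For a set $E$, $1_E$ denotes its characteristic function. $\mathbb{Z}_+$ denotes the positive integers. *)

theory Defs
  imports "HOL-Analysis.Analysis"
begin

text \<open>The plane is \<^typ>\<open>real \<times> real\<close>: its library norm is the Euclidean one and
  \<open>lborel\<close> on it is two-dimensional Lebesgue measure.\<close>

text \<open>\<open>iterated_partial [u\<^sub>1, \<dots>, u\<^sub>k] f\<close> is \<open>\<partial>\<^bsub>u\<^sub>1\<^esub> \<dots> \<partial>\<^bsub>u\<^sub>k\<^esub> f\<close>; for basis vectors \<open>u\<^sub>i\<close> these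
  are the iterated partial derivatives.\<close>

primrec iterated_partial ::
    "'a::euclidean_space list \<Rightarrow> ('a \<Rightarrow> complex) \<Rightarrow> 'a \<Rightarrow> complex" where
  "iterated_partial [] f = f"
| "iterated_partial (u # us) f = (\<lambda>z. frechet_derivative (iterated_partial us f) (at z) u)"

text \<open>The differentiability clause says that \<open>f\<close> is \<open>C\<^sup>\<infinity>\<close> (and that every
  \<^const>\<open>frechet_derivative\<close> above is a genuine derivative).\<close>

definition schwartz :: "('a::euclidean_space \<Rightarrow> complex) \<Rightarrow> bool" where
  "schwartz f \<longleftrightarrow>
     (\<forall>us. set us \<subseteq> Basis \<longrightarrow>
        (\<forall>z. iterated_partial us f differentiable (at z)) \<and>
        (\<forall>N::nat. \<exists>B::real. \<forall>z. norm z ^ N * norm (iterated_partial us f z) \<le> B))"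

definition fourier :: "(real \<times> real \<Rightarrow> complex) \<Rightarrow> real \<times> real \<Rightarrow> complex" where
  "fourier f = (\<lambda>(\<xi>, \<eta>).
     LINT (x, y)|lborel. f (x, y) * exp (- 2 * of_real pi * \<i> * of_real (x * \<xi> + y * \<eta>)))"

definition T_op ::
    "(real \<times> real \<Rightarrow> real) \<Rightarrow> (real \<times> real \<Rightarrow> complex) \<Rightarrow> real \<times> real \<Rightarrow> complex" where
  "T_op V f = (\<lambda>(x, y).
     LINT (\<xi>, \<eta>)|lborel.
       indicator {0..<1} \<bar>\<eta>\<bar> * indicator {0..<1} (V (x, y) * \<bar>\<xi> * \<eta>\<bar>) * fourier f (\<xi>, \<eta>)
         * exp (2 * of_real pi * \<i> * of_real (x * \<xi> + y * \<eta>)))"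

definition in_L2 :: "('a::euclidean_space \<Rightarrow> complex) \<Rightarrow> bool" where
  "in_L2 g \<longleftrightarrow> g \<in> borel_measurable lborel \<and> integrable lborel (\<lambda>z. (norm (g z))\<^sup>2)"

text \<open>Meaningful only together with \<^const>\<open>in_L2\<close>: the Bochner integral of a non-integrable
  function is \<open>0\<close>.\<close>

definition norm_L2 :: "('a::euclidean_space \<Rightarrow> complex) \<Rightarrow> real" where
  "norm_L2 g = sqrt (LINT z|lborel. (norm (g z))\<^sup>2)"

end

theory Submission
  imports Defs "HOL-Probability.Sinc_Integral"
begin

text \<open>
  At a point \<open>z\<close> the operator applies the multiplier \<open>1(\<bar>\<eta>\<bar> < 1) 1(2^k \<bar>\<xi> \<eta>\<bar> < 1)\<close> with
  \<open>k = \<lfloor>log 2 (v z)\<rfloor>\<close>, so the difficulty is that \<open>k\<close> depends on \<open>z\<close>. Since \<open>T_op V f\<close> is an integral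
  of \<open>fourier f\<close>, the Plancherel theorem enters only through the inequality that the Fourier
  integral of an integrable function has at most its \<open>L\<^sup>2\<close> norm (\<open>plancherel_2d\<close>).

  The sharp symbol \<open>1(2^k \<bar>\<xi> \<eta>\<bar> < 1)\<close> is compared with the model symbol
  \<open>exp (- 2 \<pi> 2^k \<bar>\<xi>\<bar>) + (\<Sum>j \<ge> - k. 1(2^j \<le> \<bar>\<xi>\<bar> < 2^(j+1)) exp (- 2 \<pi> 2^(k+j) \<bar>\<eta>\<bar>))\<close>, and the choice of
  \<open>k\<close> with a partition of unity \<open>hat (v z) k\<close> that is piecewise linear in \<open>log 2 (v z)\<close>. On
  \<open>\<bar>\<eta>\<bar> < 1\<close> the squared differences of the two symbols, even with \<open>k\<close> off by one, have a bounded
  sum over \<open>k\<close>; hence the error is dominated by a square function, which Plancherel bounds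
  (\<open>square_function_bound\<close>).

  For the model operator, the first term of the symbol is bounded by a Poisson maximal function
  in \<open>x\<close>. The \<open>j\<close>-th term of the sum gives a layer \<open>M\<^sub>j\<close>, which is bounded by a Poisson maximal
  function in \<open>y\<close>. Distinct layers are almost orthogonal: for \<open>j' < j\<close> the frequency \<open>\<xi>\<close>
  in layer \<open>j\<close> has size \<open>2^j\<close>, so the layer is a difference of two translates by \<open>\<plusminus> h\<close> in \<open>x\<close> with
  \<open>h = 2^(-j) / 8\<close>, and the translation can be moved to the other factor of the inner product. There it
  changes \<open>M\<^sub>j\<^sub>'\<close>, which has frequencies of size \<open>2^j'\<close>, by a factor \<open>O(2^(j'-j))\<close>. It changes
  the weights \<open>hat (v z) k\<close> by the same amount, because \<open>v\<close> is Lipschitz and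
  \<open>v \<ge> 2^(-j'-1)\<close> wherever \<open>M\<^sub>j\<^sub>'\<close> does not vanish. So \<open>\<bar>\<langle>M\<^sub>j, M\<^sub>j\<^sub>'\<rangle>\<bar>\<close> is at most
  \<open>O(2^(-\<bar>j-j'\<bar>))\<close> times the \<open>L\<^sup>2\<close> norms of the two frequency bands (\<open>layer_pair\<close>), and summation over
  \<open>j\<close> and \<open>j'\<close> bounds the model operator (\<open>model_operator_bound\<close>).

  The maximal inequality comes from a \<open>T T*\<close> argument. The averaging operator \<open>N\<close> with kernel
  \<open>P\<^bsub>\<tau>(y)\<^esub>(y - u)\<close>, for the Poisson kernel \<open>P\<close> and an arbitrary measurable \<open>\<tau>\<close>, has
  \<open>N N* \<le> 16 (N + N*)\<close> pointwise on kernels; hence the best constant \<open>A\<close> in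
  \<open>\<parallel>N w\<parallel>\<^sup>2 \<le> A \<parallel>w\<parallel>\<^sup>2\<close> satisfies \<open>A \<le> 32 \<surd>A\<close> (\<open>pmean_bound\<close>). The Fourier integrals damped by
  \<open>exp (- 2 \<pi> \<tau>(y) \<bar>\<eta>\<bar>)\<close> are reduced to \<open>N\<close> by duality (\<open>maximal_1d\<close>).

  All of this is done for frequencies \<open>\<bar>\<xi>\<bar> < 2^n\<close> and on the set where \<open>\<lfloor>log 2 (v z)\<rfloor> \<le> n\<close>, so that all
  sums are finite; the limit \<open>n \<longlonglongrightarrow> \<infinity>\<close> uses Fatou's lemma and the decay of \<open>fourier f\<close>
  in \<open>\<xi>\<close>.
\<close>

section \<open>Characters and the Poisson kernel\<close>

text \<open>The character \<open>s \<mapsto> exp (2 \<pi> i s)\<close>.\<close>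

definition ch :: "real \<Rightarrow> complex" where
  "ch s = cis (2 * pi * s)"

text \<open>The damping factor \<open>exp (- 2 \<pi> t \<bar>s\<bar>)\<close>, as a complex number.\<close>

abbreviation damp :: "real \<Rightarrow> real \<Rightarrow> complex" where
  "damp t s \<equiv> of_real (exp (- 2 * pi * t * \<bar>s\<bar>))"

lemma norm_ch [simp]: "cmod (ch s) = 1"
  by (simp add: ch_def)

lemma ch_add: "ch (a + b) = ch a * ch b"
  by (simp add: ch_def cis_mult algebra_simps)

lemma ch_0 [simp]: "ch 0 = 1"
  by (simp add: ch_def)

lemma cnj_ch: "cnj (ch s) = ch (- s)"
  by (simp add: ch_def cis_cnj)

lemma continuous_ch [continuous_intros]:
  "continuous_on S f \<Longrightarrow> continuous_on S (\<lambda>x. ch (f x))"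
  unfolding ch_def cis_conv_exp by (intro continuous_intros)

lemma measurable_ch [measurable]: "ch \<in> borel_measurable borel"
  by (intro borel_measurable_continuous_onI continuous_intros)

text \<open>The squared \<open>L\<^sup>2\<close> norm, with values in the extended nonnegative reals, so that it is
  meaningful for every measurable function.\<close>

definition l2sq :: "('a::euclidean_space \<Rightarrow> complex) \<Rightarrow> ennreal" where
  "l2sq F = (\<integral>\<^sup>+z. ennreal ((cmod (F z))\<^sup>2) \<partial>lborel)"

text \<open>The Poisson kernel on the line: for \<open>t > 0\<close> a probability density, and the Fourier transform of
  \<open>damp t\<close> (\<open>integral_exp_abs_ch\<close>).\<close>

definition pois :: "real \<Rightarrow> real \<Rightarrow> real" where
  "pois t x = t / (pi * (t\<^sup>2 + x\<^sup>2))"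

lemma pois_nonneg: "t \<ge> 0 \<Longrightarrow> pois t x \<ge> 0"
  by (simp add: pois_def)

lemma pois_minus [simp]: "pois t (- x) = pois t x"
  by (simp add: pois_def)

lemma measurable_pois [measurable (raw)]:
  "f \<in> borel_measurable M \<Longrightarrow> g \<in> borel_measurable M \<Longrightarrow> (\<lambda>x. pois (f x) (g x)) \<in> borel_measurable M"
  unfolding pois_def by simp

lemma integrable_exp_Ioi:
  fixes c :: complex
  assumes "Re c < 0"
  shows "integrable lborel (\<lambda>\<eta>. indicator {0<..} \<eta> *\<^sub>R exp (c * of_real \<eta>))"
    and "(LINT \<eta>|lborel. indicator {0<..} \<eta> *\<^sub>R exp (c * of_real \<eta>)) = - (1 / c)"
proof -
  have "set_integrable lborel {0<..} (\<lambda>\<eta>::real. exp (- (\<eta> * (- Re c))))"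
    using assms by (intro integrable_I0i_exp_mscale) auto
  then have *: "set_integrable lborel {0<..} (\<lambda>\<eta>. exp (c * of_real \<eta>))"
    unfolding set_integrable_def
    by (rule Bochner_Integration.integrable_bound)
       (auto simp: indicator_def norm_exp_eq_Re mult.commute intro!: borel_measurable_continuous_on_indicator continuous_intros)
  then show "integrable lborel (\<lambda>\<eta>. indicator {0<..} \<eta> *\<^sub>R exp (c * of_real \<eta>))"
    by (simp add: set_integrable_def)
  have c0: "c \<noteq> 0" using assms by auto
  have lim: "((\<lambda>\<eta>. exp (c * of_real \<eta>) / c) \<longlongrightarrow> 0) at_top"
  proof (rule tendsto_norm_zero_cancel)
    have "((\<lambda>\<eta>. exp (r * \<eta>)) \<longlongrightarrow> 0) at_top" if "r < 0" for r :: real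
      using that by real_asymp
    from tendsto_divide_zero[OF this[OF assms]]
    have "((\<lambda>\<eta>. exp (Re c * \<eta>) / cmod c) \<longlongrightarrow> 0) at_top" .
    then show "((\<lambda>\<eta>. norm (exp (c * of_real \<eta>) / c)) \<longlongrightarrow> 0) at_top"
      by (simp add: norm_divide norm_exp_eq_Re)
  qed
  have lim0: "((\<lambda>\<eta>::real. exp (c * of_real \<eta>) / c) \<longlongrightarrow> exp (c * of_real 0) / c) (at_right 0)"
    using c0 by (intro tendsto_intros) auto
  have "(LBINT \<eta>=0..\<infinity>. exp (c * of_real \<eta>)) = 0 - 1 / c"
  proof (rule interval_integral_FTC_integrable[where F = "\<lambda>\<eta>. exp (c * of_real \<eta>) / c"])
    show "((\<lambda>\<eta>. exp (c * of_real \<eta>) / c) has_vector_derivative exp (c * of_real x)) (at x)" for x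
      using c0 by (auto intro!: derivative_eq_intros has_vector_derivative_real_field)
    show "set_integrable lborel (einterval 0 \<infinity>) (\<lambda>\<eta>. exp (c * of_real \<eta>))"
      using * by (simp add: einterval_eq zero_ereal_def)
    show "(((\<lambda>\<eta>. exp (c * of_real \<eta>) / c) \<circ> real_of_ereal) \<longlongrightarrow> 1 / c) (at_right 0)"
      using lim0 by (simp add: ereal_tendsto_simps zero_ereal_def)
    show "(((\<lambda>\<eta>. exp (c * of_real \<eta>) / c) \<circ> real_of_ereal) \<longlongrightarrow> 0) (at_left \<infinity>)"
      using lim by (simp add: ereal_tendsto_simps)
  qed (auto intro!: continuous_intros)
  then show "(LINT \<eta>|lborel. indicator {0<..} \<eta> *\<^sub>R exp (c * of_real \<eta>)) = - (1 / c)"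
    by (simp add: interval_lebesgue_integral_0_infty set_lebesgue_integral_def)
qed

lemma
  assumes "t > 0"
  shows integrable_exp_abs_ch: "integrable lborel (\<lambda>\<eta>. damp t \<eta> * ch (x * \<eta>))"
    and integral_exp_abs_ch: "(LINT \<eta>|lborel. damp t \<eta> * ch (x * \<eta>)) = of_real (pois t x)"
proof -
  define c where "c = Complex (- 2 * pi * t) (2 * pi * x)"
  \<comment> \<open>The integrals over the two half lines are those of two complex exponentials with conjugate exponents.\<close>
  let ?f = "\<lambda>\<eta>. indicator {0<..} \<eta> *\<^sub>R exp (c * of_real \<eta>)"
  let ?g = "\<lambda>\<eta>. indicator {0<..} \<eta> *\<^sub>R exp (cnj c * of_real \<eta>)"
  let ?h = "\<lambda>\<eta>. damp t \<eta> * ch (x * \<eta>)"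
  have c: "Re c < 0" "Re (cnj c) < 0" "c \<noteq> 0" using assms by (auto simp: c_def complex_eq_iff)
  have f: "has_bochner_integral lborel ?f (- (1 / c))"
    using integrable_exp_Ioi[OF c(1)] by (simp add: has_bochner_integral_iff)
  have "has_bochner_integral lborel ?g (- (1 / cnj c))"
    using integrable_exp_Ioi[OF c(2)] by (simp add: has_bochner_integral_iff)
  then have g: "has_bochner_integral lborel (\<lambda>\<eta>. ?g (- \<eta>)) (- (1 / cnj c))"
    using lborel_has_bochner_integral_real_affine_iff[of "-1" ?g "- (1 / cnj c)" 0] by simp
  have sum: "has_bochner_integral lborel (\<lambda>\<eta>. ?f \<eta> + ?g (- \<eta>)) (- (1 / c) + - (1 / cnj c))"
    by (rule has_bochner_integral_add[OF f g])
  have e: "ch (x * \<eta>) * damp t \<eta> = exp (Complex (- 2 * pi * t * \<bar>\<eta>\<bar>) (2 * pi * x * \<eta>))" for \<eta>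
    by (simp add: ch_def exp_eq_polar mult_ac)
  have eq: "?f \<eta> + ?g (- \<eta>) = ?h \<eta>" if "\<eta> \<noteq> 0" for \<eta>
  proof (cases "\<eta> > 0")
    case True
    have "c * of_real \<eta> = Complex (- 2 * pi * t * \<bar>\<eta>\<bar>) (2 * pi * x * \<eta>)"
      using True by (simp add: c_def complex_eq_iff)
    then show ?thesis using e[of \<eta>] True by (simp add: mult.commute)
  next
    case False
    have "cnj c * of_real (- \<eta>) = Complex (- 2 * pi * t * \<bar>\<eta>\<bar>) (2 * pi * x * \<eta>)"
      using False by (simp add: c_def complex_eq_iff)
    then show ?thesis using e[of \<eta>] False that by (simp add: mult.commute)
  qed
  have val: "- (1 / c) + - (1 / cnj c) = of_real (pois t x)"
  proof -
    have "- (1 / c) + - (1 / cnj c) = - ((c + cnj c) / (c * cnj c))"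
      using c by (simp add: field_simps)
    also have "c + cnj c = of_real (- 4 * pi * t)"
      by (simp add: c_def complex_eq_iff)
    also have "c * cnj c = of_real (4 * pi\<^sup>2 * (t\<^sup>2 + x\<^sup>2))"
      by (simp add: c_def complex_eq_iff power2_eq_square algebra_simps)
    also have "- (of_real (- 4 * pi * t) / of_real (4 * pi\<^sup>2 * (t\<^sup>2 + x\<^sup>2))) = complex_of_real (- ((- 4 * pi * t) / (4 * pi\<^sup>2 * (t\<^sup>2 + x\<^sup>2))))"
      by simp
    also have "- ((- 4 * pi * t) / (4 * pi\<^sup>2 * (t\<^sup>2 + x\<^sup>2))) = pois t x"
      using assms by (simp add: pois_def power2_eq_square divide_simps)
    finally show ?thesis .
  qed
  have "has_bochner_integral lborel ?h (of_real (pois t x))"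
  proof (subst has_bochner_integral_cong_AE[of _ _ "\<lambda>\<eta>. ?f \<eta> + ?g (- \<eta>)"])
    show "AE \<eta> in lborel. ?h \<eta> = ?f \<eta> + ?g (- \<eta>)"
      using AE_lborel_singleton[of "0::real"] by eventually_elim (use eq in auto)
    show "(\<lambda>\<eta>. ?f \<eta> + ?g (- \<eta>)) \<in> borel_measurable lborel"
      using borel_measurable_has_bochner_integral[OF sum] by simp
  qed (use sum val in auto)
  then show "integrable lborel ?h" "(LINT \<eta>|lborel. ?h \<eta>) = of_real (pois t x)"
    by (auto simp: has_bochner_integral_iff)
qed

lemma nn_integral_pois:
  assumes "t > 0"
  shows "(\<integral>\<^sup>+u. ennreal (pois t (y - u)) \<partial>lborel) = 1"
proof -
  have i: "integrable lborel (\<lambda>x::real. inverse (1 + x\<^sup>2))"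
    using integrable_inverse_1_plus_square by (simp add: set_integrable_def einterval_eq)
  have l: "(LINT x|lborel. inverse (1 + x\<^sup>2)) = pi"
    using LBINT_inverse_1_plus_square
    by (simp add: interval_lebesgue_integral_def set_lebesgue_integral_def einterval_eq)
  have "(\<integral>\<^sup>+x. ennreal (inverse (1 + x\<^sup>2) / pi) \<partial>lborel) = ennreal (LINT x|lborel. inverse (1 + x\<^sup>2) / pi)"
    using i by (intro nn_integral_eq_integral) (auto intro!: divide_nonneg_pos simp: add_nonneg_nonneg)
  also have "\<dots> = 1"
    using l by simp
  finally have 1: "(\<integral>\<^sup>+x. ennreal (inverse (1 + x\<^sup>2) / pi) \<partial>lborel) = 1" .
  have "(\<integral>\<^sup>+u. ennreal (pois t (y - u)) \<partial>lborel) = ennreal t * (\<integral>\<^sup>+x. ennreal (pois t (y - (y + t * x))) \<partial>lborel)"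
    using assms by (subst nn_integral_real_affine[where t = y and c = t]) auto
  also have "\<dots> = (\<integral>\<^sup>+x. ennreal (t * pois t (t * x)) \<partial>lborel)"
    using assms by (subst nn_integral_cmult[symmetric]) (auto simp: ennreal_mult' pois_nonneg)
  also have "\<dots> = (\<integral>\<^sup>+x. ennreal (inverse (1 + x\<^sup>2) / pi) \<partial>lborel)"
  proof (intro nn_integral_cong arg_cong[where f = ennreal])
    fix x
    have "t\<^sup>2 + (t * x)\<^sup>2 = t\<^sup>2 * (1 + x\<^sup>2)" by (simp add: algebra_simps)
    then show "t * pois t (t * x) = inverse (1 + x\<^sup>2) / pi"
      using assms by (simp add: pois_def power2_eq_square divide_simps)
  qed
  finally show ?thesis using 1 by simp
qed

section \<open>Damped Fourier integrals on the line\<close>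

lemma nn_integral_lborel_pair:
  fixes f :: "'a::euclidean_space \<times> 'b::euclidean_space \<Rightarrow> ennreal"
  assumes f: "f \<in> borel_measurable borel"
  shows "(\<integral>\<^sup>+z. f z \<partial>lborel) = (\<integral>\<^sup>+x. \<integral>\<^sup>+y. f (x, y) \<partial>lborel \<partial>lborel)"
    and "(\<integral>\<^sup>+z. f z \<partial>lborel) = (\<integral>\<^sup>+y. \<integral>\<^sup>+x. f (x, y) \<partial>lborel \<partial>lborel)"
proof -
  have f': "f \<in> borel_measurable (lborel \<Otimes>\<^sub>M lborel)"
    using f by (simp add: lborel_prod)
  show "(\<integral>\<^sup>+z. f z \<partial>lborel) = (\<integral>\<^sup>+x. \<integral>\<^sup>+y. f (x, y) \<partial>lborel \<partial>lborel)"
    using lborel.nn_integral_fst[OF f'] by (simp add: lborel_prod)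
  show "(\<integral>\<^sup>+z. f z \<partial>lborel) = (\<integral>\<^sup>+y. \<integral>\<^sup>+x. f (x, y) \<partial>lborel \<partial>lborel)"
    using lborel_pair.nn_integral_snd[OF f'] by (simp add: lborel_prod)
qed

lemma integrable_lborel_pairI:
  fixes f :: "'a::euclidean_space \<times> 'b::euclidean_space \<Rightarrow> 'c::{banach, second_countable_topology}"
  assumes [measurable]: "f \<in> borel_measurable borel"
    and "(\<integral>\<^sup>+x. \<integral>\<^sup>+y. ennreal (norm (f (x, y))) \<partial>lborel \<partial>lborel) < \<infinity>"
  shows "integrable lborel f"
  using assms(2) by (intro integrableI_bounded) (auto simp: nn_integral_lborel_pair(1))

lemma integral_lborel_pair:
  fixes f :: "'a::euclidean_space \<times> 'b::euclidean_space \<Rightarrow> 'c::{banach, second_countable_topology}"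
  assumes f: "integrable lborel f"
  shows "(LINT z|lborel. f z) = (LINT x|lborel. LINT y|lborel. f (x, y))"
    and "(LINT z|lborel. f z) = (LINT y|lborel. LINT x|lborel. f (x, y))"
proof -
  have f': "integrable (lborel \<Otimes>\<^sub>M lborel) f"
    using f by (simp add: lborel_prod)
  show 1: "(LINT z|lborel. f z) = (LINT x|lborel. LINT y|lborel. f (x, y))"
    using lborel_pair.integral_fst'[OF f'] by (simp add: lborel_prod)
  have f'': "integrable (lborel \<Otimes>\<^sub>M lborel) (case_prod (\<lambda>x y. f (x, y)))"
    using f' by simp
  show "(LINT z|lborel. f z) = (LINT y|lborel. LINT x|lborel. f (x, y))"
    using lborel_pair.integral_snd[OF f''] f by (simp add: lborel_prod)
qed

lemma measurable_cnj [measurable (raw)]: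
  "f \<in> borel_measurable M \<Longrightarrow> (\<lambda>x. cnj (f x)) \<in> borel_measurable M"
  by (rule measurable_compose[where g = cnj and L = borel])
     (auto intro!: borel_measurable_continuous_onI continuous_intros)

lemma measurable_fst_borel [measurable]:
    "(fst :: 'a::euclidean_space \<times> 'b::euclidean_space \<Rightarrow> _) \<in> borel_measurable borel"
  and measurable_snd_borel [measurable]:
    "(snd :: 'a::euclidean_space \<times> 'b::euclidean_space \<Rightarrow> _) \<in> borel_measurable borel"
  by (auto intro!: borel_measurable_continuous_onI continuous_intros)

lemma measurable_borel_pairI:
  fixes f :: "'a::second_countable_topology \<times> 'b::second_countable_topology \<Rightarrow> _"
  shows "f \<in> (borel \<Otimes>\<^sub>M borel) \<rightarrow>\<^sub>M N \<Longrightarrow> f \<in> borel \<rightarrow>\<^sub>M N"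
  by (simp add: borel_prod)

lemma cauchy_schwarz_norm:
  fixes f g :: "'a \<Rightarrow> complex"
  assumes [measurable]: "f \<in> borel_measurable M" "g \<in> borel_measurable M"
  shows "(\<integral>\<^sup>+x. ennreal (cmod (f x) * cmod (g x)) \<partial>M)\<^sup>2
    \<le> (\<integral>\<^sup>+x. ennreal ((cmod (f x))\<^sup>2) \<partial>M) * (\<integral>\<^sup>+x. ennreal ((cmod (g x))\<^sup>2) \<partial>M)"
  using Cauchy_Schwarz_nn_integral[of "\<lambda>x. ennreal (cmod (f x))" M "\<lambda>x. ennreal (cmod (g x))"]
  by (simp add: ennreal_mult' ennreal_power)

lemma integrable_mult_bounded:
  fixes g m :: "'a \<Rightarrow> complex"
  assumes "integrable M g" "m \<in> borel_measurable M" "\<And>x. cmod (m x) \<le> c"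
  shows "integrable M (\<lambda>x. m x * g x)"
proof (rule Bochner_Integration.integrable_bound)
  show "integrable M (\<lambda>x. of_real c * g x)" using assms by simp
  show "(\<lambda>x. m x * g x) \<in> borel_measurable M" using assms by measurable
  show "AE x in M. cmod (m x * g x) \<le> cmod (of_real c * g x)"
    using assms(3) by (auto simp: norm_mult intro!: mult_right_mono order_trans[OF _ abs_ge_self])
qed

text \<open>The square of a damped Fourier integral, expanded as a double integral and integrated in \<open>\<eta>\<close>
  first, has a Poisson kernel as its only remaining factor besides \<open>u\<close>. The damping \<open>\<tau>\<close> may
  depend on \<open>y\<close>; a constant one gives Plancherel's inequality, a variable one the maximal inequality.\<close>

lemma l2sq_damped_transform_le:
  fixes u :: "real \<Rightarrow> complex" and \<tau> :: "real \<Rightarrow> real"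
  assumes u: "integrable lborel u" and \<tau>[measurable]: "\<tau> \<in> borel_measurable borel"
    and a: "a > 0" "\<And>y. \<tau> y \<ge> a"
  shows "l2sq (\<lambda>\<eta>. LINT y|lborel. damp (\<tau> y) \<eta> * u y * ch (y * \<eta>))
    \<le> (\<integral>\<^sup>+y. \<integral>\<^sup>+y'. ennreal (cmod (u y) * cmod (u y') * pois (\<tau> y + \<tau> y') (y - y')) \<partial>lborel \<partial>lborel)"
proof -
  have [measurable]: "u \<in> borel_measurable borel" using u by auto
  define k where "k = (\<lambda>\<eta> y. damp (\<tau> y) \<eta> * u y * ch (y * \<eta>))"
  define W where "W = (\<lambda>\<eta>. LINT y|lborel. k \<eta> y)"
  define F where "F = (\<lambda>(\<eta>, y, y'). k \<eta> y * cnj (k \<eta> y'))"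
  have [measurable]: "case_prod k \<in> borel_measurable borel"
    unfolding k_def by (rule measurable_borel_pairI) measurable
  have km[measurable]: "k \<eta> \<in> borel_measurable borel" for \<eta>
    unfolding k_def by measurable
  have Fm[measurable]: "F \<in> borel_measurable borel"
  proof -
    have "F \<in> borel_measurable (borel \<Otimes>\<^sub>M (borel \<Otimes>\<^sub>M borel))"
      unfolding F_def k_def by measurable
    then show ?thesis by (simp add: borel_prod)
  qed
  have nk: "cmod (k \<eta> y) = exp (- 2 * pi * \<tau> y * \<bar>\<eta>\<bar>) * cmod (u y)" for \<eta> y
    by (simp add: k_def norm_mult)
  have expa: "exp (- 2 * pi * \<tau> y * \<bar>\<eta>\<bar>) \<le> exp (- 2 * pi * a * \<bar>\<eta>\<bar>)" for y \<eta>
    using a(2)[of y] by (auto intro!: mult_right_mono)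
  have a0: "exp (- 2 * pi * a * \<bar>\<eta>\<bar>) \<le> 1" for \<eta> using a by auto
  have ik: "integrable lborel (k \<eta>)" for \<eta>
    by (rule Bochner_Integration.integrable_bound[OF u])
       (use order_trans[OF expa a0] in \<open>auto simp: nk intro!: mult_left_le_one_le\<close>)
  have iu: "(\<integral>\<^sup>+y. ennreal (cmod (u y)) \<partial>lborel) < \<infinity>"
    using u by (simp add: integrable_iff_bounded)
  have ie: "(\<integral>\<^sup>+\<eta>. ennreal (exp (- 2 * pi * a * \<bar>\<eta>\<bar>)) \<partial>lborel) < \<infinity>"
    using integrable_exp_abs_ch[OF a(1), of 0] by (simp add: integrable_iff_bounded norm_mult)
  have iF: "integrable lborel F"
  proof (rule integrable_lborel_pairI[OF Fm])
    have "(\<integral>\<^sup>+\<eta>. \<integral>\<^sup>+p. ennreal (norm (F (\<eta>, p))) \<partial>lborel \<partial>lborel)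
      \<le> (\<integral>\<^sup>+\<eta>. ennreal (exp (- 2 * pi * a * \<bar>\<eta>\<bar>)) * ((\<integral>\<^sup>+y. ennreal (cmod (u y)) \<partial>lborel) * (\<integral>\<^sup>+y. ennreal (cmod (u y)) \<partial>lborel)) \<partial>lborel)"
    proof (rule nn_integral_mono)
      fix \<eta> :: real
      let ?e = "exp (- 2 * pi * a * \<bar>\<eta>\<bar>)"
      have "(\<integral>\<^sup>+p. ennreal (norm (F (\<eta>, p))) \<partial>lborel)
        \<le> (\<integral>\<^sup>+p. ennreal ?e * (ennreal (cmod (u (fst p))) * ennreal (cmod (u (snd p)))) \<partial>lborel)"
      proof (intro nn_integral_mono, clarify)
        fix y y'
        have "norm (F (\<eta>, (y, y'))) = (exp (- 2 * pi * \<tau> y * \<bar>\<eta>\<bar>) * exp (- 2 * pi * \<tau> y' * \<bar>\<eta>\<bar>)) * (cmod (u y) * cmod (u y'))"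
          by (simp add: F_def norm_mult nk)
        also have "\<dots> \<le> (?e * 1) * (cmod (u y) * cmod (u y'))"
          using expa[of y \<eta>] order_trans[OF expa a0, of y' \<eta>]
          by (intro mult_right_mono mult_mono) auto
        finally show "ennreal (norm (F (\<eta>, (y, y')))) \<le> ennreal ?e * (ennreal (cmod (u (fst (y, y')))) * ennreal (cmod (u (snd (y, y')))))"
          by (simp add: ennreal_mult'[symmetric] ennreal_leI)
      qed
      also have "\<dots> = ennreal ?e * ((\<integral>\<^sup>+y. ennreal (cmod (u y)) \<partial>lborel) * (\<integral>\<^sup>+y. ennreal (cmod (u y)) \<partial>lborel))"
        by (simp add: nn_integral_cmult nn_integral_lborel_pair(1) nn_integral_multc)
      finally show "(\<integral>\<^sup>+p. ennreal (norm (F (\<eta>, p))) \<partial>lborel) \<le> \<dots>" .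
    qed
    also have "\<dots> = (\<integral>\<^sup>+\<eta>. ennreal (exp (- 2 * pi * a * \<bar>\<eta>\<bar>)) \<partial>lborel) * ((\<integral>\<^sup>+y. ennreal (cmod (u y)) \<partial>lborel) * (\<integral>\<^sup>+y. ennreal (cmod (u y)) \<partial>lborel))"
      by (simp add: nn_integral_multc)
    also have "\<dots> < \<infinity>"
      using iu ie by (simp add: ennreal_mult_less_top)
    finally show "(\<integral>\<^sup>+\<eta>. \<integral>\<^sup>+p. ennreal (norm (F (\<eta>, p))) \<partial>lborel \<partial>lborel) < \<infinity>" .
  qed
  have sec: "(LINT p|lborel. F (\<eta>, p)) = of_real ((cmod (W \<eta>))\<^sup>2)" for \<eta>
  proof -
    have i: "integrable lborel (\<lambda>p. F (\<eta>, p))"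
    proof (rule integrable_lborel_pairI)
      have "(\<lambda>p. F (\<eta>, p)) \<in> borel_measurable (borel \<Otimes>\<^sub>M borel)"
        unfolding F_def split_beta fst_conv snd_conv by measurable
      then show "(\<lambda>p. F (\<eta>, p)) \<in> borel_measurable borel" by (simp add: borel_prod)
      have "(\<integral>\<^sup>+y. \<integral>\<^sup>+y'. ennreal (norm (F (\<eta>, y, y'))) \<partial>lborel \<partial>lborel) =
         (\<integral>\<^sup>+y. ennreal (cmod (k \<eta> y)) \<partial>lborel) * (\<integral>\<^sup>+y. ennreal (cmod (k \<eta> y)) \<partial>lborel)"
        by (simp add: F_def norm_mult ennreal_mult' nn_integral_cmult nn_integral_multc)
      also have "\<dots> < \<infinity>" using ik[of \<eta>] by (simp add: integrable_iff_bounded ennreal_mult_less_top)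
      finally show "(\<integral>\<^sup>+y. \<integral>\<^sup>+y'. ennreal (norm (F (\<eta>, y, y'))) \<partial>lborel \<partial>lborel) < \<infinity>" .
    qed
    have "(LINT p|lborel. F (\<eta>, p)) = (LINT y|lborel. LINT y'|lborel. k \<eta> y * cnj (k \<eta> y'))"
      using integral_lborel_pair(1)[OF i] by (simp add: F_def)
    also have "\<dots> = W \<eta> * cnj (W \<eta>)"
      by (simp add: W_def)
    finally show "(LINT p|lborel. F (\<eta>, p)) = of_real ((cmod (W \<eta>))\<^sup>2)"
      by (simp only: complex_norm_square)
  qed
  have Wi: "integrable lborel (\<lambda>\<eta>. complex_of_real ((cmod (W \<eta>))\<^sup>2))"
    using lborel_pair.integrable_fst'[of F] iF sec by (simp add: lborel_prod)
  then have Wi': "integrable lborel (\<lambda>\<eta>. (cmod (W \<eta>))\<^sup>2)"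
    by (simp only: complex_of_real_integrable_eq)
  define Q where "Q = (\<lambda>(y, y'). of_real (pois (\<tau> y + \<tau> y') (y - y')) * (u y * cnj (u y')))"
  have Qeq: "(LINT \<eta>|lborel. F (\<eta>, p)) = Q p" for p
  proof (cases p)
    case (Pair y y')
    have pos: "\<tau> y + \<tau> y' > 0" using a(2)[of y] a(2)[of y'] a(1) by linarith
    have "F (\<eta>, p) = (damp (\<tau> y + \<tau> y') \<eta> * ch ((y - y') * \<eta>)) * (u y * cnj (u y'))" for \<eta>
    proof -
      have "ch ((y - y') * \<eta>) = ch (y * \<eta>) * ch (- (y' * \<eta>))"
        by (simp add: ch_add[symmetric] algebra_simps)
      moreover have "exp (- 2 * pi * (\<tau> y + \<tau> y') * \<bar>\<eta>\<bar>) = exp (- 2 * pi * \<tau> y * \<bar>\<eta>\<bar>) * exp (- 2 * pi * \<tau> y' * \<bar>\<eta>\<bar>)"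
        by (simp add: exp_add[symmetric] algebra_simps)
      ultimately show ?thesis
        by (simp add: F_def Pair k_def cnj_ch mult_ac)
    qed
    then show ?thesis
      using integral_exp_abs_ch[OF pos, of "y - y'"] by (simp add: Q_def Pair)
  qed
  have Qi: "integrable lborel Q"
  proof -
    have "integrable (lborel \<Otimes>\<^sub>M lborel) (case_prod (\<lambda>x y. F (x, y)))" using iF by (simp add: lborel_prod)
    from lborel_pair.integrable_snd[OF this] show ?thesis
      by (simp add: Qeq)
  qed
  have "l2sq W = ennreal (LINT \<eta>|lborel. (cmod (W \<eta>))\<^sup>2)"
    unfolding l2sq_def using Wi' by (intro nn_integral_eq_integral) auto
  also have "(LINT \<eta>|lborel. (cmod (W \<eta>))\<^sup>2) = cmod (LINT \<eta>|lborel. complex_of_real ((cmod (W \<eta>))\<^sup>2))"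
    unfolding integral_complex_of_real by (simp add: integral_nonneg_AE)
  also have "(LINT \<eta>|lborel. complex_of_real ((cmod (W \<eta>))\<^sup>2)) = (LINT z|lborel. F z)"
    using integral_lborel_pair(1)[OF iF] by (simp add: sec)
  also have "\<dots> = (LINT p|lborel. Q p)"
    using integral_lborel_pair(2)[OF iF] by (simp add: Qeq)
  also have "ennreal (cmod (LINT p|lborel. Q p)) \<le> (\<integral>\<^sup>+p. ennreal (cmod (Q p)) \<partial>lborel)"
    by (rule integral_norm_bound_ennreal[OF Qi])
  also have "\<dots> = (\<integral>\<^sup>+y. \<integral>\<^sup>+y'. ennreal (cmod (Q (y, y'))) \<partial>lborel \<partial>lborel)"
    using Qi by (intro nn_integral_lborel_pair(1)) auto
  also have "\<dots> = (\<integral>\<^sup>+y. \<integral>\<^sup>+y'. ennreal (cmod (u y) * cmod (u y') * pois (\<tau> y + \<tau> y') (y - y')) \<partial>lborel \<partial>lborel)"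
  proof (intro nn_integral_cong arg_cong[where f = ennreal])
    fix y y'
    have "pois (\<tau> y + \<tau> y') (y - y') \<ge> 0"
      using a(2)[of y] a(2)[of y'] a(1) by (intro pois_nonneg) linarith
    then show "cmod (Q (y, y')) = cmod (u y) * cmod (u y') * pois (\<tau> y + \<tau> y') (y - y')"
      by (simp add: Q_def norm_mult)
  qed
  finally show ?thesis by (simp add: W_def k_def)
qed

section \<open>Plancherel inequality and Poisson kernel estimates\<close>

lemma l2sq_eq_power2: "l2sq F = (\<integral>\<^sup>+z. (ennreal (cmod (F z)))\<^sup>2 \<partial>lborel)"
  by (simp add: l2sq_def ennreal_power)

lemma nn_integral_pois':
  assumes "t > 0"
  shows "(\<integral>\<^sup>+u. ennreal (pois t (u - y)) \<partial>lborel) = 1"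
proof -
  have "pois t (u - y) = pois t (y - u)" for u by (simp add: pois_def power2_commute)
  then show ?thesis using nn_integral_pois[OF assms, of y] by simp
qed

lemma pois_schur:
  fixes f :: "real \<Rightarrow> ennreal"
  assumes [measurable]: "f \<in> borel_measurable borel" and t: "t > 0"
  shows "(\<integral>\<^sup>+y. \<integral>\<^sup>+u. ennreal (pois t (y - u)) * f u \<partial>lborel \<partial>lborel) = (\<integral>\<^sup>+u. f u \<partial>lborel)"
    and "(\<integral>\<^sup>+y. \<integral>\<^sup>+u. ennreal (pois t (y - u)) * f y \<partial>lborel \<partial>lborel) = (\<integral>\<^sup>+u. f u \<partial>lborel)"
proof -
  have "(\<integral>\<^sup>+y. \<integral>\<^sup>+u. ennreal (pois t (y - u)) * f u \<partial>lborel \<partial>lborel)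
     = (\<integral>\<^sup>+u. \<integral>\<^sup>+y. ennreal (pois t (y - u)) * f u \<partial>lborel \<partial>lborel)"
    by (rule lborel_pair.Fubini') measurable
  then show "(\<integral>\<^sup>+y. \<integral>\<^sup>+u. ennreal (pois t (y - u)) * f u \<partial>lborel \<partial>lborel) = (\<integral>\<^sup>+u. f u \<partial>lborel)"
    using t by (simp add: nn_integral_multc nn_integral_pois')
  show "(\<integral>\<^sup>+y. \<integral>\<^sup>+u. ennreal (pois t (y - u)) * f y \<partial>lborel \<partial>lborel) = (\<integral>\<^sup>+u. f u \<partial>lborel)"
    using t by (simp add: nn_integral_multc nn_integral_pois)
qed

text \<open>Integrability of \<open>h\<close> need not be assumed: without it every Fourier integral of \<open>h\<close> is \<open>0\<close>, the value of
  the integral of a non-integrable function.\<close>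

lemma plancherel_1d:
  fixes h :: "real \<Rightarrow> complex"
  assumes h[measurable]: "h \<in> borel_measurable borel"
  shows "l2sq (\<lambda>\<eta>. LINT y|lborel. h y * ch (y * \<eta>)) \<le> l2sq h"
proof (cases "integrable lborel h")
  case False
  have "\<not> integrable lborel (\<lambda>y. h y * ch (y * \<eta>))" for \<eta>
  proof
    assume "integrable lborel (\<lambda>y. h y * ch (y * \<eta>))"
    then have "integrable lborel (\<lambda>y. ch (- (y * \<eta>)) * (h y * ch (y * \<eta>)))"
      by (rule integrable_mult_bounded[where c = 1]) auto
    moreover have "ch (- (y * \<eta>)) * (h y * ch (y * \<eta>)) = h y" for y
      using ch_add[of "- (y * \<eta>)" "y * \<eta>"] by (simp add: mult_ac)
    ultimately show False using False by simp
  qed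
  then show ?thesis by (simp add: l2sq_def not_integrable_integral_eq)
next
  case True
  define F where "F = (\<lambda>\<eta>. LINT y|lborel. h y * ch (y * \<eta>))"
  \<comment> \<open>Damping with parameters tending to zero makes the previous lemma applicable; Fatou removes it again.\<close>
  define e where "e = (\<lambda>n::nat. 1 / (real n + 1))"
  define W where "W = (\<lambda>n \<eta>. LINT y|lborel. damp (e n / 2) \<eta> * h y * ch (y * \<eta>))"
  have e: "e n > 0" for n by (simp add: e_def)
  have W: "W n \<eta> = damp (e n / 2) \<eta> * F \<eta>" for n \<eta>
    unfolding W_def F_def mult.assoc by simp
  have Fm[measurable]: "F \<in> borel_measurable borel"
    unfolding F_def by measurable
  have bound: "l2sq (W n) \<le> l2sq h" for n
  proof -
    have "l2sq (W n) \<le> (\<integral>\<^sup>+y. \<integral>\<^sup>+y'. ennreal (cmod (h y) * cmod (h y') * pois (e n / 2 + e n / 2) (y - y')) \<partial>lborel \<partial>lborel)"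
      unfolding W_def using True e[of n] by (intro l2sq_damped_transform_le[where a = "e n / 2"]) auto
    also have "\<dots> \<le> (\<integral>\<^sup>+y. \<integral>\<^sup>+y'. ennreal (pois (e n) (y - y')) * ennreal ((cmod (h y))\<^sup>2 / 2) + ennreal (pois (e n) (y - y')) * ennreal ((cmod (h y'))\<^sup>2 / 2) \<partial>lborel \<partial>lborel)"
    proof (intro nn_integral_mono)
      fix y y'
      have p: "pois (e n) (y - y') \<ge> 0" using e[of n] by (intro pois_nonneg) auto
      have "cmod (h y) * cmod (h y') \<le> (cmod (h y))\<^sup>2 / 2 + (cmod (h y'))\<^sup>2 / 2"
        using sum_squares_bound[of "cmod (h y)" "cmod (h y')"] by simp
      from mult_right_mono[OF this p]
      have "cmod (h y) * cmod (h y') * pois (e n) (y - y') \<le> pois (e n) (y - y') * ((cmod (h y))\<^sup>2 / 2) + pois (e n) (y - y') * ((cmod (h y'))\<^sup>2 / 2)"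
        by (simp add: algebra_simps)
      with p show "ennreal (cmod (h y) * cmod (h y') * pois (e n / 2 + e n / 2) (y - y')) \<le> ennreal (pois (e n) (y - y')) * ennreal ((cmod (h y))\<^sup>2 / 2) + ennreal (pois (e n) (y - y')) * ennreal ((cmod (h y'))\<^sup>2 / 2)"
        by (simp add: ennreal_mult'[symmetric] ennreal_plus[symmetric] del: ennreal_plus)
    qed
    also have "\<dots> = (\<integral>\<^sup>+y. \<integral>\<^sup>+y'. ennreal (pois (e n) (y - y')) * ennreal ((cmod (h y))\<^sup>2 / 2) \<partial>lborel \<partial>lborel) + (\<integral>\<^sup>+y. \<integral>\<^sup>+y'. ennreal (pois (e n) (y - y')) * ennreal ((cmod (h y'))\<^sup>2 / 2) \<partial>lborel \<partial>lborel)"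
      by (subst nn_integral_add[symmetric]) (auto intro!: nn_integral_cong nn_integral_add)
    also have "\<dots> = (\<integral>\<^sup>+y. ennreal ((cmod (h y))\<^sup>2 / 2) \<partial>lborel) + (\<integral>\<^sup>+y. ennreal ((cmod (h y))\<^sup>2 / 2) \<partial>lborel)"
      using e[of n] by (subst pois_schur(1), simp, simp, subst pois_schur(2)) auto
    also have "\<dots> = l2sq h"
      by (subst nn_integral_add[symmetric]) (auto simp: l2sq_def ennreal_plus[symmetric] simp del: ennreal_plus)
    finally show ?thesis .
  qed
  have "l2sq F = (\<integral>\<^sup>+\<eta>. liminf (\<lambda>n. ennreal ((cmod (W n \<eta>))\<^sup>2)) \<partial>lborel)"
    unfolding l2sq_def
  proof (rule nn_integral_cong)
    fix \<eta>
    have "e \<longlonglongrightarrow> 0"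
      unfolding e_def by real_asymp
    then have "(\<lambda>n. exp (- 2 * pi * (e n / 2) * \<bar>\<eta>\<bar>)) \<longlonglongrightarrow> exp (- 2 * pi * (0 / 2) * \<bar>\<eta>\<bar>)"
      by (intro tendsto_intros) auto
    then have "(\<lambda>n. (exp (- 2 * pi * (e n / 2) * \<bar>\<eta>\<bar>) * cmod (F \<eta>))\<^sup>2) \<longlonglongrightarrow> (1 * cmod (F \<eta>))\<^sup>2"
      by (intro tendsto_intros) auto
    then have "(\<lambda>n. ennreal ((cmod (W n \<eta>))\<^sup>2)) \<longlonglongrightarrow> ennreal ((cmod (F \<eta>))\<^sup>2)"
      by (intro tendsto_ennrealI) (simp add: W norm_mult)
    then show "ennreal ((cmod (F \<eta>))\<^sup>2) = liminf (\<lambda>n. ennreal ((cmod (W n \<eta>))\<^sup>2))"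
      by (intro lim_imp_Liminf[symmetric]) auto
  qed
  also have "\<dots> \<le> liminf (\<lambda>n. l2sq (W n))"
    unfolding l2sq_def by (intro nn_integral_liminf) (simp add: W)
  also have "\<dots> \<le> l2sq h"
    by (rule Liminf_le) (auto simp: bound)
  finally show ?thesis by (simp add: F_def)
qed

lemma pois_le_4:
  assumes "t > 0" "\<bar>d\<bar> \<le> 2 * \<bar>x\<bar>" shows "pois t x \<le> 4 * pois t d"
proof -
  have "d\<^sup>2 \<le> (2 * x)\<^sup>2" using assms(2) by (subst abs_le_square_iff[symmetric]) (simp add: abs_mult)
  then have "d\<^sup>2 \<le> 4 * x\<^sup>2" by (simp add: power_mult_distrib)
  then have "t\<^sup>2 + d\<^sup>2 \<le> 4 * (t\<^sup>2 + x\<^sup>2)"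
    unfolding distrib_left by (intro add_mono) simp_all
  moreover have "t\<^sup>2 + d\<^sup>2 > 0" "t\<^sup>2 + x\<^sup>2 > 0" using assms by (auto intro: add_pos_nonneg)
  ultimately have "1 / (t\<^sup>2 + x\<^sup>2) \<le> 4 / (t\<^sup>2 + d\<^sup>2)" by (simp add: field_simps)
  from mult_left_mono[OF this, of "t / pi"] show ?thesis
    using assms(1) by (simp add: pois_def mult_ac)
qed

text \<open>Either \<open>y - u\<close> or \<open>u - z\<close> is at least half as large as \<open>y - z\<close>, and then the kernel evaluated there is at
  most a multiple of \<open>pois t (y - z)\<close>; for the narrower kernel this requires \<open>\<bar>y - z\<bar> > t\<close>, but if
  \<open>\<bar>y - z\<bar> \<le> t\<close>, then \<open>pois t (y - z)\<close> is comparable to the maximum of \<open>pois t\<close>.\<close>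

lemma pois_prod_le:
  assumes s: "0 < s" "s \<le> t"
  shows "pois t (y - u) * pois s (u - z) \<le> 8 * pois t (y - z) * (pois s (u - z) + pois t (y - u))"
proof -
  let ?d = "y - z"
  have nn: "pois t (y - u) \<ge> 0" "pois s (u - z) \<ge> 0" "pois t ?d \<ge> 0"
    using s by (auto intro!: pois_nonneg)
  consider "\<bar>?d\<bar> \<le> 2 * \<bar>y - u\<bar>" | "\<bar>?d\<bar> \<le> 2 * \<bar>u - z\<bar>" by (smt (verit))
  then have "pois t (y - u) \<le> 8 * pois t ?d \<or> pois s (u - z) \<le> 8 * pois t ?d"
  proof cases
    case 1
    then show ?thesis using pois_le_4[of t ?d "y - u"] s nn by auto
  next
    case 2
    show ?thesis
    proof (cases "\<bar>?d\<bar> \<le> t")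
      case True
      show ?thesis
      proof -
        have *: "a \<le> t \<Longrightarrow> 0 \<le> t \<Longrightarrow> 0 \<le> b \<Longrightarrow> t + a \<le> 8 * (t + b)" for a b t :: real
          unfolding distrib_left by linarith
        have "?d\<^sup>2 \<le> t\<^sup>2" using True s by (intro power2_le_iff_abs_le[THEN iffD2]) auto
        moreover have "t\<^sup>2 > 0" "t\<^sup>2 + ?d\<^sup>2 > 0" "t\<^sup>2 + (y - u)\<^sup>2 > 0"
          using s by (auto intro: add_pos_nonneg)
        moreover from this have "t\<^sup>2 + ?d\<^sup>2 \<le> 8 * (t\<^sup>2 + (y - u)\<^sup>2)"
          using \<open>?d\<^sup>2 \<le> t\<^sup>2\<close> by (intro *) simp_all
        ultimately have "1 / (t\<^sup>2 + (y - u)\<^sup>2) \<le> 8 / (t\<^sup>2 + ?d\<^sup>2)"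
          by (simp add: field_simps)
        from mult_left_mono[OF this, of "t / pi"] show ?thesis
          using s by (simp add: pois_def mult_ac)
      qed
    next
      case False
      have "?d\<^sup>2 \<le> 4 * (u - z)\<^sup>2" using power_mono[OF 2, of 2] by (simp add: power_mult_distrib)
      moreover have "t\<^sup>2 \<le> ?d\<^sup>2" using False s by (subst abs_le_square_iff[symmetric]) auto
      ultimately have "t\<^sup>2 + ?d\<^sup>2 \<le> 8 * (s\<^sup>2 + (u - z)\<^sup>2)"
        using add_increasing[of "8 * s\<^sup>2" "t\<^sup>2 + ?d\<^sup>2" "8 * (u - z)\<^sup>2"] by simp
      moreover have "t\<^sup>2 + ?d\<^sup>2 > 0" "s\<^sup>2 + (u - z)\<^sup>2 > 0" using s by (auto intro: add_pos_nonneg)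
      ultimately have "1 / (s\<^sup>2 + (u - z)\<^sup>2) \<le> 8 / (t\<^sup>2 + ?d\<^sup>2)" by (simp add: field_simps)
      moreover have "s / pi \<le> t / pi" using s by (simp add: divide_right_mono)
      ultimately have "s / pi * (1 / (s\<^sup>2 + (u - z)\<^sup>2)) \<le> t / pi * (8 / (t\<^sup>2 + ?d\<^sup>2))"
        using s by (intro mult_mono) auto
      then show ?thesis by (simp add: pois_def mult_ac)
    qed
  qed
  then show ?thesis
  proof
    assume "pois t (y - u) \<le> 8 * pois t ?d"
    from mult_right_mono[OF this nn(2)] show ?thesis
      using mult_nonneg_nonneg[OF nn(3) nn(1)] by (simp add: algebra_simps)
  next
    assume "pois s (u - z) \<le> 8 * pois t ?d"
    from mult_left_mono[OF this nn(1)] show ?thesis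
      using mult_nonneg_nonneg[OF nn(3) nn(2)] by (simp add: algebra_simps)
  qed
qed

lemma pois_conv_le:
  assumes "0 < s" "0 < t"
  shows "(\<integral>\<^sup>+u. ennreal (pois t (y - u) * pois s (z - u)) \<partial>lborel) \<le> ennreal (16 * (pois t (y - z) + pois s (y - z)))"
proof -
  have *: "(\<integral>\<^sup>+u. ennreal (pois t (y - u) * pois s (u - z)) \<partial>lborel) \<le> ennreal (16 * pois t (y - z))"
    if "0 < s" "s \<le> t" for s t y z
  proof -
    have nn: "pois t (y - z) \<ge> 0" using that by (auto intro!: pois_nonneg)
    have "(\<integral>\<^sup>+u. ennreal (pois t (y - u) * pois s (u - z)) \<partial>lborel)
      \<le> (\<integral>\<^sup>+u. ennreal (8 * pois t (y - z)) * (ennreal (pois s (u - z)) + ennreal (pois t (y - u))) \<partial>lborel)"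
    proof (intro nn_integral_mono)
      fix u
      show "ennreal (pois t (y - u) * pois s (u - z)) \<le> ennreal (8 * pois t (y - z)) * (ennreal (pois s (u - z)) + ennreal (pois t (y - u)))"
        using pois_prod_le[OF that, of y u z] nn that
        by (simp add: ennreal_mult'[symmetric] ennreal_plus[symmetric] pois_nonneg ennreal_leI del: ennreal_plus)
    qed
    also have "\<dots> = ennreal (8 * pois t (y - z)) * (1 + 1)"
      using that by (simp add: nn_integral_cmult nn_integral_add nn_integral_pois nn_integral_pois')
    also have "\<dots> = ennreal (8 * pois t (y - z)) * ennreal 2"
      by (simp add: one_add_one)
    also have "\<dots> = ennreal (16 * pois t (y - z))"
      using nn by (subst ennreal_mult[symmetric]) auto
    finally show ?thesis .
  qed
  have sym: "pois r (a - b) = pois r (b - a)" for r a b by (simp add: pois_def power2_commute)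
  show ?thesis
  proof (cases "s \<le> t")
    case True
    show ?thesis
      using order_trans[OF *[OF assms(1) True, of y z] ennreal_leI[of "16 * pois t (y - z)" "16 * (pois t (y - z) + pois s (y - z))"]]
        pois_nonneg[of s "y - z"] assms
      by (simp add: sym[of s _ z])
  next
    case False
    then have "t \<le> s" by simp
    show ?thesis
      using order_trans[OF *[OF assms(2) \<open>t \<le> s\<close>, of z y] ennreal_leI[of "16 * pois s (z - y)" "16 * (pois t (y - z) + pois s (y - z))"]]
        pois_nonneg[of t "y - z"] assms
      by (simp add: sym[of t _ y] sym[of s z y] mult.commute)
  qed
qed

lemma pois_add_le:
  assumes "0 < s" "0 < t"
  shows "pois (t + s) x \<le> 2 * (pois t x + pois s x)"
proof -
  have *: "pois (t + s) x \<le> 2 * pois t x" if "0 < s" "s \<le> t" for s t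
  proof -
    have "t\<^sup>2 \<le> (t + s)\<^sup>2" using that by (intro power_mono) auto
    moreover have "t\<^sup>2 + x\<^sup>2 > 0" using that by (auto intro: add_pos_nonneg)
    ultimately have "1 / ((t + s)\<^sup>2 + x\<^sup>2) \<le> 1 / (t\<^sup>2 + x\<^sup>2)" by (intro divide_left_mono mult_pos_pos) auto
    moreover have "(t + s) / pi \<le> 2 * t / pi" using that by (simp add: divide_right_mono)
    ultimately have "(t + s) / pi * (1 / ((t + s)\<^sup>2 + x\<^sup>2)) \<le> 2 * t / pi * (1 / (t\<^sup>2 + x\<^sup>2))"
      using that by (intro mult_mono) auto
    then show ?thesis by (simp add: pois_def mult_ac)
  qed
  show ?thesis
    using *[of s t] *[of t s] assms pois_nonneg[of s x] pois_nonneg[of t x]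
    by (cases "s \<le> t") (auto simp: add.commute)
qed

section \<open>The Poisson maximal inequality\<close>

lemma ennreal_le_if_power2_le:
  fixes x y :: ennreal
  assumes "x\<^sup>2 \<le> y\<^sup>2"
  shows "x \<le> y"
proof (cases x; cases y)
  fix a b assume ab: "x = ennreal a" "0 \<le> a" "y = ennreal b" "0 \<le> b"
  then have "a\<^sup>2 \<le> b\<^sup>2" using assms by (simp add: ennreal_power)
  then show ?thesis using ab by (auto intro!: ennreal_leI power2_le_imp_le)
next
  fix b assume "x = top" "y = ennreal b" "0 \<le> b"
  then show ?thesis using assms by (simp add: ennreal_power top_unique)
qed auto

lemma ennreal_le_if_power2_le_mult:
  fixes x y :: ennreal
  assumes "x\<^sup>2 \<le> y * x" "x < top"
  shows "x \<le> y"
proof (cases "x = 0")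
  case False
  obtain a where a: "x = ennreal a" "a > 0"
    using assms(2) False by (cases x) auto
  show ?thesis
  proof (cases y)
    case (real b)
    have "a\<^sup>2 \<le> b * a" using assms(1) a real
      by (simp add: ennreal_power ennreal_mult'[symmetric])
    then show ?thesis using a real by (simp add: power2_eq_square)
  qed auto
qed auto

text \<open>The mean of \<open>w\<close> with respect to the Poisson kernel whose width \<open>\<tau> y\<close> depends on the point \<open>y\<close>. A bound
  uniform in \<open>\<tau>\<close> is a maximal inequality.\<close>

definition pmean :: "(real \<Rightarrow> real) \<Rightarrow> (real \<Rightarrow> ennreal) \<Rightarrow> real \<Rightarrow> ennreal" where
  "pmean \<tau> w y = (\<integral>\<^sup>+u. ennreal (pois (\<tau> y) (y - u)) * w u \<partial>lborel)"

lemma measurable_pmean [measurable]: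
  assumes [measurable]: "\<tau> \<in> borel_measurable borel" "w \<in> borel_measurable borel"
  shows "pmean \<tau> w \<in> borel_measurable borel"
  unfolding pmean_def by measurable

lemma pmean_const_power2_le:
  assumes [measurable]: "w \<in> borel_measurable borel" and a: "a > 0"
  shows "(\<integral>\<^sup>+u. ennreal (pois a (y - u)) * w u \<partial>lborel)\<^sup>2 \<le> (\<integral>\<^sup>+u. ennreal (pois a (y - u)) * (w u)\<^sup>2 \<partial>lborel)"
proof -
  let ?r = "\<lambda>u. ennreal (sqrt (pois a (y - u)))"
  have r: "(?r u)\<^sup>2 = ennreal (pois a (y - u))" "?r u * ?r u = ennreal (pois a (y - u))" for u
    using a by (auto simp: ennreal_power pois_nonneg ennreal_mult'[symmetric])
  have "(\<integral>\<^sup>+u. ?r u * (?r u * w u) \<partial>lborel)\<^sup>2 \<le> (\<integral>\<^sup>+u. (?r u)\<^sup>2 \<partial>lborel) * (\<integral>\<^sup>+u. (?r u * w u)\<^sup>2 \<partial>lborel)"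
    by (rule Cauchy_Schwarz_nn_integral) measurable
  moreover have "?r u * (?r u * w u) = ennreal (pois a (y - u)) * w u" for u
    unfolding mult.assoc[symmetric] r ..
  ultimately show ?thesis
    using nn_integral_pois[OF a, of y] by (simp add: power_mult_distrib r)
qed

text \<open>A bound that depends on the range of \<open>\<tau>\<close>; it only serves to make the best constant finite.\<close>

lemma pmean_crude_bound:
  assumes [measurable]: "\<tau> \<in> borel_measurable borel" "w \<in> borel_measurable borel"
    and a: "0 < a" "\<And>y. a \<le> \<tau> y" "\<And>y. \<tau> y \<le> b"
  shows "(\<integral>\<^sup>+y. (pmean \<tau> w y)\<^sup>2 \<partial>lborel) \<le> ennreal ((b / a)\<^sup>2) * (\<integral>\<^sup>+y. (w y)\<^sup>2 \<partial>lborel)"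
proof -
  have b: "b > 0" using a(1) a(2)[of 0] a(3)[of 0] by linarith
  have le: "pois (\<tau> y) x \<le> b / a * pois a x" for x y
  proof -
    have t: "\<tau> y > 0" using a(1) a(2)[of y] by linarith
    have "a\<^sup>2 \<le> (\<tau> y)\<^sup>2" using a by (intro power_mono) auto
    moreover have "a\<^sup>2 + x\<^sup>2 > 0" using a by (auto intro: add_pos_nonneg)
    ultimately have "1 / ((\<tau> y)\<^sup>2 + x\<^sup>2) \<le> 1 / (a\<^sup>2 + x\<^sup>2)"
      by (intro divide_left_mono mult_pos_pos) auto
    moreover have "\<tau> y / pi \<le> b / pi" using a(3)[of y] by (simp add: divide_right_mono)
    ultimately have "\<tau> y / pi * (1 / ((\<tau> y)\<^sup>2 + x\<^sup>2)) \<le> b / pi * (1 / (a\<^sup>2 + x\<^sup>2))"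
      using t b by (intro mult_mono) auto
    then show ?thesis using a by (simp add: pois_def mult_ac)
  qed
  have "(\<integral>\<^sup>+y. (pmean \<tau> w y)\<^sup>2 \<partial>lborel)
    \<le> (\<integral>\<^sup>+y. ennreal ((b / a)\<^sup>2) * (\<integral>\<^sup>+u. ennreal (pois a (y - u)) * (w u)\<^sup>2 \<partial>lborel) \<partial>lborel)"
  proof (rule nn_integral_mono)
    fix y
    have "pmean \<tau> w y \<le> (\<integral>\<^sup>+u. ennreal (b / a) * (ennreal (pois a (y - u)) * w u) \<partial>lborel)"
      unfolding pmean_def
    proof (intro nn_integral_mono)
      fix u
      have "ennreal (pois (\<tau> y) (y - u)) \<le> ennreal (b / a) * ennreal (pois a (y - u))"
        using le[of y "y - u"] a b by (subst ennreal_mult'[symmetric]) (auto intro: ennreal_leI)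
      then show "ennreal (pois (\<tau> y) (y - u)) * w u \<le> ennreal (b / a) * (ennreal (pois a (y - u)) * w u)"
        unfolding mult.assoc[symmetric] by (rule mult_right_mono) simp
    qed
    also have "\<dots> = ennreal (b / a) * (\<integral>\<^sup>+u. ennreal (pois a (y - u)) * w u \<partial>lborel)"
      by (rule nn_integral_cmult) measurable
    finally have "(pmean \<tau> w y)\<^sup>2 \<le> (ennreal (b / a) * (\<integral>\<^sup>+u. ennreal (pois a (y - u)) * w u \<partial>lborel))\<^sup>2"
      by (rule power_mono) simp
    also have "\<dots> = ennreal ((b / a)\<^sup>2) * (\<integral>\<^sup>+u. ennreal (pois a (y - u)) * w u \<partial>lborel)\<^sup>2"
      using a b by (simp add: power_mult_distrib ennreal_power)
    also have "\<dots> \<le> ennreal ((b / a)\<^sup>2) * (\<integral>\<^sup>+u. ennreal (pois a (y - u)) * (w u)\<^sup>2 \<partial>lborel)"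
      using a by (intro mult_left_mono pmean_const_power2_le) auto
    finally show "(pmean \<tau> w y)\<^sup>2 \<le> \<dots>" .
  qed
  also have "\<dots> = ennreal ((b / a)\<^sup>2) * (\<integral>\<^sup>+y. (w y)\<^sup>2 \<partial>lborel)"
    using a(1) by (simp add: nn_integral_cmult pois_schur(1))
  finally show ?thesis .
qed

text \<open>A quadratic form with a symmetrized Poisson kernel of variable width is at most twice the
  corresponding form with the kernel of \<open>pmean \<tau>\<close>.\<close>

lemma pmean_form_le:
  fixes F :: "real \<Rightarrow> real \<Rightarrow> ennreal"
  assumes [measurable]: "\<tau> \<in> borel_measurable borel" "q \<in> borel_measurable borel"
    and F: "\<And>y y'. F y y' \<le> c * (q y * q y' * (ennreal (pois (\<tau> y) (y - y')) + ennreal (pois (\<tau> y') (y' - y))))"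
  shows "(\<integral>\<^sup>+y. \<integral>\<^sup>+y'. F y y' \<partial>lborel \<partial>lborel) \<le> 2 * (c * (\<integral>\<^sup>+y. q y * pmean \<tau> q y \<partial>lborel))"
proof -
  define P where "P = (\<lambda>y u. ennreal (pois (\<tau> y) (y - u)))"
  have Pm[measurable]: "case_prod P \<in> borel_measurable (borel \<Otimes>\<^sub>M borel)"
    unfolding P_def by measurable
  define E where "E = (\<integral>\<^sup>+y. q y * pmean \<tau> q y \<partial>lborel)"
  have half: "(\<integral>\<^sup>+y. \<integral>\<^sup>+y'. c * (q y * (P y y' * q y')) \<partial>lborel \<partial>lborel) = c * E"
  proof -
    have "(\<integral>\<^sup>+y'. c * (q y * (P y y' * q y')) \<partial>lborel) = c * (q y * pmean \<tau> q y)" for y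
      unfolding pmean_def P_def by (subst nn_integral_cmult, measurable, subst nn_integral_cmult) auto
    then show ?thesis unfolding E_def by (simp add: nn_integral_cmult)
  qed
  have "(\<integral>\<^sup>+y. \<integral>\<^sup>+y'. F y y' \<partial>lborel \<partial>lborel)
    \<le> (\<integral>\<^sup>+y. \<integral>\<^sup>+y'. c * (q y * (P y y' * q y')) + c * (q y' * (P y' y * q y)) \<partial>lborel \<partial>lborel)"
    by (intro nn_integral_mono order_trans[OF F]) (simp add: P_def distrib_left mult_ac)
  also have "\<dots> = (\<integral>\<^sup>+y. (\<integral>\<^sup>+y'. c * (q y * (P y y' * q y')) \<partial>lborel) + (\<integral>\<^sup>+y'. c * (q y' * (P y' y * q y)) \<partial>lborel) \<partial>lborel)"
    by (intro nn_integral_cong nn_integral_add) measurable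
  also have "\<dots> = c * E + (\<integral>\<^sup>+y. \<integral>\<^sup>+y'. c * (q y' * (P y' y * q y)) \<partial>lborel \<partial>lborel)"
    by (subst nn_integral_add) (measurable, simp only: half)
  also have "(\<integral>\<^sup>+y. \<integral>\<^sup>+y'. c * (q y' * (P y' y * q y)) \<partial>lborel \<partial>lborel) = (\<integral>\<^sup>+y'. \<integral>\<^sup>+y. c * (q y' * (P y' y * q y)) \<partial>lborel \<partial>lborel)"
    by (rule lborel_pair.Fubini') measurable
  also have "\<dots> = c * E" by (rule half)
  finally show ?thesis by (simp add: E_def mult_2)
qed

text \<open>The \<open>T T*\<close> step. With \<open>q = N w\<close> and \<open>N*\<close> the transposed operator, \<open>\<parallel>q\<parallel>\<^sup>2 = \<langle>w, N* q\<rangle>\<close>,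
  and \<open>\<parallel>N* q\<parallel>\<^sup>2\<close> is a form in \<open>q\<close> whose kernel is a convolution of two Poisson kernels; this is at most
  \<open>32 \<langle>q, N q\<rangle>\<close>, which the given bound on \<open>N\<close> controls.\<close>

lemma pmean_improve:
  assumes [measurable]: "\<tau> \<in> borel_measurable borel" and pos: "\<And>y. \<tau> y > 0"
    and A: "A > 0" "\<And>w. w \<in> borel_measurable borel \<Longrightarrow>
      (\<integral>\<^sup>+y. (pmean \<tau> w y)\<^sup>2 \<partial>lborel) \<le> ennreal A * (\<integral>\<^sup>+y. (w y)\<^sup>2 \<partial>lborel)"
    and w[measurable]: "w \<in> borel_measurable borel"
  shows "(\<integral>\<^sup>+y. (pmean \<tau> w y)\<^sup>2 \<partial>lborel) \<le> ennreal (32 * sqrt A) * (\<integral>\<^sup>+y. (w y)\<^sup>2 \<partial>lborel)"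
proof (cases "(\<integral>\<^sup>+y. (w y)\<^sup>2 \<partial>lborel) = top")
  case True
  then show ?thesis using A(1) by (simp add: ennreal_mult_top)
next
  case False
  define q where "q = pmean \<tau> w"
  have qm[measurable]: "q \<in> borel_measurable borel" unfolding q_def by measurable
  define P where "P = (\<lambda>y u. ennreal (pois (\<tau> y) (y - u)))"
  have Pm[measurable]: "case_prod P \<in> borel_measurable (borel \<Otimes>\<^sub>M borel)"
    unfolding P_def by measurable
  define Ns where "Ns = (\<lambda>u. \<integral>\<^sup>+y. q y * P y u \<partial>lborel)"
  have Nsm[measurable]: "Ns \<in> borel_measurable borel" unfolding Ns_def by measurable
  define S where "S = (\<integral>\<^sup>+y. (w y)\<^sup>2 \<partial>lborel)"
  define Q where "Q = (\<integral>\<^sup>+y. (q y)\<^sup>2 \<partial>lborel)"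
  define E where "E = (\<integral>\<^sup>+y. q y * pmean \<tau> q y \<partial>lborel)"
  have pq: "pmean \<tau> f y = (\<integral>\<^sup>+u. P y u * f u \<partial>lborel)" for f y
    by (simp add: pmean_def P_def)
  have "ennreal A * (\<integral>\<^sup>+y. (w y)\<^sup>2 \<partial>lborel) < top"
    using False by (simp add: less_top[symmetric] ennreal_mult_eq_top_iff)
  then have Qfin: "Q < top"
    using A(2)[OF w] unfolding Q_def q_def by (rule order.strict_trans1[rotated])
  have "Q = (\<integral>\<^sup>+y. \<integral>\<^sup>+u. w u * (q y * P y u) \<partial>lborel \<partial>lborel)"
  proof -
    have "(q y)\<^sup>2 = (\<integral>\<^sup>+u. w u * (q y * P y u) \<partial>lborel)" for y
    proof -
      have "(q y)\<^sup>2 = q y * (\<integral>\<^sup>+u. P y u * w u \<partial>lborel)"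
        by (simp add: power2_eq_square q_def pq)
      also have "\<dots> = (\<integral>\<^sup>+u. q y * (P y u * w u) \<partial>lborel)"
        by (rule nn_integral_cmult[symmetric]) measurable
      finally show ?thesis by (simp add: mult_ac)
    qed
    then show ?thesis by (simp add: Q_def)
  qed
  also have "\<dots> = (\<integral>\<^sup>+u. \<integral>\<^sup>+y. w u * (q y * P y u) \<partial>lborel \<partial>lborel)"
    by (rule lborel_pair.Fubini') measurable
  also have "\<dots> = (\<integral>\<^sup>+u. w u * Ns u \<partial>lborel)"
    unfolding Ns_def by (intro nn_integral_cong nn_integral_cmult) measurable
  finally have "Q\<^sup>2 \<le> S * (\<integral>\<^sup>+u. (Ns u)\<^sup>2 \<partial>lborel)"
    unfolding S_def by (simp add: Cauchy_Schwarz_nn_integral)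
  also have "(\<integral>\<^sup>+u. (Ns u)\<^sup>2 \<partial>lborel) \<le> 32 * E"
  proof -
    have "(\<integral>\<^sup>+u. (Ns u)\<^sup>2 \<partial>lborel) = (\<integral>\<^sup>+u. \<integral>\<^sup>+y. \<integral>\<^sup>+y'. (q y * P y u) * (q y' * P y' u) \<partial>lborel \<partial>lborel \<partial>lborel)"
    proof (rule nn_integral_cong)
      fix u
      have "(\<integral>\<^sup>+y. \<integral>\<^sup>+y'. (q y * P y u) * (q y' * P y' u) \<partial>lborel \<partial>lborel) = (\<integral>\<^sup>+y. (q y * P y u) * Ns u \<partial>lborel)"
        unfolding Ns_def by (intro nn_integral_cong nn_integral_cmult) measurable
      also have "\<dots> = Ns u * Ns u"
        by (subst nn_integral_multc) (auto simp: Ns_def)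
      finally show "(Ns u)\<^sup>2 = (\<integral>\<^sup>+y. \<integral>\<^sup>+y'. (q y * P y u) * (q y' * P y' u) \<partial>lborel \<partial>lborel)"
        by (simp add: power2_eq_square)
    qed
    also have "\<dots> = (\<integral>\<^sup>+y. \<integral>\<^sup>+u. \<integral>\<^sup>+y'. (q y * P y u) * (q y' * P y' u) \<partial>lborel \<partial>lborel \<partial>lborel)"
      by (rule lborel_pair.Fubini') measurable
    also have "\<dots> = (\<integral>\<^sup>+y. \<integral>\<^sup>+y'. \<integral>\<^sup>+u. (q y * P y u) * (q y' * P y' u) \<partial>lborel \<partial>lborel \<partial>lborel)"
      by (intro nn_integral_cong lborel_pair.Fubini') measurable
    also have "\<dots> \<le> 2 * (16 * E)"
      unfolding E_def
    proof (rule pmean_form_le)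
      fix y y'
      have nn: "pois (\<tau> y) (y - y') \<ge> 0" "pois (\<tau> y') (y - y') \<ge> 0"
        using pos[of y] pos[of y'] by (simp_all add: pois_nonneg)
      have "(\<integral>\<^sup>+u. (q y * P y u) * (q y' * P y' u) \<partial>lborel) = (\<integral>\<^sup>+u. (q y * q y') * ennreal (pois (\<tau> y) (y - u) * pois (\<tau> y') (y' - u)) \<partial>lborel)"
        using pos by (intro nn_integral_cong) (simp add: P_def ennreal_mult' pois_nonneg less_imp_le mult_ac)
      also have "\<dots> = (q y * q y') * (\<integral>\<^sup>+u. ennreal (pois (\<tau> y) (y - u) * pois (\<tau> y') (y' - u)) \<partial>lborel)"
        by (rule nn_integral_cmult) measurable
      also have "\<dots> \<le> (q y * q y') * ennreal (16 * (pois (\<tau> y) (y - y') + pois (\<tau> y') (y - y')))"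
        using pos by (intro mult_left_mono pois_conv_le) auto
      also have "ennreal (16 * (pois (\<tau> y) (y - y') + pois (\<tau> y') (y - y'))) = 16 * (ennreal (pois (\<tau> y) (y - y')) + ennreal (pois (\<tau> y') (y' - y)))"
      proof -
        have "pois (\<tau> y') (y' - y) = pois (\<tau> y') (y - y')" by (simp add: pois_def power2_commute)
        then show ?thesis using nn by (simp add: ennreal_mult')
      qed
      finally show "(\<integral>\<^sup>+u. (q y * P y u) * (q y' * P y' u) \<partial>lborel)
        \<le> 16 * (q y * q y' * (ennreal (pois (\<tau> y) (y - y')) + ennreal (pois (\<tau> y') (y' - y))))"
        by (simp only: mult.left_commute)
    qed measurable
    also have "2 * (16 * E) = 32 * E"
      by (simp only: mult.assoc[symmetric]) simp
    finally show ?thesis .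
  qed
  also have "E \<le> ennreal (sqrt A) * Q"
  proof (rule ennreal_le_if_power2_le)
    have "E\<^sup>2 \<le> Q * (\<integral>\<^sup>+y. (pmean \<tau> q y)\<^sup>2 \<partial>lborel)"
      unfolding E_def Q_def by (rule Cauchy_Schwarz_nn_integral) measurable
    also have "\<dots> \<le> Q * (ennreal A * Q)"
      unfolding Q_def by (intro mult_left_mono A(2)) auto
    also have "\<dots> = (ennreal (sqrt A) * Q)\<^sup>2"
      using A(1) by (simp add: power_mult_distrib ennreal_power) (simp add: power2_eq_square mult_ac)
    finally show "E\<^sup>2 \<le> (ennreal (sqrt A) * Q)\<^sup>2" .
  qed
  also have "S * (32 * (ennreal (sqrt A) * Q)) = (ennreal (32 * sqrt A) * S) * Q"
    using A(1) by (simp add: ennreal_mult' mult_ac)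
  finally have "Q\<^sup>2 \<le> (ennreal (32 * sqrt A) * S) * Q"
    by (simp add: mult_left_mono)
  from ennreal_le_if_power2_le_mult[OF this Qfin] show ?thesis
    by (simp add: Q_def q_def S_def)
qed

lemma pmean_bound:
  assumes [measurable]: "\<tau> \<in> borel_measurable borel" "w \<in> borel_measurable borel"
    and a: "0 < a" "\<And>y. a \<le> \<tau> y" "\<And>y. \<tau> y \<le> b"
  shows "(\<integral>\<^sup>+y. (pmean \<tau> w y)\<^sup>2 \<partial>lborel) \<le> ennreal 1025 * (\<integral>\<^sup>+y. (w y)\<^sup>2 \<partial>lborel)"
proof -
  define ok where "ok = (\<lambda>A. A > 0 \<and> (\<forall>w. w \<in> borel_measurable borel \<longrightarrow>
     (\<integral>\<^sup>+y. (pmean \<tau> w y)\<^sup>2 \<partial>lborel) \<le> ennreal A * (\<integral>\<^sup>+y. (w y)\<^sup>2 \<partial>lborel)))"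
  have pos: "\<tau> y > 0" for y using a(1) a(2)[of y] by linarith
  have "b > 0" using pos[of 0] a(3)[of 0] by linarith
  then have ok0: "ok ((b / a)\<^sup>2)"
    using pmean_crude_bound[OF _ _ a] a(1) by (auto simp: ok_def)
  have step: "ok A \<Longrightarrow> ok (32 * sqrt A)" for A
    using pmean_improve[of \<tau> A] pos by (auto simp: ok_def)
  \<comment> \<open>The best constant cannot exceed 1024, the fixed point of the improvement step.\<close>
  define m where "m = Inf {A. ok A}"
  have bdd: "bdd_below {A. ok A}" by (rule bdd_belowI[of _ 0]) (auto simp: ok_def)
  have m0: "m \<ge> 0" unfolding m_def
  proof (rule cInf_greatest)
    show "{A. ok A} \<noteq> {}" using ok0 by blast
  qed (simp add: ok_def)
  have "m\<^sup>2 / 1024 \<le> m"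
    unfolding m_def
  proof (rule cInf_greatest)
    show "{A. ok A} \<noteq> {}" using ok0 by blast
    fix A assume A: "A \<in> {A. ok A}"
    then have "m \<le> 32 * sqrt A" unfolding m_def using step bdd by (intro cInf_lower) auto
    then have "m\<^sup>2 \<le> (32 * sqrt A)\<^sup>2" using m0 by (intro power_mono) auto
    then show "(Inf {A. ok A})\<^sup>2 / 1024 \<le> A" using A by (simp add: power_mult_distrib m_def ok_def)
  qed
  then have "m * m \<le> 1024 * m" by (simp add: power2_eq_square)
  then have "m \<le> 1024" using m0 by (cases "m = 0") auto
  then have "Inf {A. ok A} < 1025" by (simp add: m_def)
  then obtain A where "ok A" "A < 1025"
    using ok0 by (subst (asm) cInf_less_iff) (auto simp: bdd)
  then have "(\<integral>\<^sup>+y. (pmean \<tau> w y)\<^sup>2 \<partial>lborel) \<le> ennreal A * (\<integral>\<^sup>+y. (w y)\<^sup>2 \<partial>lborel)"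
    by (auto simp: ok_def)
  also have "\<dots> \<le> ennreal 1025 * (\<integral>\<^sup>+y. (w y)\<^sup>2 \<partial>lborel)"
    using \<open>A < 1025\<close> by (intro mult_right_mono ennreal_leI) auto
  finally show ?thesis .
qed

section \<open>The maximal inequality for damped Fourier integrals\<close>

lemma damped_kernel_le_pmean:
  fixes u :: "real \<Rightarrow> complex"
  assumes [measurable]: "\<tau> \<in> borel_measurable borel" "u \<in> borel_measurable borel" and pos: "\<And>y. \<tau> y > 0"
  shows "(\<integral>\<^sup>+y. \<integral>\<^sup>+y'. ennreal (cmod (u y) * cmod (u y') * pois (\<tau> y + \<tau> y') (y - y')) \<partial>lborel \<partial>lborel)
    \<le> 4 * (\<integral>\<^sup>+y. ennreal (cmod (u y)) * pmean \<tau> (\<lambda>y. ennreal (cmod (u y))) y \<partial>lborel)"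
proof -
  have "(\<integral>\<^sup>+y. \<integral>\<^sup>+y'. ennreal (cmod (u y) * cmod (u y') * pois (\<tau> y + \<tau> y') (y - y')) \<partial>lborel \<partial>lborel)
    \<le> 2 * (2 * (\<integral>\<^sup>+y. ennreal (cmod (u y)) * pmean \<tau> (\<lambda>y. ennreal (cmod (u y))) y \<partial>lborel))"
  proof (rule pmean_form_le)
    fix y y'
    have nn: "pois (\<tau> y) (y - y') \<ge> 0" "pois (\<tau> y') (y' - y) \<ge> 0"
      using pos[of y] pos[of y'] by (simp_all add: pois_nonneg)
    have "pois (\<tau> y') (y' - y) = pois (\<tau> y') (y - y')" by (simp add: pois_def power2_commute)
    then have "pois (\<tau> y + \<tau> y') (y - y') \<le> 2 * (pois (\<tau> y) (y - y') + pois (\<tau> y') (y' - y))"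
      using pois_add_le[OF pos pos, of y' y "y - y'"] by (simp add: add.commute)
    then have "ennreal (cmod (u y) * cmod (u y') * pois (\<tau> y + \<tau> y') (y - y'))
       \<le> ennreal (cmod (u y) * cmod (u y') * (2 * (pois (\<tau> y) (y - y') + pois (\<tau> y') (y' - y))))"
      by (intro ennreal_leI mult_left_mono) auto
    also have "\<dots> = 2 * (ennreal (cmod (u y)) * ennreal (cmod (u y')) * (ennreal (pois (\<tau> y) (y - y')) + ennreal (pois (\<tau> y') (y' - y))))"
      using nn by (simp add: ennreal_mult' distrib_left mult_ac)
    finally show "ennreal (cmod (u y) * cmod (u y') * pois (\<tau> y + \<tau> y') (y - y')) \<le> \<dots>" .
  qed measurable
  then show ?thesis by (simp add: mult.assoc[symmetric])
qed

text \<open>Duality: \<open>\<parallel>u\<parallel>\<^sup>2\<close>, for the damped integral \<open>u\<close> cut off to a bounded interval, is a pairing of \<open>h\<close>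
  with a damped transform of \<open>u\<close>, to which the bounds on the kernel and on \<open>pmean\<close> apply.
  The cutoff makes \<open>u\<close> integrable. The constant is \<open>132 = 4 * 33\<close>, where \<open>33\<^sup>2 \<ge> 1025\<close>.\<close>

lemma maximal_1d_interval:
  fixes h :: "real \<Rightarrow> complex"
  assumes h: "integrable lborel h" and \<tau>[measurable]: "\<tau> \<in> borel_measurable borel"
    and a: "0 < a" "\<And>y. a \<le> \<tau> y" "\<And>y. \<tau> y \<le> b"
  shows "l2sq (\<lambda>y. indicator {- r..r} y * (LINT \<eta>|lborel. damp (\<tau> y) \<eta> * h \<eta> * ch (y * \<eta>)))
    \<le> 132 * l2sq h"
proof -
  have hm[measurable]: "h \<in> borel_measurable borel" using h by auto
  define k where "k = (\<lambda>y \<eta>. damp (\<tau> y) \<eta> * h \<eta> * ch (y * \<eta>))"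
  have km[measurable]: "case_prod k \<in> borel_measurable (borel \<Otimes>\<^sub>M borel)"
    unfolding k_def by measurable
  define U where "U = (\<lambda>y. LINT \<eta>|lborel. k y \<eta>)"
  have Um[measurable]: "U \<in> borel_measurable borel" unfolding U_def by measurable
  define u where "u = (\<lambda>y. indicator {- r..r} y * U y)"
  have um[measurable]: "u \<in> borel_measurable borel" unfolding u_def by measurable
  have pos: "\<tau> y > 0" for y using a(1) a(2)[of y] by linarith
  have nk: "cmod (k y \<eta>) \<le> cmod (h \<eta>)" for y \<eta>
    using pos[of y] by (auto simp: k_def norm_mult intro!: mult_left_le_one_le)
  have ik: "integrable lborel (k y)" for y
    by (rule Bochner_Integration.integrable_bound[OF h]) (auto simp: nk)
  define H where "H = (LINT \<eta>|lborel. cmod (h \<eta>))"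
  have H0: "H \<ge> 0" by (simp add: H_def)
  have UH: "cmod (U y) \<le> H" for y
    unfolding U_def H_def
    by (rule order_trans[OF integral_norm_bound integral_mono]) (use ik nk h in auto)
  have bnd: "integrable lborel (\<lambda>y. indicator {- r..r} y *\<^sub>R (c::real))" for c
    by (intro integrable_scaleR_left integrable_real_indicator) (auto simp: emeasure_lborel_Icc_eq)
  have ui: "integrable lborel u"
    by (rule Bochner_Integration.integrable_bound[OF bnd[of H]])
       (use UH H0 in \<open>auto simp: u_def norm_mult indicator_def\<close>)
  have u2i: "integrable lborel (\<lambda>y. (cmod (u y))\<^sup>2)"
    by (rule Bochner_Integration.integrable_bound[OF bnd[of "H\<^sup>2"]])
       (use UH H0 in \<open>auto simp: u_def norm_mult indicator_def intro!: power_mono\<close>)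
  \<comment> \<open>The dual object: pairing the truncated integral with itself equals pairing h with W.\<close>
  define W where "W = (\<lambda>\<eta>. LINT y|lborel. damp (\<tau> y) \<eta> * cnj (u y) * ch (y * \<eta>))"
  have Wm[measurable]: "W \<in> borel_measurable borel" unfolding W_def by measurable
  define F where "F = (\<lambda>(y, \<eta>). cnj (u y) * k y \<eta>)"
  have Fm[measurable]: "F \<in> borel_measurable borel"
    unfolding F_def by (rule measurable_borel_pairI) measurable
  have Fi: "integrable lborel F"
  proof (rule integrable_lborel_pairI[OF Fm])
    have "(\<integral>\<^sup>+y. \<integral>\<^sup>+\<eta>. ennreal (norm (F (y, \<eta>))) \<partial>lborel \<partial>lborel)
      \<le> (\<integral>\<^sup>+y. \<integral>\<^sup>+\<eta>. ennreal (cmod (u y)) * ennreal (cmod (h \<eta>)) \<partial>lborel \<partial>lborel)"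
      using nk by (intro nn_integral_mono)
        (auto simp: F_def norm_mult ennreal_mult'[symmetric] intro!: ennreal_leI mult_left_mono)
    also have "\<dots> = (\<integral>\<^sup>+y. ennreal (cmod (u y)) \<partial>lborel) * (\<integral>\<^sup>+\<eta>. ennreal (cmod (h \<eta>)) \<partial>lborel)"
      by (simp add: nn_integral_cmult nn_integral_multc)
    also have "\<dots> < \<infinity>" using h ui by (simp add: integrable_iff_bounded ennreal_mult_less_top)
    finally show "(\<integral>\<^sup>+y. \<integral>\<^sup>+\<eta>. ennreal (norm (F (y, \<eta>))) \<partial>lborel \<partial>lborel) < \<infinity>" .
  qed
  have F1: "(LINT \<eta>|lborel. F (y, \<eta>)) = of_real ((cmod (u y))\<^sup>2)" for y
  proof -
    have "(LINT \<eta>|lborel. F (y, \<eta>)) = cnj (u y) * U y" by (simp add: F_def U_def)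
    also have "\<dots> = u y * cnj (u y)" by (auto simp: u_def indicator_def)
    finally show ?thesis by (simp only: complex_norm_square)
  qed
  have F2: "(LINT y|lborel. F (y, \<eta>)) = h \<eta> * W \<eta>" for \<eta>
  proof -
    have "(LINT y|lborel. F (y, \<eta>)) = (LINT y|lborel. h \<eta> * (damp (\<tau> y) \<eta> * cnj (u y) * ch (y * \<eta>)))"
      by (simp add: F_def k_def mult_ac)
    then show ?thesis by (simp add: W_def)
  qed
  have hWi: "integrable lborel (\<lambda>\<eta>. h \<eta> * W \<eta>)"
  proof -
    have "integrable (lborel \<Otimes>\<^sub>M lborel) (case_prod (\<lambda>x y. F (x, y)))" using Fi by (simp add: lborel_prod)
    from lborel_pair.integrable_snd[OF this] show ?thesis by (simp add: F2)
  qed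
  define S where "S = l2sq u"
  have "S = ennreal (LINT y|lborel. (cmod (u y))\<^sup>2)"
    unfolding S_def l2sq_def using u2i by (intro nn_integral_eq_integral) auto
  also have "(LINT y|lborel. (cmod (u y))\<^sup>2) = cmod (LINT y|lborel. complex_of_real ((cmod (u y))\<^sup>2))"
    unfolding integral_complex_of_real by (simp add: integral_nonneg_AE)
  also have "(LINT y|lborel. complex_of_real ((cmod (u y))\<^sup>2)) = (LINT \<eta>|lborel. h \<eta> * W \<eta>)"
    using integral_lborel_pair[OF Fi] by (simp add: F1 F2)
  also have "ennreal (cmod \<dots>) \<le> (\<integral>\<^sup>+\<eta>. ennreal (cmod (h \<eta> * W \<eta>)) \<partial>lborel)"
    by (rule integral_norm_bound_ennreal[OF hWi])
  finally have "S\<^sup>2 \<le> (\<integral>\<^sup>+\<eta>. ennreal (cmod (h \<eta>) * cmod (W \<eta>)) \<partial>lborel)\<^sup>2"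
    by (auto simp: norm_mult intro: power_mono)
  also have "\<dots> \<le> l2sq h * l2sq W"
    unfolding l2sq_def by (rule cauchy_schwarz_norm) measurable
  also have "l2sq W \<le> 4 * (\<integral>\<^sup>+y. ennreal (cmod (u y)) * pmean \<tau> (\<lambda>y. ennreal (cmod (u y))) y \<partial>lborel)"
  proof -
    have "l2sq W \<le> (\<integral>\<^sup>+y. \<integral>\<^sup>+y'. ennreal (cmod (u y) * cmod (u y') * pois (\<tau> y + \<tau> y') (y - y')) \<partial>lborel \<partial>lborel)"
      using l2sq_damped_transform_le[of "\<lambda>y. cnj (u y)", OF _ \<tau> a(1,2)] ui by (simp add: W_def)
    also note damped_kernel_le_pmean[OF \<tau> um pos]
    finally show ?thesis .
  qed
  also have "(\<integral>\<^sup>+y. ennreal (cmod (u y)) * pmean \<tau> (\<lambda>y. ennreal (cmod (u y))) y \<partial>lborel) \<le> 33 * S"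
  proof (rule ennreal_le_if_power2_le)
    have "(\<integral>\<^sup>+y. ennreal (cmod (u y)) * pmean \<tau> (\<lambda>y. ennreal (cmod (u y))) y \<partial>lborel)\<^sup>2
      \<le> (\<integral>\<^sup>+y. (ennreal (cmod (u y)))\<^sup>2 \<partial>lborel) * (\<integral>\<^sup>+y. (pmean \<tau> (\<lambda>y. ennreal (cmod (u y))) y)\<^sup>2 \<partial>lborel)"
      by (rule Cauchy_Schwarz_nn_integral) measurable
    also have "\<dots> \<le> S * (ennreal 1025 * S)"
      unfolding S_def l2sq_eq_power2 by (intro mult_left_mono pmean_bound[OF _ _ a]) auto
    also have "\<dots> = 1025 * S\<^sup>2" by (simp add: power2_eq_square mult_ac)
    also have "\<dots> \<le> 1089 * S\<^sup>2"
      by (intro mult_right_mono) auto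
    also have "\<dots> = (33 * S)\<^sup>2" by (simp add: power_mult_distrib)
    finally show "(\<integral>\<^sup>+y. ennreal (cmod (u y)) * pmean \<tau> (\<lambda>y. ennreal (cmod (u y))) y \<partial>lborel)\<^sup>2 \<le> (33 * S)\<^sup>2" .
  qed
  finally have "S\<^sup>2 \<le> l2sq h * (4 * (33 * S))"
    by (simp add: mult_left_mono)
  also have "l2sq h * (4 * (33 * S)) = (132 * l2sq h) * S"
  proof -
    have "4 * (33 * S) = (4 * 33) * S" by (simp only: mult.assoc)
    then show ?thesis by (simp add: mult_ac)
  qed
  finally have "S\<^sup>2 \<le> (132 * l2sq h) * S" .
  moreover have "S < top"
    using \<open>S = ennreal (LINT y|lborel. (cmod (u y))\<^sup>2)\<close> by simp
  ultimately have "S \<le> 132 * l2sq h" by (rule ennreal_le_if_power2_le_mult)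
  then show ?thesis by (simp add: S_def u_def U_def k_def)
qed

lemma maximal_1d:
  fixes h :: "real \<Rightarrow> complex"
  assumes h: "integrable lborel h" and \<tau>[measurable]: "\<tau> \<in> borel_measurable borel"
    and a: "0 < a" "\<And>y. a \<le> \<tau> y" "\<And>y. \<tau> y \<le> b"
  shows "l2sq (\<lambda>y. LINT \<eta>|lborel. damp (\<tau> y) \<eta> * h \<eta> * ch (y * \<eta>)) \<le> 132 * l2sq h"
proof -
  have [measurable]: "h \<in> borel_measurable borel" using h by auto
  define U where "U = (\<lambda>y. LINT \<eta>|lborel. damp (\<tau> y) \<eta> * h \<eta> * ch (y * \<eta>))"
  have Um[measurable]: "U \<in> borel_measurable borel" unfolding U_def by measurable
  define u where "u = (\<lambda>n y. indicator {- real n..real n} y * U y)"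
  have "l2sq U = (\<integral>\<^sup>+y. liminf (\<lambda>n. ennreal ((cmod (u n y))\<^sup>2)) \<partial>lborel)"
    unfolding l2sq_def
  proof (rule nn_integral_cong)
    fix y
    have "\<forall>\<^sub>F n in sequentially. ennreal ((cmod (U y))\<^sup>2) = ennreal ((cmod (u n y))\<^sup>2)"
      using eventually_ge_at_top[of "nat \<lceil>\<bar>y\<bar>\<rceil>"]
    proof eventually_elim
      case (elim n)
      then have "\<bar>y\<bar> \<le> real n" by linarith
      then show ?case by (auto simp: u_def indicator_def)
    qed
    then have "(\<lambda>n. ennreal ((cmod (u n y))\<^sup>2)) \<longlonglongrightarrow> ennreal ((cmod (U y))\<^sup>2)"
      by (rule Lim_transform_eventually[rotated]) simp
    then show "ennreal ((cmod (U y))\<^sup>2) = liminf (\<lambda>n. ennreal ((cmod (u n y))\<^sup>2))"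
      by (intro lim_imp_Liminf[symmetric]) auto
  qed
  also have "\<dots> \<le> liminf (\<lambda>n. l2sq (u n))"
    unfolding l2sq_def by (intro nn_integral_liminf) (simp add: u_def)
  also have "\<dots> \<le> 132 * l2sq h"
    unfolding u_def U_def using maximal_1d_interval[OF h \<tau> a] by (intro Liminf_le always_eventually allI) auto
  finally show ?thesis by (simp add: U_def)
qed

text \<open>A measurable choice of the maximizing parameter, by which a maximal function over finitely many
  parameters becomes a single operator.\<close>

lemma measurable_argmax:
  fixes G :: "real \<Rightarrow> real \<Rightarrow> real"
  assumes "finite T" "T \<noteq> {}" "\<And>t. t \<in> T \<Longrightarrow> G t \<in> borel_measurable borel"
  shows "\<exists>\<tau>\<in>borel_measurable borel. \<forall>y. \<tau> y \<in> T \<and> (\<forall>t\<in>T. G t y \<le> G (\<tau> y) y)"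
  using assms
proof (induction rule: finite_ne_induct)
  case (singleton t)
  show ?case by (intro bexI[of _ "\<lambda>_. t"]) auto
next
  case (insert a T)
  then obtain \<tau> where \<tau>: "\<tau> \<in> borel_measurable borel" "\<And>y. \<tau> y \<in> T" "\<And>y t. t \<in> T \<Longrightarrow> G t y \<le> G (\<tau> y) y"
    by auto
  note [measurable] = \<tau>(1) insert.prems
  have [measurable]: "G t \<in> borel_measurable borel" if "t \<in> T" for t using insert.prems that by auto
  define \<sigma> where "\<sigma> = (\<lambda>y. if \<forall>t\<in>T. G t y \<le> G a y then a else \<tau> y)"
  have "{y. \<forall>t\<in>T. G t y \<le> G a y} = space borel \<inter> (\<Inter>t\<in>T. {y \<in> space borel. G t y \<le> G a y})" by auto
  also have "\<dots> \<in> sets borel"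
    using insert.hyps by (intro sets.Int sets.finite_INT borel_measurable_le) (auto intro: insert.prems)
  finally have [measurable]: "Measurable.pred borel (\<lambda>y. \<forall>t\<in>T. G t y \<le> G a y)"
    by (simp add: pred_def)
  have "\<sigma> \<in> borel_measurable borel" unfolding \<sigma>_def by measurable
  moreover have "\<sigma> y \<in> insert a T" for y using \<tau>(2) by (auto simp: \<sigma>_def)
  moreover have "G t y \<le> G (\<sigma> y) y" if "t \<in> insert a T" for t y
    using that \<tau>(3)[of _ y] by (auto simp: \<sigma>_def intro: order_trans less_imp_le) (metis le_cases order_trans)
  ultimately show ?case by blast
qed

lemma maximal_1d_SUP:
  fixes h :: "real \<Rightarrow> complex"
  assumes h: "integrable lborel h" and T: "finite T" "T \<subseteq> {0<..}"
  shows "(\<integral>\<^sup>+y. (SUP t\<in>T. ennreal ((cmod (LINT \<eta>|lborel. damp t \<eta> * h \<eta> * ch (y * \<eta>)))\<^sup>2)) \<partial>lborel)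
    \<le> 132 * l2sq h"
proof (cases "T = {}")
  case False
  have [measurable]: "h \<in> borel_measurable borel" using h by auto
  define U where "U = (\<lambda>t y. LINT \<eta>|lborel. damp t \<eta> * h \<eta> * ch (y * \<eta>))"
  have [measurable]: "U t \<in> borel_measurable borel" for t unfolding U_def by measurable
  from measurable_argmax[OF T(1) False, of "\<lambda>t y. cmod (U t y)"]
  obtain \<tau> where \<tau>: "\<tau> \<in> borel_measurable borel" "\<And>y. \<tau> y \<in> T" "\<And>y t. t \<in> T \<Longrightarrow> cmod (U t y) \<le> cmod (U (\<tau> y) y)"
    by auto
  have "(\<integral>\<^sup>+y. (SUP t\<in>T. ennreal ((cmod (U t y))\<^sup>2)) \<partial>lborel) \<le> l2sq (\<lambda>y. U (\<tau> y) y)"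
    unfolding l2sq_def by (intro nn_integral_mono SUP_least ennreal_leI power_mono \<tau>(3)) auto
  also have "\<dots> \<le> 132 * l2sq h"
    unfolding U_def
  proof (rule maximal_1d[OF h \<tau>(1)])
    show "0 < Min T" using T False by auto
    show "Min T \<le> \<tau> y" "\<tau> y \<le> Max T" for y using \<tau>(2) T by auto
  qed
  finally show ?thesis by (simp add: U_def)
qed (simp add: bot_ennreal)

section \<open>Fourier integrals on the plane\<close>

text \<open>The inverse Fourier integral on the plane.\<close>

definition ift :: "(real \<times> real \<Rightarrow> complex) \<Rightarrow> real \<times> real \<Rightarrow> complex" where
  "ift g z = (LINT \<zeta>|lborel. g \<zeta> * ch (fst z * fst \<zeta> + snd z * snd \<zeta>))"

lemma l2sq_lborel_pair:
  fixes F :: "real \<times> real \<Rightarrow> complex"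
  assumes [measurable]: "F \<in> borel_measurable borel"
  shows "l2sq F = (\<integral>\<^sup>+x. l2sq (\<lambda>y. F (x, y)) \<partial>lborel)" "l2sq F = (\<integral>\<^sup>+y. l2sq (\<lambda>x. F (x, y)) \<partial>lborel)"
  unfolding l2sq_def by (subst nn_integral_lborel_pair(1) nn_integral_lborel_pair(2); simp)+

lemma measurable_ift [measurable]:
  assumes [measurable]: "g \<in> borel_measurable borel"
  shows "ift g \<in> borel_measurable borel"
  unfolding ift_def
proof (rule lborel.borel_measurable_lebesgue_integral)
  have "(\<lambda>(x, y). g y * ch (fst x * fst y + snd x * snd y)) \<in> borel_measurable (borel \<Otimes>\<^sub>M lborel)"
    by measurable
  then show "(\<lambda>(x, y). g y * ch (fst x * fst y + snd x * snd y)) \<in> borel_measurable (borel \<Otimes>\<^sub>M lborel)" .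
qed

text \<open>The Fourier integral in the first variable only.\<close>

definition pft :: "(real \<times> real \<Rightarrow> complex) \<Rightarrow> real \<Rightarrow> real \<Rightarrow> complex" where
  "pft g x \<eta> = (LINT \<xi>|lborel. g (\<xi>, \<eta>) * ch (x * \<xi>))"

lemma measurable_pft [measurable]:
  assumes [measurable]: "g \<in> borel_measurable borel"
  shows "case_prod (pft g) \<in> borel_measurable (borel \<Otimes>\<^sub>M borel)" "pft g x \<in> borel_measurable borel"
  unfolding pft_def by measurable

lemma
  assumes g: "integrable lborel g"
  shows integrable_pft: "integrable lborel (pft g x)"
    and ift_eq_pft: "ift g (x, y) = (LINT \<eta>|lborel. pft g x \<eta> * ch (y * \<eta>))"
proof -
  have [measurable]: "g \<in> borel_measurable borel" using g by auto
  have *: "integrable lborel (\<lambda>\<zeta>. ch (x * fst \<zeta> + y * snd \<zeta>) * g \<zeta>)" for y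
    by (rule integrable_mult_bounded[OF g, where c = 1]) auto
  then have i: "integrable lborel (\<lambda>\<zeta>. g \<zeta> * ch (x * fst \<zeta> + y * snd \<zeta>))" for y
    by (simp add: mult.commute)
  have eq: "(LINT \<xi>|lborel. g (\<xi>, \<eta>) * ch (x * \<xi> + y * \<eta>)) = pft g x \<eta> * ch (y * \<eta>)" for y \<eta>
    by (simp add: pft_def ch_add mult.assoc[symmetric])
  show "ift g (x, y) = (LINT \<eta>|lborel. pft g x \<eta> * ch (y * \<eta>))"
    using integral_lborel_pair(2)[OF i[of y]] by (simp add: ift_def eq)
  have "integrable (lborel \<Otimes>\<^sub>M lborel) (case_prod (\<lambda>a b. g (a, b) * ch (x * a + 0 * b)))"
    using i[of 0] by (simp add: lborel_prod split_beta')
  from lborel_pair.integrable_snd[OF this] show "integrable lborel (pft g x)"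
    by (simp add: pft_def[abs_def])
qed

lemma l2sq_pft_le:
  assumes [measurable]: "g \<in> borel_measurable borel"
  shows "(\<integral>\<^sup>+x. l2sq (pft g x) \<partial>lborel) \<le> l2sq g"
proof -
  have "(\<integral>\<^sup>+x. l2sq (pft g x) \<partial>lborel) = (\<integral>\<^sup>+\<eta>. l2sq (\<lambda>x. pft g x \<eta>) \<partial>lborel)"
    unfolding l2sq_def by (rule lborel_pair.Fubini') measurable
  also have "\<dots> \<le> (\<integral>\<^sup>+\<eta>. l2sq (\<lambda>\<xi>. g (\<xi>, \<eta>)) \<partial>lborel)"
  proof (rule nn_integral_mono)
    fix \<eta>
    show "l2sq (\<lambda>x. pft g x \<eta>) \<le> l2sq (\<lambda>\<xi>. g (\<xi>, \<eta>))"
      using plancherel_1d[of "\<lambda>\<xi>. g (\<xi>, \<eta>)"] by (simp add: pft_def mult.commute)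
  qed
  finally show ?thesis by (simp add: l2sq_lborel_pair(2))
qed

lemma plancherel_2d:
  assumes g: "integrable lborel g"
  shows "l2sq (ift g) \<le> l2sq g"
proof -
  have [measurable]: "g \<in> borel_measurable borel" using g by auto
  have "l2sq (ift g) = (\<integral>\<^sup>+x. l2sq (\<lambda>y. ift g (x, y)) \<partial>lborel)"
    by (rule l2sq_lborel_pair) measurable
  also have "\<dots> \<le> (\<integral>\<^sup>+x. l2sq (pft g x) \<partial>lborel)"
  proof (rule nn_integral_mono)
    fix x
    show "l2sq (\<lambda>y. ift g (x, y)) \<le> l2sq (pft g x)"
      using plancherel_1d[of "pft g x"] by (simp add: ift_eq_pft[OF g] mult.commute)
  qed
  also have "\<dots> \<le> l2sq g" by (rule l2sq_pft_le) measurable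
  finally show ?thesis .
qed

lemma maximal_ift_snd:
  assumes g: "integrable lborel g" and T: "finite T" "T \<subseteq> {0<..}"
  shows "(\<integral>\<^sup>+z. (SUP t\<in>T. ennreal ((cmod (ift (\<lambda>\<zeta>. damp t (snd \<zeta>) * g \<zeta>) z))\<^sup>2)) \<partial>lborel)
    \<le> 132 * l2sq g"
proof -
  have [measurable]: "g \<in> borel_measurable borel" using g by auto
  let ?m = "\<lambda>t \<zeta>. damp t (snd \<zeta>) * g \<zeta>"
  have gi: "integrable lborel (?m t)" if "t \<in> T" for t
    using that T by (intro integrable_mult_bounded[OF g, where c = 1]) auto
  have eq: "ift (?m t) (x, y) = (LINT \<eta>|lborel. damp t \<eta> * pft g x \<eta> * ch (y * \<eta>))"
    if "t \<in> T" for t x y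
  proof -
    have "pft (?m t) x \<eta> = damp t \<eta> * pft g x \<eta>" for \<eta>
      by (simp add: pft_def mult.assoc)
    then show ?thesis by (simp only: ift_eq_pft[OF gi[OF that]])
  qed
  have "(\<integral>\<^sup>+z. (SUP t\<in>T. ennreal ((cmod (ift (?m t) z))\<^sup>2)) \<partial>lborel)
    = (\<integral>\<^sup>+x. \<integral>\<^sup>+y. (SUP t\<in>T. ennreal ((cmod (ift (?m t) (x, y)))\<^sup>2)) \<partial>lborel \<partial>lborel)"
    using T by (intro nn_integral_lborel_pair(1) borel_measurable_SUP) (auto intro: countable_finite)
  also have "\<dots> = (\<integral>\<^sup>+x. \<integral>\<^sup>+y. (SUP t\<in>T. ennreal ((cmod (LINT \<eta>|lborel. damp t \<eta> * pft g x \<eta> * ch (y * \<eta>)))\<^sup>2)) \<partial>lborel \<partial>lborel)"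
    by (intro nn_integral_cong SUP_cong refl) (simp only: eq)
  also have "\<dots> \<le> (\<integral>\<^sup>+x. 132 * l2sq (pft g x) \<partial>lborel)"
    by (intro nn_integral_mono maximal_1d_SUP[OF integrable_pft[OF g] T])
  also have "\<dots> = 132 * (\<integral>\<^sup>+x. l2sq (pft g x) \<partial>lborel)"
    unfolding l2sq_def by (rule nn_integral_cmult) measurable
  also have "\<dots> \<le> 132 * l2sq g" by (intro mult_left_mono l2sq_pft_le) auto
  finally show ?thesis .
qed

lemma
  fixes f :: "real \<times> real \<Rightarrow> 'c::{banach, second_countable_topology}"
  shows integrable_swap: "integrable lborel f \<Longrightarrow> integrable lborel (\<lambda>z. f (prod.swap z))"
    and integral_swap: "integrable lborel f \<Longrightarrow> (LINT z|lborel. f (prod.swap z)) = (LINT z|lborel. f z)"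
proof -
  assume f: "integrable lborel f"
  then have f': "integrable (lborel \<Otimes>\<^sub>M lborel) f" by (simp add: lborel_prod)
  show i: "integrable lborel (\<lambda>z. f (prod.swap z))"
    using lborel_pair.integrable_product_swap[OF f'] by (simp add: lborel_prod split_beta' prod.swap_def)
  show "(LINT z|lborel. f (prod.swap z)) = (LINT z|lborel. f z)"
    by (simp add: integral_lborel_pair(1)[OF i] integral_lborel_pair(2)[OF f])
qed

lemma nn_integral_swap:
  fixes f :: "real \<times> real \<Rightarrow> ennreal"
  assumes [measurable]: "f \<in> borel_measurable borel"
  shows "(\<integral>\<^sup>+z. f (prod.swap z) \<partial>lborel) = (\<integral>\<^sup>+z. f z \<partial>lborel)"
proof -
  have "(\<integral>\<^sup>+z. f (prod.swap z) \<partial>lborel) = (\<integral>\<^sup>+x. \<integral>\<^sup>+y. f (prod.swap (x, y)) \<partial>lborel \<partial>lborel)"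
    by (rule nn_integral_lborel_pair(1)) (simp add: prod.swap_def)
  then show ?thesis by (simp add: nn_integral_lborel_pair(2))
qed

lemma maximal_ift_fst:
  assumes g: "integrable lborel g" and T: "finite T" "T \<subseteq> {0<..}"
  shows "(\<integral>\<^sup>+z. (SUP t\<in>T. ennreal ((cmod (ift (\<lambda>\<zeta>. damp t (fst \<zeta>) * g \<zeta>) z))\<^sup>2)) \<partial>lborel)
    \<le> 132 * l2sq g"
proof -
  have [measurable]: "g \<in> borel_measurable borel" using g by auto
  let ?m = "\<lambda>t \<zeta>. damp t (fst \<zeta>) * g \<zeta>"
  let ?n = "\<lambda>t \<zeta>. damp t (snd \<zeta>) * g (prod.swap \<zeta>)"
  have gi: "integrable lborel (?m t)" if "t \<in> T" for t
    using that T by (intro integrable_mult_bounded[OF g, where c = 1]) auto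
  have swap: "ift (?m t) z = ift (?n t) (prod.swap z)" if "t \<in> T" for t z
  proof -
    have "integrable lborel (\<lambda>\<zeta>. ch (fst z * fst \<zeta> + snd z * snd \<zeta>) * ?m t \<zeta>)"
      by (rule integrable_mult_bounded[OF gi[OF that], where c = 1]) auto
    from integral_swap[OF this] show ?thesis
      unfolding ift_def by (simp add: mult.commute add.commute)
  qed
  have gs: "integrable lborel (\<lambda>\<zeta>. g (prod.swap \<zeta>))" by (rule integrable_swap[OF g])
  then have [measurable]: "(\<lambda>\<zeta>. g (prod.swap \<zeta>)) \<in> borel_measurable borel" by auto
  have "(\<integral>\<^sup>+z. (SUP t\<in>T. ennreal ((cmod (ift (?m t) z))\<^sup>2)) \<partial>lborel)
    = (\<integral>\<^sup>+z. (SUP t\<in>T. ennreal ((cmod (ift (?n t) (prod.swap z)))\<^sup>2)) \<partial>lborel)"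
    by (intro nn_integral_cong SUP_cong refl) (simp only: swap)
  also have "\<dots> = (\<integral>\<^sup>+z. (SUP t\<in>T. ennreal ((cmod (ift (?n t) z))\<^sup>2)) \<partial>lborel)"
    using T by (intro nn_integral_swap[where f = "\<lambda>z. SUP t\<in>T. ennreal ((cmod (ift (?n t) z))\<^sup>2)"] borel_measurable_SUP) (auto intro: countable_finite)
  also have "\<dots> \<le> 132 * l2sq (\<lambda>\<zeta>. g (prod.swap \<zeta>))"
    by (rule maximal_ift_snd[OF gs T])
  also have "l2sq (\<lambda>\<zeta>. g (prod.swap \<zeta>)) = l2sq g"
    unfolding l2sq_def by (rule nn_integral_swap[where f = "\<lambda>z. ennreal ((cmod (g z))\<^sup>2)"]) simp
  finally show ?thesis .
qed

section \<open>Dyadic scales and translations\<close>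

lemma
  fixes f :: "'a::euclidean_space \<Rightarrow> 'c::{banach, second_countable_topology}"
  assumes [measurable]: "f \<in> borel_measurable borel"
  shows integral_translate: "(LINT z|lborel. f (c + z)) = (LINT z|lborel. f z)"
    and integrable_translate: "integrable lborel (\<lambda>z. f (c + z)) \<longleftrightarrow> integrable lborel f"
proof -
  have "(LINT z|distr lborel borel ((+) c). f z) = (LINT z|lborel. f (c + z))"
    by (rule integral_distr) auto
  then show "(LINT z|lborel. f (c + z)) = (LINT z|lborel. f z)" by (simp add: lborel_distr_plus)
  have "integrable (distr lborel borel ((+) c)) f \<longleftrightarrow> integrable lborel (\<lambda>z. f (c + z))"
    by (rule integrable_distr_eq) auto
  then show "integrable lborel (\<lambda>z. f (c + z)) \<longleftrightarrow> integrable lborel f" by (simp add: lborel_distr_plus)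
qed

lemma nn_integral_translate:
  fixes f :: "'a::euclidean_space \<Rightarrow> ennreal"
  assumes [measurable]: "f \<in> borel_measurable borel"
  shows "(\<integral>\<^sup>+z. f (c + z) \<partial>lborel) = (\<integral>\<^sup>+z. f z \<partial>lborel)"
proof -
  have "(\<integral>\<^sup>+z. f z \<partial>distr lborel borel ((+) c)) = (\<integral>\<^sup>+z. f (c + z) \<partial>lborel)"
    by (rule nn_integral_distr) auto
  then show ?thesis by (simp add: lborel_distr_plus)
qed

text \<open>The Cauchy--Schwarz inequality with real bounds on the two \<open>L\<^sup>2\<close> norms.\<close>

lemma cauchy_schwarz_le:
  fixes f g :: "'a \<Rightarrow> real"
  assumes [measurable]: "f \<in> borel_measurable M" "g \<in> borel_measurable M"
    and "\<And>x. f x \<ge> 0" "\<And>x. g x \<ge> 0" and b: "\<beta> \<ge> 0" "\<gamma> \<ge> 0"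
    and f: "(\<integral>\<^sup>+x. ennreal ((f x)\<^sup>2) \<partial>M) \<le> ennreal (\<beta>\<^sup>2)"
    and g: "(\<integral>\<^sup>+x. ennreal ((g x)\<^sup>2) \<partial>M) \<le> ennreal (\<gamma>\<^sup>2)"
  shows "(\<integral>\<^sup>+x. ennreal (f x * g x) \<partial>M) \<le> ennreal (\<beta> * \<gamma>)"
proof (rule ennreal_le_if_power2_le)
  have "(\<integral>\<^sup>+x. ennreal (f x * g x) \<partial>M)\<^sup>2 = (\<integral>\<^sup>+x. ennreal (f x) * ennreal (g x) \<partial>M)\<^sup>2"
    using assms by (simp add: ennreal_mult')
  also have "\<dots> \<le> (\<integral>\<^sup>+x. (ennreal (f x))\<^sup>2 \<partial>M) * (\<integral>\<^sup>+x. (ennreal (g x))\<^sup>2 \<partial>M)"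
    by (rule Cauchy_Schwarz_nn_integral) auto
  also have "\<dots> = (\<integral>\<^sup>+x. ennreal ((f x)\<^sup>2) \<partial>M) * (\<integral>\<^sup>+x. ennreal ((g x)\<^sup>2) \<partial>M)"
    using assms by (simp add: ennreal_power)
  also have "\<dots> \<le> ennreal (\<beta>\<^sup>2) * ennreal (\<gamma>\<^sup>2)"
    by (rule mult_mono[OF f g]) auto
  also have "\<dots> = (ennreal (\<beta> * \<gamma>))\<^sup>2"
    using b by (simp add: ennreal_power ennreal_mult'[symmetric] power_mult_distrib)
  finally show "(\<integral>\<^sup>+x. ennreal (f x * g x) \<partial>M)\<^sup>2 \<le> (ennreal (\<beta> * \<gamma>))\<^sup>2" .
qed

text \<open>Dyadic numbers \<open>2^j\<close> with an integer exponent.\<close>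

definition pw :: "int \<Rightarrow> real" where "pw j = 2 powr of_int j"

lemma pw_pos [simp]: "pw j > 0" by (simp add: pw_def)
lemma pw_nonneg [simp]: "pw j \<ge> 0" by (simp add: pw_def)
lemma pw_add: "pw (i + j) = pw i * pw j" by (simp add: pw_def powr_add)
lemma pw_0 [simp]: "pw 0 = 1" by (simp add: pw_def)
lemma pw_1 [simp]: "pw 1 = 2" by (simp add: pw_def)
lemma pw_minus: "pw (- j) = 1 / pw j" by (simp add: pw_def powr_minus_divide)
lemma pw_le_iff [simp]: "pw i \<le> pw j \<longleftrightarrow> i \<le> j" by (simp add: pw_def)
lemma pw_less_iff [simp]: "pw i < pw j \<longleftrightarrow> i < j" by (simp add: pw_def)
lemma pw_neg_nat: "pw (- int n) = (1 / 2) ^ n"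
  by (simp add: pw_def powr_minus powr_realpow power_one_over inverse_eq_divide)

lemma sum_pw_dist_le:
  assumes J: "finite J"
  shows "(\<Sum>i\<in>J. pw (- \<bar>i - j\<bar>)) \<le> 4"
proof -
  have geo: "(\<Sum>n\<in>N. (1 / 2) ^ n) \<le> (2::real)" if "finite N" for N :: "nat set"
  proof -
    have "(\<Sum>n\<in>N. (1 / 2 :: real) ^ n) \<le> (\<Sum>n. (1 / 2) ^ n)"
      using that by (intro sum_le_suminf) (auto simp: summable_geometric)
    then show ?thesis by (simp add: suminf_geometric)
  qed
  have half: "(\<Sum>i\<in>I. pw (- \<bar>i - j\<bar>)) \<le> 2" if I: "finite I" "inj_on (\<lambda>i. nat \<bar>i - j\<bar>) I" for I
  proof -
    have "(\<Sum>i\<in>I. pw (- \<bar>i - j\<bar>)) = (\<Sum>i\<in>I. (1 / 2) ^ nat \<bar>i - j\<bar>)"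
    proof (rule sum.cong)
      fix i show "pw (- \<bar>i - j\<bar>) = (1 / 2) ^ nat \<bar>i - j\<bar>"
        using pw_neg_nat[of "nat \<bar>i - j\<bar>"] by simp
    qed simp
    also have "\<dots> = (\<Sum>n\<in>(\<lambda>i. nat \<bar>i - j\<bar>) ` I. (1 / 2) ^ n)"
      using I(2) by (subst sum.reindex) auto
    also have "\<dots> \<le> 2" using I by (intro geo) auto
    finally show ?thesis .
  qed
  have "(\<Sum>i\<in>J. pw (- \<bar>i - j\<bar>)) = (\<Sum>i\<in>{i\<in>J. i \<ge> j}. pw (- \<bar>i - j\<bar>)) + (\<Sum>i\<in>{i\<in>J. \<not> i \<ge> j}. pw (- \<bar>i - j\<bar>))"
    using J by (subst sum.union_disjoint[symmetric]) (auto intro!: sum.cong)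
  also have "\<dots> \<le> 2 + 2"
    using J by (intro add_mono half) (auto simp: inj_on_def)
  finally show ?thesis by simp
qed

text \<open>A partition of unity on the positive reals, subordinate to the dyadic scales: the piecewise linear hat
  function with vertex at \<open>log 2 v = k\<close>. At most two of the weights \<open>hat v k\<close> are nonzero.\<close>

definition hat :: "real \<Rightarrow> int \<Rightarrow> real" where
  "hat v k = max 0 (1 - \<bar>log 2 v - of_int k\<bar>)"

lemma hat_nonneg [simp]: "hat v k \<ge> 0" by (simp add: hat_def)

lemma measurable_hat [measurable]: "(\<lambda>v. hat v k) \<in> borel_measurable borel"
  unfolding hat_def by measurable

lemma hat_eq_0:
  assumes "k \<noteq> \<lfloor>log 2 v\<rfloor>" "k \<noteq> \<lfloor>log 2 v\<rfloor> + 1"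
  shows "hat v k = 0"
proof -
  have "k \<le> \<lfloor>log 2 v\<rfloor> - 1 \<or> k \<ge> \<lfloor>log 2 v\<rfloor> + 2" using assms by linarith
  then have "\<bar>log 2 v - of_int k\<bar> \<ge> 1" by linarith
  then show ?thesis by (simp add: hat_def)
qed

lemma hat_floor_sum: "hat v \<lfloor>log 2 v\<rfloor> + hat v (\<lfloor>log 2 v\<rfloor> + 1) = 1"
proof -
  have "\<bar>log 2 v - of_int \<lfloor>log 2 v\<rfloor>\<bar> = log 2 v - of_int \<lfloor>log 2 v\<rfloor>" by simp
  moreover have "\<bar>log 2 v - of_int (\<lfloor>log 2 v\<rfloor> + 1)\<bar> = of_int \<lfloor>log 2 v\<rfloor> + 1 - log 2 v" by linarith
  moreover have "log 2 v - of_int \<lfloor>log 2 v\<rfloor> \<le> 1" by linarith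
  ultimately show ?thesis by (simp add: hat_def)
qed

lemma sum_hat_le_1:
  assumes "finite K"
  shows "(\<Sum>k\<in>K. hat v k) \<le> 1"
proof -
  let ?n = "\<lfloor>log 2 v\<rfloor>"
  have "(\<Sum>k\<in>K. hat v k) = (\<Sum>k\<in>K \<inter> {?n, ?n + 1}. hat v k)"
    using assms hat_eq_0[of _ v] by (intro sum.mono_neutral_right) auto
  also have "\<dots> \<le> (\<Sum>k\<in>{?n, ?n + 1}. hat v k)"
    by (intro sum_mono2) auto
  also have "\<dots> = 1" using hat_floor_sum[of v] by simp
  finally show ?thesis .
qed

lemma sum_hat_eq:
  assumes "finite K" "\<lfloor>log 2 v\<rfloor> \<in> K" "\<lfloor>log 2 v\<rfloor> + 1 \<in> K"
  shows "(\<Sum>k\<in>K. of_real (hat v k) * (f k :: complex)) =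
    of_real (hat v \<lfloor>log 2 v\<rfloor>) * f \<lfloor>log 2 v\<rfloor> + of_real (hat v (\<lfloor>log 2 v\<rfloor> + 1)) * f (\<lfloor>log 2 v\<rfloor> + 1)"
proof -
  let ?n = "\<lfloor>log 2 v\<rfloor>"
  have "(\<Sum>k\<in>K. of_real (hat v k) * f k) = (\<Sum>k\<in>{?n, ?n + 1}. of_real (hat v k) * f k)"
    using assms hat_eq_0[of _ v] by (intro sum.mono_neutral_right) auto
  then show ?thesis by simp
qed

lemma sum_hat_diff_le:
  assumes "finite K"
  shows "(\<Sum>k\<in>K. \<bar>hat v k - hat w k\<bar>) \<le> 4 * \<bar>log 2 v - log 2 w\<bar>"
proof -
  let ?S = "{\<lfloor>log 2 v\<rfloor>, \<lfloor>log 2 v\<rfloor> + 1, \<lfloor>log 2 w\<rfloor>, \<lfloor>log 2 w\<rfloor> + 1}"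
  have "(\<Sum>k\<in>K. \<bar>hat v k - hat w k\<bar>) = (\<Sum>k\<in>K \<inter> ?S. \<bar>hat v k - hat w k\<bar>)"
    using assms hat_eq_0[of _ v] hat_eq_0[of _ w] by (intro sum.mono_neutral_right) auto
  also have "\<dots> \<le> (\<Sum>k\<in>K \<inter> ?S. \<bar>log 2 v - log 2 w\<bar>)"
    unfolding hat_def by (intro sum_mono) linarith
  also have "\<dots> = real (card (K \<inter> ?S)) * \<bar>log 2 v - log 2 w\<bar>" by simp
  also have "\<dots> \<le> 4 * \<bar>log 2 v - log 2 w\<bar>"
  proof -
    have "card (K \<inter> ?S) \<le> card ?S" by (intro card_mono) auto
    also have "\<dots> \<le> 4" by (simp add: card_insert_if)
    finally show ?thesis by (intro mult_right_mono) auto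
  qed
  finally show ?thesis .
qed

lemma norm_sum_hat_le:
  assumes "finite K" "\<And>k. k \<in> K \<Longrightarrow> cmod (f k) \<le> b" "b \<ge> 0"
  shows "cmod (\<Sum>k\<in>K. of_real (hat v k) * f k) \<le> b"
proof -
  have "cmod (\<Sum>k\<in>K. of_real (hat v k) * f k) \<le> (\<Sum>k\<in>K. hat v k * b)"
    using assms by (intro sum_norm_le) (auto simp: norm_mult intro!: mult_left_mono)
  also have "\<dots> = (\<Sum>k\<in>K. hat v k) * b" by (simp add: sum_distrib_right)
  also have "\<dots> \<le> 1 * b" using assms by (intro mult_right_mono sum_hat_le_1) auto
  finally show ?thesis by simp
qed

text \<open>Averages with the hat weights are Lipschitz functions of \<open>log 2 v\<close>.\<close>

lemma norm_sum_hat_diff_le: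
  assumes "finite K" "\<And>k. k \<in> K \<Longrightarrow> cmod (f k) \<le> b" "b \<ge> 0"
  shows "cmod ((\<Sum>k\<in>K. of_real (hat v k) * f k) - (\<Sum>k\<in>K. of_real (hat w k) * f k)) \<le> 4 * \<bar>log 2 v - log 2 w\<bar> * b"
proof -
  have "(\<Sum>k\<in>K. of_real (hat v k) * f k) - (\<Sum>k\<in>K. of_real (hat w k) * f k) = (\<Sum>k\<in>K. of_real (hat v k - hat w k) * f k)"
    by (simp add: sum_subtractf algebra_simps)
  also have "cmod \<dots> \<le> (\<Sum>k\<in>K. \<bar>hat v k - hat w k\<bar> * b)"
    using assms by (intro sum_norm_le) (auto simp: norm_mult simp flip: of_real_diff intro!: mult_mono)
  also have "\<dots> = (\<Sum>k\<in>K. \<bar>hat v k - hat w k\<bar>) * b" by (simp add: sum_distrib_right)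
  also have "\<dots> \<le> 4 * \<bar>log 2 v - log 2 w\<bar> * b" using assms by (intro mult_right_mono sum_hat_diff_le) auto
  finally show ?thesis .
qed

lemma abs_log_diff_le:
  fixes a b r \<epsilon> :: real
  assumes r: "r > 0" "a \<ge> r" and d: "\<bar>a - b\<bar> \<le> \<epsilon>" and e: "\<epsilon> \<le> r / 4"
  shows "\<bar>log 2 a - log 2 b\<bar> \<le> 2 * (\<epsilon> / r)"
proof -
  have b: "b \<ge> 3 / 4 * r" using assms by linarith
  have e0: "\<epsilon> \<ge> 0" using d by linarith
  have pos: "a > 0" "b > 0" using r b by (auto intro: less_le_trans[of 0 "3 / 4 * r"])
  have 1: "ln a - ln b \<le> \<epsilon> / (3 / 4 * r)"
  proof -
    have "ln a - ln b \<le> (a - b) / b" using pos by (intro ln_diff_le)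
    also have "\<dots> \<le> \<epsilon> / b" using d pos by (intro divide_right_mono) auto
    also have "\<dots> \<le> \<epsilon> / (3 / 4 * r)" using e0 b r by (intro divide_left_mono) auto
    finally show ?thesis .
  qed
  have 2: "ln b - ln a \<le> \<epsilon> / (3 / 4 * r)"
  proof -
    have "ln b - ln a \<le> (b - a) / a" using pos by (intro ln_diff_le)
    also have "\<dots> \<le> \<epsilon> / a" using d pos by (intro divide_right_mono) auto
    also have "\<dots> \<le> \<epsilon> / (3 / 4 * r)" using e0 r pos by (intro divide_left_mono) auto
    finally show ?thesis .
  qed
  have "\<bar>ln a - ln b\<bar> \<le> \<epsilon> / (3 / 4 * r)" using 1 2 by linarith
  then have "\<bar>ln a - ln b\<bar> / ln 2 \<le> \<epsilon> / (3 / 4 * r) / ln 2" by (intro divide_right_mono) auto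
  also have "\<dots> \<le> \<epsilon> / (3 / 4 * r) / (2 / 3)"
    using ln2_ge_two_thirds e0 r by (intro divide_left_mono) auto
  also have "\<dots> = 2 * (\<epsilon> / r)" by simp
  finally show ?thesis by (simp add: log_def diff_divide_distrib[symmetric])
qed

text \<open>A bound on a finite maximal function, restated as the existence of one square integrable majorant.\<close>

lemma SUP_majorant:
  fixes U :: "real \<Rightarrow> 'a \<Rightarrow> complex"
  assumes T: "finite T" and [measurable]: "\<And>t. t \<in> T \<Longrightarrow> U t \<in> borel_measurable M"
    and le: "(\<integral>\<^sup>+z. (SUP t\<in>T. ennreal ((cmod (U t z))\<^sup>2)) \<partial>M) \<le> C"
  shows "\<exists>b. b \<in> borel_measurable M \<and> (\<forall>z. b z \<ge> 0) \<and> (\<forall>t\<in>T. \<forall>z. cmod (U t z) \<le> b z)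
    \<and> (\<integral>\<^sup>+z. ennreal ((b z)\<^sup>2) \<partial>M) \<le> C"
proof (cases "T = {}")
  case True
  then show ?thesis by (intro exI[of _ "\<lambda>_. 0"]) auto
next
  case False
  define b where "b = (\<lambda>z. Max ((\<lambda>t. cmod (U t z)) ` T))"
  have "b \<in> borel_measurable M" unfolding b_def using T by measurable
  moreover have ub: "cmod (U t z) \<le> b z" if "t \<in> T" for t z
    using that T by (auto simp: b_def)
  moreover have "b z \<ge> 0" for z
    using False ub[of _ z] norm_ge_zero order_trans by blast
  moreover have "(\<integral>\<^sup>+z. ennreal ((b z)\<^sup>2) \<partial>M) \<le> C"
  proof (rule order_trans[OF nn_integral_mono le])
    fix z
    have "b z \<in> (\<lambda>t. cmod (U t z)) ` T"
      unfolding b_def using T False by (intro Max_in) auto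
    then obtain t where "t \<in> T" "b z = cmod (U t z)" by auto
    then show "ennreal ((b z)\<^sup>2) \<le> (SUP t\<in>T. ennreal ((cmod (U t z))\<^sup>2))"
      by (intro SUP_upper2[of t]) auto
  qed
  ultimately show ?thesis by blast
qed

text \<open>A difference of two opposite translates in the first variable multiplies the symbol by
  \<open>2 i sin (2 \<pi> h \<xi>)\<close>.\<close>

lemma ift_translate:
  assumes g: "integrable lborel g"
  shows "ift g ((h, 0) + z) - ift g ((- h, 0) + z) = ift (\<lambda>\<zeta>. (ch (h * fst \<zeta>) - ch (- (h * fst \<zeta>))) * g \<zeta>) z"
proof -
  have i: "integrable lborel (\<lambda>\<zeta>. g \<zeta> * ch (fst w * fst \<zeta> + snd w * snd \<zeta>))" for w
    using integrable_mult_bounded[OF g, of "\<lambda>\<zeta>. ch (fst w * fst \<zeta> + snd w * snd \<zeta>)" 1]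
    by (simp add: mult.commute)
  have "ift g ((h, 0) + z) - ift g ((- h, 0) + z) = (LINT \<zeta>|lborel. g \<zeta> * ch ((h + fst z) * fst \<zeta> + snd z * snd \<zeta>) - g \<zeta> * ch ((- h + fst z) * fst \<zeta> + snd z * snd \<zeta>))"
    using i[of "(h, 0) + z"] i[of "(- h, 0) + z"] unfolding ift_def by (subst Bochner_Integration.integral_diff) auto
  also have "\<dots> = ift (\<lambda>\<zeta>. (ch (h * fst \<zeta>) - ch (- (h * fst \<zeta>))) * g \<zeta>) z"
    unfolding ift_def
  proof (rule Bochner_Integration.integral_cong)
    fix \<zeta> :: "real \<times> real"
    have "ch ((h + fst z) * fst \<zeta> + snd z * snd \<zeta>) = ch (h * fst \<zeta>) * ch (fst z * fst \<zeta> + snd z * snd \<zeta>)"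
      "ch ((- h + fst z) * fst \<zeta> + snd z * snd \<zeta>) = ch (- (h * fst \<zeta>)) * ch (fst z * fst \<zeta> + snd z * snd \<zeta>)"
      by (simp_all add: ch_add[symmetric] algebra_simps)
    then show "g \<zeta> * ch ((h + fst z) * fst \<zeta> + snd z * snd \<zeta>) - g \<zeta> * ch ((- h + fst z) * fst \<zeta> + snd z * snd \<zeta>)
      = (ch (h * fst \<zeta>) - ch (- (h * fst \<zeta>))) * g \<zeta> * ch (fst z * fst \<zeta> + snd z * snd \<zeta>)"
      by (simp add: algebra_simps)
  qed simp
  finally show ?thesis .
qed

lemma norm_ch_diff: "cmod (ch s - ch (- s)) = 2 * \<bar>sin (2 * pi * s)\<bar>"
proof -
  have "ch s - ch (- s) = 2 * \<i> * of_real (sin (2 * pi * s))"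
    by (simp add: ch_def complex_eq_iff)
  then show ?thesis by (simp add: norm_mult)
qed

lemma norm_ch_diff_le: "cmod (ch s - ch (- s)) \<le> 4 * pi * \<bar>s\<bar>"
  using abs_sin_x_le_abs_x[of "2 * pi * s"] by (simp add: norm_ch_diff abs_mult)

lemma norm_ch_diff_ge:
  assumes "1 / 8 \<le> \<bar>s\<bar>" "\<bar>s\<bar> \<le> 1 / 4"
  shows "cmod (ch s - ch (- s)) \<ge> 1"
proof -
  have *: "\<bar>sin (2 * pi * s)\<bar> = \<bar>sin (2 * pi * \<bar>s\<bar>)\<bar>" by (cases "s \<ge> 0") auto
  have "pi / 6 \<le> 2 * pi * \<bar>s\<bar>" using mult_left_mono[OF assms(1), of "2 * pi"] by simp
  moreover have "2 * pi * \<bar>s\<bar> \<le> pi / 2" using mult_left_mono[OF assms(2), of "2 * pi"] by simp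
  ultimately have "sin (pi / 6) \<le> sin (2 * pi * \<bar>s\<bar>)"
    by (intro sin_monotone_2pi_le) auto
  then show ?thesis using * by (simp add: norm_ch_diff sin_30)
qed

section \<open>Almost orthogonality of frequency layers\<close>

lemma integral_mult_cnj_majorants:
  fixes f g :: "'a \<Rightarrow> complex"
  assumes [measurable]: "f \<in> borel_measurable M" "g \<in> borel_measurable M" "b \<in> borel_measurable M" "a \<in> borel_measurable M"
    and nn: "\<And>x. b x \<ge> 0" "\<And>x. a x \<ge> 0" and b: "\<beta> \<ge> 0" "\<alpha> \<ge> 0"
    and le: "\<And>x. cmod (f x) \<le> b x" "\<And>x. cmod (g x) \<le> a x"
    and f: "(\<integral>\<^sup>+x. ennreal ((b x)\<^sup>2) \<partial>M) \<le> ennreal (\<beta>\<^sup>2)"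
    and g: "(\<integral>\<^sup>+x. ennreal ((a x)\<^sup>2) \<partial>M) \<le> ennreal (\<alpha>\<^sup>2)"
  shows "integrable M (\<lambda>x. f x * cnj (g x))" "cmod (LINT x|M. f x * cnj (g x)) \<le> \<beta> * \<alpha>"
proof -
  have *: "(\<integral>\<^sup>+x. ennreal (cmod (f x * cnj (g x))) \<partial>M) \<le> ennreal (\<beta> * \<alpha>)"
  proof (rule order_trans[OF nn_integral_mono cauchy_schwarz_le[OF _ _ nn b f g]])
    fix x show "ennreal (cmod (f x * cnj (g x))) \<le> ennreal (b x * a x)"
      using le[of x] nn[of x] by (auto simp: norm_mult intro!: ennreal_leI mult_mono)
  qed auto
  then show i: "integrable M (\<lambda>x. f x * cnj (g x))"
    by (intro integrableI_bounded) (auto elim!: order.strict_trans1)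
  show "cmod (LINT x|M. f x * cnj (g x)) \<le> \<beta> * \<alpha>"
    using order_trans[OF integral_norm_bound_ennreal[OF i] *] b by (simp add: ennreal_le_iff)
qed

text \<open>Summation by parts for almost orthogonality. The differences of translates by \<open>\<plusminus> h\<close> of the functions
  \<open>B k\<close> are paired with the functions \<open>A k\<close>, all with weights \<open>hat (v z) k\<close>. Moving the translations
  away from \<open>B k\<close> leaves only differences of the weights, of size \<open>\<delta>\<close>, and of the functions \<open>A k\<close>, which \<open>d\<close>
  majorizes. The bound on the oscillation of \<open>log 2 v\<close> is only required where some weight of an
  \<open>A k\<close> is nonzero.\<close>

lemma shifted_pairing_bound:
  fixes B A :: "int \<Rightarrow> real \<times> real \<Rightarrow> complex" and v b a d :: "real \<times> real \<Rightarrow> real"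
  assumes K: "finite K" "finite K'"
    and [measurable]: "v \<in> borel_measurable borel" "\<And>k. B k \<in> borel_measurable borel" "\<And>k. A k \<in> borel_measurable borel"
      "b \<in> borel_measurable borel" "a \<in> borel_measurable borel" "d \<in> borel_measurable borel"
    and nn: "\<And>z. b z \<ge> 0" "\<And>z. a z \<ge> 0" "\<And>z. d z \<ge> 0" "\<beta> \<ge> 0" "\<alpha> \<ge> 0" "\<kappa> \<ge> 0" "\<delta> \<ge> 0"
    and B: "\<And>k z. k \<in> K \<Longrightarrow> cmod (B k z) \<le> b z"
    and A: "\<And>k z. k \<in> K' \<Longrightarrow> cmod (A k z) \<le> a z"
    and D: "\<And>k z. k \<in> K' \<Longrightarrow> cmod (A k ((- h, 0) + z) - A k ((h, 0) + z)) \<le> d z"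
    and \<delta>: "\<And>k z. k \<in> K' \<Longrightarrow> hat (v ((- h, 0) + z)) k \<noteq> 0 \<or> hat (v ((h, 0) + z)) k \<noteq> 0 \<Longrightarrow>
       \<bar>log 2 (v ((- h, 0) + z)) - log 2 (v ((h, 0) + z))\<bar> \<le> \<delta>"
    and b2: "(\<integral>\<^sup>+z. ennreal ((b z)\<^sup>2) \<partial>lborel) \<le> ennreal (\<beta>\<^sup>2)"
    and a2: "(\<integral>\<^sup>+z. ennreal ((a z)\<^sup>2) \<partial>lborel) \<le> ennreal (\<alpha>\<^sup>2)"
    and d2: "(\<integral>\<^sup>+z. ennreal ((d z)\<^sup>2) \<partial>lborel) \<le> ennreal (\<kappa>\<^sup>2)"
  shows "cmod (LINT z|lborel. (\<Sum>k\<in>K. of_real (hat (v z) k) * (B k ((h, 0) + z) - B k ((- h, 0) + z)))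
      * cnj (\<Sum>k\<in>K'. of_real (hat (v z) k) * A k z)) \<le> \<beta> * (8 * \<delta> * \<alpha> + \<kappa>)"
proof -
  \<comment> \<open>Weights at w, functions at z: after a translation these are different points.\<close>
  define p where "p = (\<lambda>w z. \<Sum>k\<in>K. of_real (hat (v w) k) * B k z)"
  define r where "r = (\<lambda>w z. \<Sum>k\<in>K'. of_real (hat (v w) k) * A k z)"
  have tm[measurable]: "(\<lambda>z. c + z) \<in> borel_measurable borel" for c :: "real \<times> real"
    by (intro borel_measurable_continuous_onI continuous_intros)
  have pm[measurable]: "(\<lambda>z. p (f z) (g z)) \<in> borel_measurable borel"
    if [measurable]: "f \<in> borel_measurable borel" "g \<in> borel_measurable borel" for f g :: "real \<times> real \<Rightarrow> real \<times> real"
    unfolding p_def by measurable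
  have rm[measurable]: "(\<lambda>z. r (f z) (g z)) \<in> borel_measurable borel"
    if [measurable]: "f \<in> borel_measurable borel" "g \<in> borel_measurable borel" for f g :: "real \<times> real \<Rightarrow> real \<times> real"
    unfolding r_def by measurable
  have pb: "cmod (p w z) \<le> b z" for w z
    unfolding p_def by (rule norm_sum_hat_le[OF K(1) B nn(1)])
  have ra: "cmod (r w z) \<le> a z" for w z
    unfolding r_def by (rule norm_sum_hat_le[OF K(2) A nn(2)])
  have bt: "(\<integral>\<^sup>+z. ennreal ((b (c + z))\<^sup>2) \<partial>lborel) \<le> ennreal (\<beta>\<^sup>2)" for c
    using b2 by (subst nn_integral_translate[where f = "\<lambda>z. ennreal ((b z)\<^sup>2)"]) auto
  have at: "(\<integral>\<^sup>+z. ennreal ((a (c + z))\<^sup>2) \<partial>lborel) \<le> ennreal (\<alpha>\<^sup>2)" for c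
    using a2 by (subst nn_integral_translate[where f = "\<lambda>z. ennreal ((a z)\<^sup>2)"]) auto
  define X where "X = (\<lambda>c z. p z (c + z) * cnj (r z z))"
  have Xm[measurable]: "X c \<in> borel_measurable borel" for c unfolding X_def by measurable
  have Xi: "integrable lborel (X c)" for c
    unfolding X_def
    by (rule integral_mult_cnj_majorants(1)[where b = "\<lambda>z. b (c + z)" and a = a and \<beta> = \<beta> and \<alpha> = \<alpha>])
       (use nn pb ra bt a2 in auto)
  define E where "E = (\<lambda>z. X (h, 0) ((- h, 0) + z) - X (- h, 0) ((h, 0) + z))"
  have Ei: "integrable lborel E"
    unfolding E_def by (intro Bochner_Integration.integrable_diff) (simp_all add: integrable_translate Xi)
  have "(LINT z|lborel. (\<Sum>k\<in>K. of_real (hat (v z) k) * (B k ((h, 0) + z) - B k ((- h, 0) + z)))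
      * cnj (\<Sum>k\<in>K'. of_real (hat (v z) k) * A k z)) = (LINT z|lborel. X (h, 0) z - X (- h, 0) z)"
    by (intro Bochner_Integration.integral_cong)
       (auto simp: X_def p_def r_def algebra_simps sum_subtractf)
  also have "\<dots> = (LINT z|lborel. X (h, 0) z) - (LINT z|lborel. X (- h, 0) z)"
    by (intro Bochner_Integration.integral_diff Xi)
  also have "\<dots> = (LINT z|lborel. X (h, 0) ((- h, 0) + z)) - (LINT z|lborel. X (- h, 0) ((h, 0) + z))"
    by (simp add: integral_translate)
  also have "\<dots> = (LINT z|lborel. E z)"
    unfolding E_def by (rule Bochner_Integration.integral_diff[symmetric]) (simp_all add: integrable_translate Xi)
  finally have eq: "(LINT z|lborel. (\<Sum>k\<in>K. of_real (hat (v z) k) * (B k ((h, 0) + z) - B k ((- h, 0) + z)))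
      * cnj (\<Sum>k\<in>K'. of_real (hat (v z) k) * A k z)) = (LINT z|lborel. E z)" .
  have Ele: "cmod (E z) \<le> b z * (8 * \<delta> * a ((- h, 0) + z)) + b z * d z" for z
  proof -
    let ?m = "(- h, 0) + z" and ?q = "(h, 0) + z"
    have E: "E z = p ?m z * cnj (r ?m ?m) - p ?q z * cnj (r ?q ?q)"
    proof -
      have *: "(h, 0) + ((- h, 0) + z) = z" "(- h, 0) + ((h, 0) + z) = z"
        by (simp_all add: prod_eq_iff)
      show ?thesis unfolding E_def X_def * ..
    qed
    have rhs0: "0 \<le> b z * (8 * \<delta> * a ?m) + b z * d z"
      using nn by (intro add_nonneg_nonneg mult_nonneg_nonneg) auto
    show ?thesis
    proof (cases "\<exists>k\<in>K'. hat (v ?m) k \<noteq> 0 \<or> hat (v ?q) k \<noteq> 0")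
      case False
      then have "r ?m ?m = 0" "r ?q ?q = 0" by (auto simp: r_def)
      then show ?thesis using E rhs0 by simp
    next
      case True
      then have l: "\<bar>log 2 (v ?m) - log 2 (v ?q)\<bar> \<le> \<delta>" using \<delta> by blast
      have 1: "cmod (p ?m z - p ?q z) \<le> 4 * \<delta> * b z"
        unfolding p_def
      proof (rule order_trans[OF norm_sum_hat_diff_le])
        show "4 * \<bar>log 2 (v ?m) - log 2 (v ?q)\<bar> * b z \<le> 4 * \<delta> * b z"
          using l by (intro mult_right_mono mult_left_mono nn) auto
      qed (use K B nn in auto)
      have 2: "cmod (r ?m ?m - r ?q ?m) \<le> 4 * \<delta> * a ?m"
        unfolding r_def
      proof (rule order_trans[OF norm_sum_hat_diff_le])
        show "4 * \<bar>log 2 (v ?m) - log 2 (v ?q)\<bar> * a ?m \<le> 4 * \<delta> * a ?m"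
          using l by (intro mult_right_mono mult_left_mono nn) auto
      qed (use K A nn in auto)
      have "r ?q ?m - r ?q ?q = (\<Sum>k\<in>K'. of_real (hat (v ?q) k) * (A k ?m - A k ?q))"
        by (simp add: r_def sum_subtractf algebra_simps)
      then have 3: "cmod (r ?q ?m - r ?q ?q) \<le> d z"
        using norm_sum_hat_le[OF K(2) D nn(3)] by simp
      have 4: "cmod (r ?m ?m - r ?q ?q) \<le> 4 * \<delta> * a ?m + d z"
        using norm_triangle_ineq[of "r ?m ?m - r ?q ?m" "r ?q ?m - r ?q ?q"] 2 3 by simp
      have "E z = (p ?m z - p ?q z) * cnj (r ?m ?m) + p ?q z * cnj (r ?m ?m - r ?q ?q)"
        by (simp add: E algebra_simps)
      then have "cmod (E z) \<le> cmod (p ?m z - p ?q z) * cmod (r ?m ?m) + cmod (p ?q z) * cmod (r ?m ?m - r ?q ?q)"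
        by (metis norm_triangle_ineq norm_mult complex_mod_cnj)
      also have "\<dots> \<le> (4 * \<delta> * b z) * a ?m + b z * (4 * \<delta> * a ?m + d z)"
        using 1 4 ra pb nn by (intro add_mono mult_mono) auto
      also have "\<dots> = b z * (8 * \<delta> * a ?m) + b z * d z" by (simp add: algebra_simps)
      finally show ?thesis .
    qed
  qed
  have "ennreal (cmod (LINT z|lborel. E z)) \<le> (\<integral>\<^sup>+z. ennreal (cmod (E z)) \<partial>lborel)"
    by (rule integral_norm_bound_ennreal[OF Ei])
  also have "\<dots> \<le> (\<integral>\<^sup>+z. ennreal (b z * (8 * \<delta> * a ((- h, 0) + z))) + ennreal (b z * d z) \<partial>lborel)"
    using Ele nn by (intro nn_integral_mono) (auto simp: ennreal_plus[symmetric] simp del: ennreal_plus intro!: ennreal_leI)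
  also have "\<dots> = (\<integral>\<^sup>+z. ennreal (b z * (8 * \<delta> * a ((- h, 0) + z))) \<partial>lborel) + (\<integral>\<^sup>+z. ennreal (b z * d z) \<partial>lborel)"
    by (intro nn_integral_add) auto
  also have "\<dots> \<le> ennreal (\<beta> * (8 * \<delta> * \<alpha>)) + ennreal (\<beta> * \<kappa>)"
  proof (intro add_mono cauchy_schwarz_le)
    have "(\<integral>\<^sup>+z. ennreal ((8 * \<delta> * a ((- h, 0) + z))\<^sup>2) \<partial>lborel) = ennreal ((8 * \<delta>)\<^sup>2) * (\<integral>\<^sup>+z. ennreal ((a ((- h, 0) + z))\<^sup>2) \<partial>lborel)"
      by (subst nn_integral_cmult[symmetric]) (auto simp: power_mult_distrib ennreal_mult')
    also have "\<dots> \<le> ennreal ((8 * \<delta>)\<^sup>2) * ennreal (\<alpha>\<^sup>2)"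
      by (intro mult_left_mono at) auto
    finally show "(\<integral>\<^sup>+z. ennreal ((8 * \<delta> * a ((- h, 0) + z))\<^sup>2) \<partial>lborel) \<le> ennreal ((8 * \<delta> * \<alpha>)\<^sup>2)"
      by (simp add: ennreal_mult'[symmetric] power_mult_distrib)
  qed (use nn b2 d2 in auto)
  also have "\<dots> = ennreal (\<beta> * (8 * \<delta> * \<alpha> + \<kappa>))"
    using nn by (simp add: distrib_left ennreal_plus[symmetric] del: ennreal_plus)
  finally have "cmod (LINT z|lborel. E z) \<le> \<beta> * (8 * \<delta> * \<alpha> + \<kappa>)"
    using nn by (simp add: ennreal_le_iff)
  then show ?thesis by (simp only: eq)
qed

text \<open>The symbol that restricts to the dyadic frequencies \<open>2^j \<le> \<bar>\<xi>\<bar> < 2^(j+1)\<close>.\<close>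

definition band :: "int \<Rightarrow> real \<times> real \<Rightarrow> complex" where
  "band j \<zeta> = (if pw j \<le> \<bar>fst \<zeta>\<bar> \<and> \<bar>fst \<zeta>\<bar> < pw (j + 1) then 1 else 0)"

text \<open>The part of \<open>g\<close> with \<open>\<xi>\<close> in the \<open>j\<close>-th band, damped in \<open>\<eta>\<close> at scale \<open>2^(k+j)\<close>; the damping
  replaces the restriction \<open>2^k \<bar>\<xi> \<eta>\<bar> < 1\<close>.\<close>

definition piece :: "(real \<times> real \<Rightarrow> complex) \<Rightarrow> int \<Rightarrow> int \<Rightarrow> real \<times> real \<Rightarrow> complex" where
  "piece g j k = ift (\<lambda>\<zeta>. damp (pw (k + j)) (snd \<zeta>) * (band j \<zeta> * g \<zeta>))"

text \<open>The contribution of the \<open>j\<close>-th band to the model operator, for the scales \<open>k\<close> in \<open>K\<close>. The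
  condition \<open>- j \<le> k\<close> says that the wave length \<open>2^(-j)\<close> is at most the scale \<open>2^k\<close>.\<close>

definition layer :: "(real \<times> real \<Rightarrow> real) \<Rightarrow> int set \<Rightarrow> (real \<times> real \<Rightarrow> complex) \<Rightarrow> int \<Rightarrow> real \<times> real \<Rightarrow> complex" where
  "layer v K g j z = (\<Sum>k\<in>{k\<in>K. - j \<le> k}. of_real (hat (v z) k) * piece g j k z)"

text \<open>The \<open>L\<^sup>2\<close> norm of the \<open>j\<close>-th band of \<open>g\<close>; meaningful if \<open>l2sq g\<close> is finite.\<close>

definition band_norm :: "(real \<times> real \<Rightarrow> complex) \<Rightarrow> int \<Rightarrow> real" where
  "band_norm g j = sqrt (enn2real (l2sq (\<lambda>\<zeta>. band j \<zeta> * g \<zeta>)))"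

lemma measurable_band [measurable]: "band j \<in> borel_measurable borel"
  unfolding band_def by measurable

lemma norm_band_le: "cmod (band j \<zeta>) \<le> 1"
  by (simp add: band_def)

lemma l2sq_mono: "(\<And>z. cmod (f z) \<le> cmod (g z)) \<Longrightarrow> l2sq f \<le> l2sq g"
  unfolding l2sq_def by (intro nn_integral_mono ennreal_leI power_mono) auto

lemma l2sq_mult_le:
  assumes "\<And>z. cmod (f z) \<le> c * cmod (g z)" "c \<ge> 0" and [measurable]: "g \<in> borel_measurable borel"
  shows "l2sq f \<le> ennreal (c\<^sup>2) * l2sq g"
proof -
  have "l2sq f \<le> (\<integral>\<^sup>+z. ennreal (c\<^sup>2) * ennreal ((cmod (g z))\<^sup>2) \<partial>lborel)"
    unfolding l2sq_def
  proof (rule nn_integral_mono)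
    fix z
    have "(cmod (f z))\<^sup>2 \<le> (c * cmod (g z))\<^sup>2" using assms(1) by (intro power_mono) auto
    then show "ennreal ((cmod (f z))\<^sup>2) \<le> ennreal (c\<^sup>2) * ennreal ((cmod (g z))\<^sup>2)"
      by (simp add: ennreal_mult'[symmetric] power_mult_distrib ennreal_leI)
  qed
  also have "\<dots> = ennreal (c\<^sup>2) * l2sq g"
    unfolding l2sq_def by (rule nn_integral_cmult) measurable
  finally show ?thesis .
qed

lemma l2sq_band:
  assumes "l2sq g < top"
  shows "l2sq (\<lambda>\<zeta>. band j \<zeta> * g \<zeta>) = ennreal ((band_norm g j)\<^sup>2)"
proof -
  have "l2sq (\<lambda>\<zeta>. band j \<zeta> * g \<zeta>) \<le> l2sq g"
    by (rule l2sq_mono) (simp add: band_def)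
  then have "l2sq (\<lambda>\<zeta>. band j \<zeta> * g \<zeta>) < top" using assms by (rule order.strict_trans1)
  then show ?thesis by (simp add: band_norm_def)
qed

lemma band_norm_nonneg [simp]: "band_norm g j \<ge> 0" by (simp add: band_norm_def)

text \<open>The maximal inequality for symbols supported in one band, as a majorant. The factor \<open>12\<close> comes from
  \<open>132 \<le> 12\<^sup>2\<close>.\<close>

lemma majorant_snd:
  assumes g: "integrable lborel g" "g = (\<lambda>\<zeta>. m \<zeta> * (band j \<zeta> * f \<zeta>))" "\<And>\<zeta>. cmod (g \<zeta>) \<le> c * cmod (band j \<zeta> * f \<zeta>)" "c \<ge> 0"
    and f: "l2sq f < top" and [measurable]: "f \<in> borel_measurable borel" and K: "finite K"
  shows "\<exists>b. b \<in> borel_measurable borel \<and> (\<forall>z. b z \<ge> 0)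
    \<and> (\<forall>k\<in>K. \<forall>z. cmod (ift (\<lambda>\<zeta>. damp (pw (k + j)) (snd \<zeta>) * g \<zeta>) z) \<le> b z)
    \<and> (\<integral>\<^sup>+z. ennreal ((b z)\<^sup>2) \<partial>lborel) \<le> ennreal ((12 * c * band_norm f j)\<^sup>2)"
proof -
  have [measurable]: "g \<in> borel_measurable borel" using g by auto
  define T where "T = (\<lambda>k. pw (k + j)) ` K"
  have T: "finite T" "T \<subseteq> {0<..}" using K by (auto simp: T_def)
  let ?U = "\<lambda>t z. ift (\<lambda>\<zeta>. damp t (snd \<zeta>) * g \<zeta>) z"
  from SUP_majorant[OF T(1) _ maximal_ift_snd[OF g(1) T], of]
  obtain b where b: "b \<in> borel_measurable lborel" "\<And>z. b z \<ge> 0" "\<And>t z. t \<in> T \<Longrightarrow> cmod (?U t z) \<le> b z"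
    "(\<integral>\<^sup>+z. ennreal ((b z)\<^sup>2) \<partial>lborel) \<le> 132 * l2sq g"
    by auto
  note b(4)
  also have "132 * l2sq g \<le> 144 * (ennreal (c\<^sup>2) * ennreal ((band_norm f j)\<^sup>2))"
    using l2sq_mult_le[of g c "\<lambda>\<zeta>. band j \<zeta> * f \<zeta>", OF g(3,4)] l2sq_band[OF f, of j]
    by (intro mult_mono) auto
  also have "\<dots> = ennreal 144 * (ennreal (c\<^sup>2) * ennreal ((band_norm f j)\<^sup>2))" by simp
  also have "\<dots> = ennreal ((12 * c * band_norm f j)\<^sup>2)"
    by (simp only: ennreal_mult'[symmetric] power_mult_distrib zero_le_power2 mult.assoc) (simp add: power_mult_distrib)
  finally show ?thesis
    using b by (intro exI[of _ b]) (auto simp: T_def)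
qed

lemma measurable_piece [measurable]: "g \<in> borel_measurable borel \<Longrightarrow> piece g j k \<in> borel_measurable borel"
  unfolding piece_def by measurable

lemma lipschitz_measurable:
  fixes v :: "real \<times> real \<Rightarrow> real"
  shows "L-lipschitz_on UNIV v \<Longrightarrow> v \<in> borel_measurable borel"
  by (intro borel_measurable_continuous_onI lipschitz_on_continuous_on)

lemma integrable_band:
  assumes "integrable lborel g"
  shows "integrable lborel (\<lambda>\<zeta>. band j \<zeta> * g \<zeta>)"
  by (rule integrable_mult_bounded[OF assms, where c = 1]) (auto simp: norm_band_le)

lemma layer_majorant:
  assumes g: "integrable lborel g" "l2sq g < top" and K: "finite K"
  shows "\<exists>b. b \<in> borel_measurable borel \<and> (\<forall>z. b z \<ge> 0) \<and> (\<forall>k\<in>K. \<forall>z. cmod (piece g j k z) \<le> b z)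
    \<and> (\<integral>\<^sup>+z. ennreal ((b z)\<^sup>2) \<partial>lborel) \<le> ennreal ((12 * band_norm g j)\<^sup>2)"
  using majorant_snd[OF integrable_band[OF g(1), of j], of "\<lambda>_. 1" j g 1 K] g K
  by (auto simp: piece_def)

text \<open>Almost orthogonality of two layers. For \<open>2^j \<le> \<bar>\<xi>\<bar> < 2^(j+1)\<close> the choice \<open>h = 2^(-j) / 8\<close> puts \<open>h \<xi>\<close>
  between \<open>1/8\<close> and \<open>1/4\<close> in modulus, where the symbol \<open>\<sigma>\<close> of the difference of translates is bounded
  below by \<open>1\<close>; in the lower band \<open>j'\<close> it is at most \<open>\<pi> 2^(j'-j)\<close>. The constant is
  \<open>1728 = 144 * 12\<close>, where \<open>8 + \<pi> \<le> 12\<close>.\<close>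

lemma layer_orth:
  assumes g: "integrable lborel g" "l2sq g < top" and K: "finite K"
    and v: "1-lipschitz_on UNIV v" "\<And>z. v z > 0" and jj: "j' < j"
  shows "cmod (LINT z|lborel. layer v K g j z * cnj (layer v K g j' z)) \<le> 1728 * pw (j' - j) * band_norm g j * band_norm g j'"
proof -
  have [measurable]: "g \<in> borel_measurable borel" using g by auto
  have vm: "v \<in> borel_measurable borel" using v(1) by (rule lipschitz_measurable)
  define h where "h = pw (- j) / 8"
  have h0: "h > 0" by (simp add: h_def)
  define \<sigma> where "\<sigma> = (\<lambda>\<zeta>::real \<times> real. ch (h * fst \<zeta>) - ch (- (h * fst \<zeta>)))"
  have \<sigma>m[measurable]: "\<sigma> \<in> borel_measurable borel" unfolding \<sigma>_def by measurable
  define K1 where "K1 = {k\<in>K. - j \<le> k}"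
  define K2 where "K2 = {k\<in>K. - j' \<le> k}"
  have Kf: "finite K1" "finite K2" using K by (auto simp: K1_def K2_def)
  have \<sigma>1: "cmod (\<sigma> \<zeta>) \<ge> 1" if "band j \<zeta> \<noteq> 0" for \<zeta>
  proof -
    have *: "pw j \<le> \<bar>fst \<zeta>\<bar>" "\<bar>fst \<zeta>\<bar> < 2 * pw j"
      using that by (auto simp: band_def pw_add split: if_splits)
    have jm: "pw (- j) * pw j = 1" by (simp add: pw_add[symmetric])
    have 1: "1 / 8 \<le> \<bar>h * fst \<zeta>\<bar>"
      using mult_left_mono[OF *(1), of "pw (- j) / 8"] jm by (simp add: h_def abs_mult)
    have 2: "\<bar>h * fst \<zeta>\<bar> \<le> 1 / 4"
      using mult_left_mono[OF less_imp_le[OF *(2)], of "pw (- j) / 8"] jm by (simp add: h_def abs_mult mult.left_commute)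
    show ?thesis unfolding \<sigma>_def by (rule norm_ch_diff_ge[OF 1 2])
  qed
  have \<sigma>2: "cmod (\<sigma> \<zeta>) \<le> pi * pw (j' - j)" if "band j' \<zeta> \<noteq> 0" for \<zeta>
  proof -
    have *: "\<bar>fst \<zeta>\<bar> \<le> 2 * pw j'"
      using that by (auto simp: band_def pw_add split: if_splits)
    have "cmod (\<sigma> \<zeta>) \<le> 4 * pi * \<bar>h * fst \<zeta>\<bar>" unfolding \<sigma>_def by (rule norm_ch_diff_le)
    also have "\<dots> = 4 * pi * h * \<bar>fst \<zeta>\<bar>" using h0 by (simp add: abs_mult)
    also have "\<dots> \<le> 4 * pi * h * (2 * pw j')" using * h0 by (intro mult_left_mono) auto
    also have "\<dots> = pi * pw (j' - j)"
      using pw_add[of j' "- j"] by (simp add: h_def mult_ac)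
    finally show ?thesis .
  qed
  define m where "m = (\<lambda>\<zeta>. inverse (\<sigma> \<zeta>))"
  define q where "q = (\<lambda>\<zeta>. m \<zeta> * (band j \<zeta> * g \<zeta>))"
  have qle: "cmod (q \<zeta>) \<le> 1 * cmod (band j \<zeta> * g \<zeta>)" for \<zeta>
  proof (cases "band j \<zeta> = 0")
    case False
    from \<sigma>1[OF this] have "inverse (cmod (\<sigma> \<zeta>)) \<le> 1" by (simp add: inverse_le_1_iff)
    then show ?thesis by (simp add: q_def m_def norm_mult norm_inverse mult_left_le_one_le)
  qed (simp add: q_def)
  have qi: "integrable lborel q"
    by (rule Bochner_Integration.integrable_bound[OF integrable_band[OF g(1), of j]])
       (use qle in \<open>auto simp: q_def m_def\<close>)
  define s where "s = (\<lambda>\<zeta>. - \<sigma> \<zeta> * (band j' \<zeta> * g \<zeta>))"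
  have sle: "cmod (s \<zeta>) \<le> pi * pw (j' - j) * cmod (band j' \<zeta> * g \<zeta>)" for \<zeta>
  proof (cases "band j' \<zeta> = 0")
    case False
    from mult_right_mono[OF \<sigma>2[OF this], of "cmod (band j' \<zeta> * g \<zeta>)"] show ?thesis
      by (simp add: s_def norm_mult)
  qed (simp add: s_def)
  have si: "integrable lborel s"
    unfolding s_def
  proof (rule integrable_mult_bounded[OF integrable_band[OF g(1)], where c = 2])
    show "cmod (- \<sigma> \<zeta>) \<le> 2" for \<zeta>
      using norm_triangle_ineq4[of "ch (h * fst \<zeta>)" "ch (- (h * fst \<zeta>))"] by (simp add: \<sigma>_def norm_minus_commute)
  qed auto
  define B where "B = (\<lambda>k. ift (\<lambda>\<zeta>. damp (pw (k + j)) (snd \<zeta>) * q \<zeta>))"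
  have ei: "integrable lborel (\<lambda>\<zeta>. damp (pw i) (snd \<zeta>) * f \<zeta>)" if "integrable lborel f" for i and f :: "real \<times> real \<Rightarrow> complex"
    by (rule integrable_mult_bounded[OF that, where c = 1]) auto
  have Bdiff: "piece g j k z = B k ((h, 0) + z) - B k ((- h, 0) + z)" for k z
  proof -
    have "B k ((h, 0) + z) - B k ((- h, 0) + z) = ift (\<lambda>\<zeta>. \<sigma> \<zeta> * (damp (pw (k + j)) (snd \<zeta>) * q \<zeta>)) z"
      unfolding B_def \<sigma>_def by (rule ift_translate[OF ei[OF qi]])
    also have "(\<lambda>\<zeta>. \<sigma> \<zeta> * (damp (pw (k + j)) (snd \<zeta>) * q \<zeta>))
      = (\<lambda>\<zeta>. damp (pw (k + j)) (snd \<zeta>) * (band j \<zeta> * g \<zeta>))"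
    proof
      fix \<zeta>
      have "\<sigma> \<zeta> * q \<zeta> = band j \<zeta> * g \<zeta>"
      proof (cases "band j \<zeta> = 0")
        case False
        from \<sigma>1[OF this] have "\<sigma> \<zeta> \<noteq> 0" by auto
        then show ?thesis by (simp add: q_def m_def)
      qed (simp add: q_def)
      then show "\<sigma> \<zeta> * (damp (pw (k + j)) (snd \<zeta>) * q \<zeta>)
        = damp (pw (k + j)) (snd \<zeta>) * (band j \<zeta> * g \<zeta>)"
        by (subst mult.left_commute) simp
    qed
    finally show ?thesis by (simp add: piece_def)
  qed
  have Ddiff: "piece g j' k ((- h, 0) + z) - piece g j' k ((h, 0) + z)
    = ift (\<lambda>\<zeta>. damp (pw (k + j')) (snd \<zeta>) * s \<zeta>) z" for k z
  proof -
    have "piece g j' k ((h, 0) + z) - piece g j' k ((- h, 0) + z)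
      = ift (\<lambda>\<zeta>. \<sigma> \<zeta> * (damp (pw (k + j')) (snd \<zeta>) * (band j' \<zeta> * g \<zeta>))) z"
      unfolding piece_def \<sigma>_def by (rule ift_translate[OF ei[OF integrable_band[OF g(1)]]])
    also have "\<dots> = - ift (\<lambda>\<zeta>. damp (pw (k + j')) (snd \<zeta>) * s \<zeta>) z"
      unfolding ift_def s_def by (subst Bochner_Integration.integral_minus[symmetric]) (simp add: mult_ac)
    finally show ?thesis by (simp add: algebra_simps)
  qed
  from majorant_snd[OF qi q_def qle _ g(2) _ Kf(1)]
  obtain b where b: "b \<in> borel_measurable borel" "\<And>z. b z \<ge> 0" "\<And>k z. k \<in> K1 \<Longrightarrow> cmod (B k z) \<le> b z"
    "(\<integral>\<^sup>+z. ennreal ((b z)\<^sup>2) \<partial>lborel) \<le> ennreal ((12 * band_norm g j)\<^sup>2)"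
    by (auto simp: B_def)
  from layer_majorant[OF g Kf(2), of j']
  obtain a where a: "a \<in> borel_measurable borel" "\<And>z. a z \<ge> 0" "\<And>k z. k \<in> K2 \<Longrightarrow> cmod (piece g j' k z) \<le> a z"
    "(\<integral>\<^sup>+z. ennreal ((a z)\<^sup>2) \<partial>lborel) \<le> ennreal ((12 * band_norm g j')\<^sup>2)"
    by auto
  from majorant_snd[OF si s_def sle _ g(2) _ Kf(2)]
  obtain d where d: "d \<in> borel_measurable borel" "\<And>z. d z \<ge> 0"
    "\<And>k z. k \<in> K2 \<Longrightarrow> cmod (piece g j' k ((- h, 0) + z) - piece g j' k ((h, 0) + z)) \<le> d z"
    "(\<integral>\<^sup>+z. ennreal ((d z)\<^sup>2) \<partial>lborel) \<le> ennreal ((12 * (pi * pw (j' - j)) * band_norm g j')\<^sup>2)"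
    unfolding Ddiff by auto
  have \<delta>: "\<bar>log 2 (v ((- h, 0) + z)) - log 2 (v ((h, 0) + z))\<bar> \<le> pw (j' - j)"
    if k: "k \<in> K2" and hat: "hat (v ((- h, 0) + z)) k \<noteq> 0 \<or> hat (v ((h, 0) + z)) k \<noteq> 0" for k z
  proof -
    let ?m = "v ((- h, 0) + z)" and ?q = "v ((h, 0) + z)"
    have "\<bar>?m - ?q\<bar> \<le> dist ((- h, 0) + z) ((h, 0) + z)"
      using lipschitz_onD[OF v(1), of "(- h, 0) + z" "(h, 0) + z"] by (simp add: dist_real_def)
    also have "dist ((- h, 0) + z) ((h, 0) + z) = 2 * h"
      using h0 by (simp add: dist_norm norm_prod_def real_sqrt_mult)
    finally have d: "\<bar>?m - ?q\<bar> \<le> 2 * h" "\<bar>?q - ?m\<bar> \<le> 2 * h" by linarith+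
    \<comment> \<open>A nonzero weight in layer j' forces v to be large compared with h.\<close>
    have big: "w \<ge> pw (- j' - 1)" if "hat w k \<noteq> 0" "w > 0" for w
    proof -
      have "log 2 w \<ge> of_int k - 1" using that by (auto simp: hat_def max_def split: if_splits)
      also have "of_int k - 1 \<ge> (of_int (- j' - 1) :: real)" using k by (simp add: K2_def)
      finally have "2 powr of_int (- j' - 1) \<le> w" using that by (simp add: le_log_iff)
      then show ?thesis by (simp add: pw_def)
    qed
    have hr: "2 * h \<le> pw (- j' - 1) / 4"
    proof -
      have "2 * h = pw (- j) / 4" by (simp add: h_def)
      also have "\<dots> \<le> pw (- j' - 1) / 4" using jj by simp
      finally show ?thesis .
    qed
    have val: "2 * (2 * h / pw (- j' - 1)) = pw (j' - j)"
    proof -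
      have "pw (- j) = pw (j' - j + 1) * pw (- j' - 1)" by (simp add: pw_add[symmetric])
      then have "2 * h / pw (- j' - 1) = pw (j' - j + 1) / 4" using pw_pos[of "- j' - 1"] by (simp add: h_def field_simps del: pw_pos)
      then show ?thesis by (simp add: pw_add)
    qed
    from hat show ?thesis
    proof
      assume "hat ?m k \<noteq> 0"
      from abs_log_diff_le[OF pw_pos big[OF this v(2)] d(1) hr] show ?thesis by (simp only: val)
    next
      assume "hat ?q k \<noteq> 0"
      from abs_log_diff_le[OF pw_pos big[OF this v(2)] d(2) hr] show ?thesis by (simp only: val abs_minus_commute)
    qed
  qed
  have "cmod (LINT z|lborel. layer v K g j z * cnj (layer v K g j' z))
    \<le> (12 * band_norm g j) * (8 * pw (j' - j) * (12 * band_norm g j') + 12 * (pi * pw (j' - j)) * band_norm g j')"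
    unfolding layer_def K1_def[symmetric] K2_def[symmetric] Bdiff
    by (rule shifted_pairing_bound[where b = b and a = a and d = d and A = "piece g j'"])
       (use Kf vm b a d \<delta> in \<open>auto simp: B_def q_def m_def\<close>)
  also have "\<dots> = (144 * (8 + pi)) * (pw (j' - j) * band_norm g j * band_norm g j')"
    by (simp add: algebra_simps)
  also have "\<dots> \<le> 1728 * (pw (j' - j) * band_norm g j * band_norm g j')"
    using pi_less_4 by (intro mult_right_mono) auto
  finally show ?thesis by (simp add: mult_ac)
qed

section \<open>The model operator\<close>

lemma measurable_layer [measurable]:
  assumes [measurable]: "v \<in> borel_measurable borel" "g \<in> borel_measurable borel"
  shows "layer v K g j \<in> borel_measurable borel"
  unfolding layer_def by measurable

lemma layer_le_majorant:
  assumes g: "integrable lborel g" "l2sq g < top" and K: "finite K"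
  obtains b where "b \<in> borel_measurable borel" "\<And>z. b z \<ge> 0" "\<And>z. cmod (layer v K g j z) \<le> b z"
    "(\<integral>\<^sup>+z. ennreal ((b z)\<^sup>2) \<partial>lborel) \<le> ennreal ((12 * band_norm g j)\<^sup>2)"
proof -
  from layer_majorant[OF g K, of j]
  obtain b where b: "b \<in> borel_measurable borel" "\<And>z. b z \<ge> 0" "\<And>k z. k \<in> K \<Longrightarrow> cmod (piece g j k z) \<le> b z"
    "(\<integral>\<^sup>+z. ennreal ((b z)\<^sup>2) \<partial>lborel) \<le> ennreal ((12 * band_norm g j)\<^sup>2)"
    by auto
  moreover have "cmod (layer v K g j z) \<le> b z" for z
    unfolding layer_def using K b by (intro norm_sum_hat_le) auto
  ultimately show thesis using that by blast
qed

lemma layer_pair: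
  assumes g: "integrable lborel g" "l2sq g < top" and K: "finite K"
    and v: "1-lipschitz_on UNIV v" "\<And>z. v z > 0"
  shows "integrable lborel (\<lambda>z. layer v K g i z * cnj (layer v K g j z))"
    and "cmod (LINT z|lborel. layer v K g i z * cnj (layer v K g j z)) \<le> 1728 * pw (- \<bar>i - j\<bar>) * band_norm g i * band_norm g j"
proof -
  have [measurable]: "g \<in> borel_measurable borel" "v \<in> borel_measurable borel"
    using g lipschitz_measurable[OF v(1)] by auto
  obtain b where b: "b \<in> borel_measurable borel" "\<And>z. b z \<ge> 0" "\<And>z. cmod (layer v K g i z) \<le> b z"
    "(\<integral>\<^sup>+z. ennreal ((b z)\<^sup>2) \<partial>lborel) \<le> ennreal ((12 * band_norm g i)\<^sup>2)"
    using layer_le_majorant[OF g K] by blast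
  obtain a where a: "a \<in> borel_measurable borel" "\<And>z. a z \<ge> 0" "\<And>z. cmod (layer v K g j z) \<le> a z"
    "(\<integral>\<^sup>+z. ennreal ((a z)\<^sup>2) \<partial>lborel) \<le> ennreal ((12 * band_norm g j)\<^sup>2)"
    using layer_le_majorant[OF g K] by blast
  note maj = integral_mult_cnj_majorants[of "layer v K g i" lborel "layer v K g j" b a "12 * band_norm g i" "12 * band_norm g j"]
  show "integrable lborel (\<lambda>z. layer v K g i z * cnj (layer v K g j z))"
    by (rule maj(1)) (use a b in auto)
  have diag: "cmod (LINT z|lborel. layer v K g i z * cnj (layer v K g j z)) \<le> (12 * band_norm g i) * (12 * band_norm g j)"
    by (rule maj(2)) (use a b in auto)
  show "cmod (LINT z|lborel. layer v K g i z * cnj (layer v K g j z)) \<le> 1728 * pw (- \<bar>i - j\<bar>) * band_norm g i * band_norm g j"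
  proof (cases i j rule: linorder_cases)
    case less
    have "(LINT z|lborel. layer v K g j z * cnj (layer v K g i z)) = cnj (LINT z|lborel. layer v K g i z * cnj (layer v K g j z))"
      using Bochner_Integration.integral_cnj[of lborel "\<lambda>z. layer v K g i z * cnj (layer v K g j z)"] by (simp add: mult.commute)
    then have "cmod (LINT z|lborel. layer v K g i z * cnj (layer v K g j z)) \<le> 1728 * pw (i - j) * band_norm g j * band_norm g i"
      using layer_orth[OF g K v less] by simp
    moreover have "- \<bar>i - j\<bar> = i - j" using less by simp
    ultimately show ?thesis by (simp only: mult.assoc mult.commute[of "band_norm g j"])
  next
    case equal
    have "band_norm g i * band_norm g j \<ge> 0" by simp
    then have "12 * band_norm g i * (12 * band_norm g j) \<le> 1728 * 1 * band_norm g i * band_norm g j" by simp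
    moreover have "pw (- \<bar>i - j\<bar>) = 1" using equal by simp
    ultimately show ?thesis using diag by (simp only:)
  next
    case greater
    then have "- \<bar>i - j\<bar> = j - i" by simp
    then show ?thesis using layer_orth[OF g K v greater] by (simp only:)
  qed
qed

lemma band_unique: "band i \<zeta> \<noteq> 0 \<Longrightarrow> band j \<zeta> \<noteq> 0 \<Longrightarrow> i = j"
proof -
  assume "band i \<zeta> \<noteq> 0" "band j \<zeta> \<noteq> 0"
  then have "pw i \<le> \<bar>fst \<zeta>\<bar>" "\<bar>fst \<zeta>\<bar> < pw (j + 1)" "pw j \<le> \<bar>fst \<zeta>\<bar>" "\<bar>fst \<zeta>\<bar> < pw (i + 1)"
    by (auto simp: band_def split: if_splits)
  then have "pw i < pw (j + 1)" "pw j < pw (i + 1)" by (blast intro: le_less_trans)+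
  then show ?thesis by simp
qed

text \<open>The bands are disjoint.\<close>

lemma sum_band_norm_le:
  assumes g: "l2sq g < top" and J: "finite J" and [measurable]: "g \<in> borel_measurable borel"
  shows "ennreal (\<Sum>j\<in>J. (band_norm g j)\<^sup>2) \<le> l2sq g"
proof -
  have "ennreal (\<Sum>j\<in>J. (band_norm g j)\<^sup>2) = (\<Sum>j\<in>J. l2sq (\<lambda>\<zeta>. band j \<zeta> * g \<zeta>))"
    by (simp add: l2sq_band[OF g] sum_ennreal)
  also have "\<dots> = (\<integral>\<^sup>+\<zeta>. (\<Sum>j\<in>J. ennreal ((cmod (band j \<zeta> * g \<zeta>))\<^sup>2)) \<partial>lborel)"
    unfolding l2sq_def by (rule nn_integral_sum[symmetric]) measurable
  also have "\<dots> \<le> l2sq g"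
    unfolding l2sq_def
  proof (rule nn_integral_mono)
    fix \<zeta>
    show "(\<Sum>j\<in>J. ennreal ((cmod (band j \<zeta> * g \<zeta>))\<^sup>2)) \<le> ennreal ((cmod (g \<zeta>))\<^sup>2)"
    proof (cases "\<exists>i\<in>J. band i \<zeta> \<noteq> 0")
      case True
      then obtain i where i: "i \<in> J" "band i \<zeta> \<noteq> 0" by auto
      have "band j \<zeta> = 0" if "j \<noteq> i" for j using i(2) band_unique that by blast
      then have "(\<Sum>j\<in>J. ennreal ((cmod (band j \<zeta> * g \<zeta>))\<^sup>2)) = (\<Sum>j\<in>{i}. ennreal ((cmod (band j \<zeta> * g \<zeta>))\<^sup>2))"
        using J i(1) by (intro sum.mono_neutral_right) auto
      also have "\<dots> \<le> ennreal ((cmod (g \<zeta>))\<^sup>2)" by (simp add: band_def)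
      finally show ?thesis .
    qed simp
  qed
  finally show ?thesis .
qed

text \<open>Schur's test: the matrix \<open>2^(-\<bar>i-j\<bar>)\<close> has row sums at most \<open>4\<close>, and \<open>6912 = 4 * 1728\<close>.\<close>

lemma l2sq_sum_layers_le:
  assumes g: "integrable lborel g" "l2sq g < top" and K: "finite K" and J: "finite J"
    and v: "1-lipschitz_on UNIV v" "\<And>z. v z > 0"
  shows "l2sq (\<lambda>z. \<Sum>j\<in>J. layer v K g j z) \<le> 6912 * l2sq g"
proof -
  have gm: "g \<in> borel_measurable borel" using g by auto
  let ?M = "layer v K g"
  let ?S = "\<lambda>z. \<Sum>j\<in>J. ?M j z"
  have exp: "complex_of_real ((cmod (?S z))\<^sup>2) = (\<Sum>i\<in>J. \<Sum>j\<in>J. ?M i z * cnj (?M j z))" for z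
    unfolding complex_norm_square by (simp add: sum_product)
  have i: "integrable lborel (\<lambda>z. complex_of_real ((cmod (?S z))\<^sup>2))"
    unfolding exp by (intro Bochner_Integration.integrable_sum layer_pair(1)[OF g K v])
  then have i': "integrable lborel (\<lambda>z. (cmod (?S z))\<^sup>2)"
    by (simp only: complex_of_real_integrable_eq)
  have "l2sq ?S = ennreal (LINT z|lborel. (cmod (?S z))\<^sup>2)"
    unfolding l2sq_def using i' by (intro nn_integral_eq_integral) auto
  also have "(LINT z|lborel. (cmod (?S z))\<^sup>2) = cmod (LINT z|lborel. complex_of_real ((cmod (?S z))\<^sup>2))"
    unfolding integral_complex_of_real by (simp add: integral_nonneg_AE)
  also have "(LINT z|lborel. complex_of_real ((cmod (?S z))\<^sup>2)) = (\<Sum>i\<in>J. \<Sum>j\<in>J. LINT z|lborel. ?M i z * cnj (?M j z))"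
    unfolding exp by (simp add: layer_pair(1)[OF g K v])
  also have "cmod \<dots> \<le> (\<Sum>i\<in>J. \<Sum>j\<in>J. 864 * (pw (- \<bar>i - j\<bar>) * (band_norm g i)\<^sup>2) + 864 * (pw (- \<bar>j - i\<bar>) * (band_norm g j)\<^sup>2))"
  proof (intro sum_norm_le)
    fix i j
    have "2 * band_norm g i * band_norm g j \<le> (band_norm g i)\<^sup>2 + (band_norm g j)\<^sup>2" by (rule sum_squares_bound)
    from mult_left_mono[OF this, of "864 * pw (- \<bar>i - j\<bar>)"]
    have "1728 * pw (- \<bar>i - j\<bar>) * band_norm g i * band_norm g j \<le> 864 * (pw (- \<bar>i - j\<bar>) * (band_norm g i)\<^sup>2) + 864 * (pw (- \<bar>j - i\<bar>) * (band_norm g j)\<^sup>2)"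
      by (simp add: algebra_simps abs_minus_commute)
    then show "cmod (LINT z|lborel. ?M i z * cnj (?M j z)) \<le> 864 * (pw (- \<bar>i - j\<bar>) * (band_norm g i)\<^sup>2) + 864 * (pw (- \<bar>j - i\<bar>) * (band_norm g j)\<^sup>2)"
      using layer_pair(2)[OF g K v, of i j] by linarith
  qed
  also have "\<dots> = 864 * (\<Sum>i\<in>J. (band_norm g i)\<^sup>2 * (\<Sum>j\<in>J. pw (- \<bar>j - i\<bar>))) + 864 * (\<Sum>j\<in>J. (band_norm g j)\<^sup>2 * (\<Sum>i\<in>J. pw (- \<bar>i - j\<bar>)))"
  proof -
    have "(\<Sum>i\<in>J. \<Sum>j\<in>J. 864 * (pw (- \<bar>j - i\<bar>) * (band_norm g j)\<^sup>2)) = (\<Sum>j\<in>J. \<Sum>i\<in>J. 864 * (pw (- \<bar>j - i\<bar>) * (band_norm g j)\<^sup>2))"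
      by (rule sum.swap)
    moreover have "864 * (pw (- \<bar>i - j\<bar>) * (band_norm g i)\<^sup>2) = 864 * ((band_norm g i)\<^sup>2 * pw (- \<bar>j - i\<bar>))" for i j
      by (simp add: abs_minus_commute)
    ultimately show ?thesis
      by (simp only: sum.distrib sum_distrib_left)
  qed
  also have "\<dots> \<le> 864 * (\<Sum>i\<in>J. (band_norm g i)\<^sup>2 * 4) + 864 * (\<Sum>j\<in>J. (band_norm g j)\<^sup>2 * 4)"
    using sum_pw_dist_le[OF J] by (intro add_mono mult_left_mono sum_mono) auto
  also have "\<dots> = 6912 * (\<Sum>i\<in>J. (band_norm g i)\<^sup>2)" by (simp add: sum_distrib_right[symmetric])
  finally have "l2sq ?S \<le> ennreal (6912 * (\<Sum>i\<in>J. (band_norm g i)\<^sup>2))"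
    by (simp add: ennreal_leI)
  also have "\<dots> = 6912 * ennreal (\<Sum>i\<in>J. (band_norm g i)\<^sup>2)"
    by (subst ennreal_mult) (auto intro: sum_nonneg)
  also have "\<dots> \<le> 6912 * l2sq g"
    by (intro mult_left_mono sum_band_norm_le[OF g(2) J gm]) auto
  finally show ?thesis .
qed

text \<open>The sharp symbol at scale \<open>2^k\<close>.\<close>

definition chi :: "int \<Rightarrow> real \<times> real \<Rightarrow> complex" where
  "chi k \<zeta> = (if pw k * \<bar>fst \<zeta> * snd \<zeta>\<bar> < 1 then 1 else 0)"

text \<open>The model symbol at scale \<open>2^k\<close>, with bands from a set \<open>J\<close> that will be finite.\<close>

definition model :: "int set \<Rightarrow> int \<Rightarrow> real \<times> real \<Rightarrow> complex" where
  "model J k \<zeta> = damp (pw k) (fst \<zeta>)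
     + (\<Sum>j\<in>{j\<in>J. - j \<le> k}. damp (pw (k + j)) (snd \<zeta>) * band j \<zeta>)"

lemma measurable_chi [measurable]: "chi k \<in> borel_measurable borel"
  unfolding chi_def by measurable

lemma measurable_model [measurable]: "model J k \<in> borel_measurable borel"
  unfolding model_def by measurable

lemma norm_model_le: "finite J \<Longrightarrow> cmod (model J k \<zeta>) \<le> 1 + real (card J)"
proof -
  assume J: "finite J"
  have "cmod (\<Sum>j\<in>{j\<in>J. - j \<le> k}. damp (pw (k + j)) (snd \<zeta>) * band j \<zeta>) \<le> (\<Sum>j\<in>{j\<in>J. - j \<le> k}. 1)"
    by (intro sum_norm_le) (auto simp: norm_mult band_def)
  also have "\<dots> \<le> real (card J)" using J by (auto intro!: card_mono)
  finally show ?thesis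
    unfolding model_def by (intro order_trans[OF norm_triangle_ineq] add_mono) auto
qed

lemma ift_add:
  assumes "integrable lborel f" "integrable lborel g"
  shows "ift (\<lambda>\<zeta>. f \<zeta> + g \<zeta>) z = ift f z + ift g z"
proof -
  have i: "integrable lborel (\<lambda>\<zeta>. f \<zeta> * ch (fst z * fst \<zeta> + snd z * snd \<zeta>))" if "integrable lborel f" for f
    using integrable_mult_bounded[OF that, of "\<lambda>\<zeta>. ch (fst z * fst \<zeta> + snd z * snd \<zeta>)" 1]
    by (simp add: mult.commute)
  show ?thesis
    unfolding ift_def distrib_right by (rule Bochner_Integration.integral_add) (intro i assms)+
qed

lemma ift_sum:
  assumes "finite J" "\<And>j. j \<in> J \<Longrightarrow> integrable lborel (f j)"
  shows "ift (\<lambda>\<zeta>. \<Sum>j\<in>J. f j \<zeta>) z = (\<Sum>j\<in>J. ift (f j) z)"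
  using assms
proof (induction rule: finite_induct)
  case empty
  then show ?case by (simp add: ift_def)
next
  case (insert j J)
  then show ?case by (simp add: ift_add)
qed

lemma ift_diff:
  assumes "integrable lborel f" "integrable lborel g"
  shows "ift (\<lambda>\<zeta>. f \<zeta> - g \<zeta>) z = ift f z - ift g z"
  using ift_add[of "\<lambda>\<zeta>. f \<zeta> - g \<zeta>" g z] assms by simp

lemma l2sq_add_le:
  assumes [measurable]: "f \<in> borel_measurable borel" "g \<in> borel_measurable borel"
  shows "l2sq (\<lambda>z. f z + g z) \<le> 2 * l2sq f + 2 * l2sq g"
proof -
  have "l2sq (\<lambda>z. f z + g z) \<le> (\<integral>\<^sup>+z. 2 * ennreal ((cmod (f z))\<^sup>2) + 2 * ennreal ((cmod (g z))\<^sup>2) \<partial>lborel)"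
    unfolding l2sq_def
  proof (rule nn_integral_mono)
    fix z
    have "(cmod (f z + g z))\<^sup>2 \<le> (cmod (f z) + cmod (g z))\<^sup>2"
      by (intro power_mono norm_triangle_ineq) auto
    also have "\<dots> \<le> 2 * (cmod (f z))\<^sup>2 + 2 * (cmod (g z))\<^sup>2"
      using sum_squares_bound[of "cmod (f z)" "cmod (g z)"] by (simp add: power2_sum)
    finally have "ennreal ((cmod (f z + g z))\<^sup>2) \<le> ennreal (2 * (cmod (f z))\<^sup>2 + 2 * (cmod (g z))\<^sup>2)"
      by (rule ennreal_leI)
    then show "ennreal ((cmod (f z + g z))\<^sup>2) \<le> 2 * ennreal ((cmod (f z))\<^sup>2) + 2 * ennreal ((cmod (g z))\<^sup>2)"
      by (simp add: ennreal_mult')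
  qed
  also have "\<dots> = 2 * l2sq f + 2 * l2sq g"
    unfolding l2sq_def by (subst nn_integral_add) (auto simp: nn_integral_cmult)
  finally show ?thesis .
qed

lemma l2sq_le_majorant:
  assumes "\<And>z. cmod (f z) \<le> b z"
  shows "l2sq f \<le> (\<integral>\<^sup>+z. ennreal ((b z)\<^sup>2) \<partial>lborel)"
  unfolding l2sq_def using assms by (intro nn_integral_mono ennreal_leI power_mono) auto

lemma model_operator_bound:
  assumes g: "integrable lborel g" "l2sq g < top" and K: "finite K" and J: "finite J"
    and v: "1-lipschitz_on UNIV v" "\<And>z. v z > 0"
  shows "l2sq (\<lambda>z. \<Sum>k\<in>K. of_real (hat (v z) k) * ift (\<lambda>\<zeta>. model J k \<zeta> * g \<zeta>) z) \<le> 14088 * l2sq g"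
proof -
  have [measurable]: "g \<in> borel_measurable borel" "v \<in> borel_measurable borel"
    using g lipschitz_measurable[OF v(1)] by auto
  let ?U = "\<lambda>t z. ift (\<lambda>\<zeta>. damp t (fst \<zeta>) * g \<zeta>) z"
  define X where "X = (\<lambda>z. \<Sum>k\<in>K. of_real (hat (v z) k) * ?U (pw k) z)"
  define Y where "Y = (\<lambda>z. \<Sum>j\<in>J. layer v K g j z)"
  have [measurable]: "X \<in> borel_measurable borel" "Y \<in> borel_measurable borel"
    unfolding X_def Y_def by measurable
  have e1: "integrable lborel (\<lambda>\<zeta>. damp (pw i) (fst \<zeta>) * g \<zeta>)" for i
    by (rule integrable_mult_bounded[OF g(1), where c = 1]) auto
  have e2: "integrable lborel (\<lambda>\<zeta>. damp (pw i) (snd \<zeta>) * (band j \<zeta> * g \<zeta>))" for i j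
    by (rule integrable_mult_bounded[OF integrable_band[OF g(1)], where c = 1]) auto
  have model: "ift (\<lambda>\<zeta>. model J k \<zeta> * g \<zeta>) z = ?U (pw k) z + (\<Sum>j\<in>{j\<in>J. - j \<le> k}. piece g j k z)" for k z
  proof -
    have "ift (\<lambda>\<zeta>. model J k \<zeta> * g \<zeta>) z = ift (\<lambda>\<zeta>. damp (pw k) (fst \<zeta>) * g \<zeta>
        + (\<Sum>j\<in>{j\<in>J. - j \<le> k}. damp (pw (k + j)) (snd \<zeta>) * (band j \<zeta> * g \<zeta>))) z"
      by (simp add: model_def distrib_right sum_distrib_right mult.assoc)
    also have "\<dots> = ?U (pw k) z + ift (\<lambda>\<zeta>. \<Sum>j\<in>{j\<in>J. - j \<le> k}. damp (pw (k + j)) (snd \<zeta>) * (band j \<zeta> * g \<zeta>)) z"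
      by (intro ift_add e1 Bochner_Integration.integrable_sum e2)
    also have "ift (\<lambda>\<zeta>. \<Sum>j\<in>{j\<in>J. - j \<le> k}. damp (pw (k + j)) (snd \<zeta>) * (band j \<zeta> * g \<zeta>)) z = (\<Sum>j\<in>{j\<in>J. - j \<le> k}. piece g j k z)"
      unfolding piece_def using J by (intro ift_sum e2) auto
    finally show ?thesis .
  qed
  have "(\<Sum>k\<in>K. of_real (hat (v z) k) * ift (\<lambda>\<zeta>. model J k \<zeta> * g \<zeta>) z) = X z + Y z" for z
  proof -
    have "(\<Sum>k\<in>K. of_real (hat (v z) k) * (\<Sum>j\<in>{j\<in>J. - j \<le> k}. piece g j k z))
      = (\<Sum>k\<in>K. \<Sum>j\<in>{j\<in>J. - j \<le> k}. of_real (hat (v z) k) * piece g j k z)"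
      by (simp add: sum_distrib_left)
    also have "\<dots> = (\<Sum>j\<in>J. \<Sum>k\<in>{k\<in>K. - j \<le> k}. of_real (hat (v z) k) * piece g j k z)"
      by (rule sum.swap_restrict[OF K J])
    finally show ?thesis unfolding model by (simp add: distrib_left sum.distrib X_def Y_def layer_def)
  qed
  then have "l2sq (\<lambda>z. \<Sum>k\<in>K. of_real (hat (v z) k) * ift (\<lambda>\<zeta>. model J k \<zeta> * g \<zeta>) z) = l2sq (\<lambda>z. X z + Y z)" by simp
  also have "\<dots> \<le> 2 * l2sq X + 2 * l2sq Y" by (rule l2sq_add_le) measurable
  also have "l2sq X \<le> 132 * l2sq g"
  proof -
    define T where "T = pw ` K"
    have T: "finite T" "T \<subseteq> {0<..}" using K by (auto simp: T_def)
    have um: "?U t \<in> borel_measurable lborel" for t by simp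
    obtain b where b: "\<And>z. b z \<ge> 0" "\<And>t z. t \<in> T \<Longrightarrow> cmod (?U t z) \<le> b z"
      "(\<integral>\<^sup>+z. ennreal ((b z)\<^sup>2) \<partial>lborel) \<le> 132 * l2sq g"
      using SUP_majorant[OF T(1) um maximal_ift_fst[OF g(1) T]] by blast
    have "cmod (X z) \<le> b z" for z
      unfolding X_def using K b by (intro norm_sum_hat_le) (auto simp: T_def)
    then have "l2sq X \<le> (\<integral>\<^sup>+z. ennreal ((b z)\<^sup>2) \<partial>lborel)" by (rule l2sq_le_majorant)
    also note b(3)
    finally show ?thesis .
  qed
  also have "l2sq Y \<le> 6912 * l2sq g" unfolding Y_def by (rule l2sq_sum_layers_le[OF g K J v])
  also have "2 * (132 * l2sq g) + 2 * (6912 * l2sq g) = 14088 * l2sq g"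
    by (simp only: mult.assoc[symmetric] distrib_right[symmetric]) simp
  finally show ?thesis by (simp add: add_mono mult_left_mono)
qed

text \<open>The decay away from \<open>s = 1\<close> in both directions. By the convention \<open>1 / 0 = 0\<close> its value at \<open>0\<close> is \<open>0\<close>.\<close>

definition min_inv :: "real \<Rightarrow> real" where "min_inv s = min s (1 / s)"

lemma min_inv_nonneg: "s \<ge> 0 \<Longrightarrow> min_inv s \<ge> 0" by (simp add: min_inv_def)

lemma min_inv_le_1: "s \<ge> 0 \<Longrightarrow> min_inv s \<le> 1"
  by (cases "s \<le> 1") (auto simp: min_inv_def min_le_iff_disj)

lemma sum_min_inv_le:
  assumes K: "finite K" and s: "s \<ge> 0"
  shows "(\<Sum>k\<in>K. (min_inv (pw k * s))\<^sup>2) \<le> 8"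
proof (cases "s = 0")
  case True
  then show ?thesis by (simp add: min_inv_def)
next
  case False
  define j where "j = \<lfloor>log 2 s\<rfloor>"
  have s0: "s > 0" using False s by auto
  have j: "pw j \<le> s" "s \<le> 2 * pw j"
  proof -
    have "of_int j \<le> log 2 s" "log 2 s \<le> of_int j + 1" unfolding j_def by linarith+
    then have "2 powr of_int j \<le> s" "s \<le> 2 powr (of_int j + 1)"
      using s0 by (simp_all add: le_log_iff log_le_iff)
    then show "pw j \<le> s" "s \<le> 2 * pw j" by (simp_all add: pw_def powr_add)
  qed
  have "(min_inv (pw k * s))\<^sup>2 \<le> 2 * pw (- \<bar>k - (- j)\<bar>)" for k
  proof -
    have sp: "pw k * s > 0" using s0 by simp
    have "(min_inv (pw k * s))\<^sup>2 \<le> min_inv (pw k * s)"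
      using min_inv_nonneg[of "pw k * s"] min_inv_le_1[of "pw k * s"] sp by (simp add: power2_eq_square mult_left_le)
    also have "\<dots> \<le> 2 * pw (- \<bar>k - (- j)\<bar>)"
    proof (cases "k + j \<ge> 0")
      case True
      have "pw (k + j) \<le> pw k * s" using j(1) by (simp add: pw_add)
      then have "1 / (pw k * s) \<le> 1 / pw (k + j)" using sp by (intro divide_left_mono) auto
      also have "1 / pw (k + j) = pw (- (k + j))" by (simp only: pw_minus)
      also have "- (k + j) = - \<bar>k - (- j)\<bar>" using True by simp
      finally show ?thesis using pw_nonneg[of "- \<bar>k - (- j)\<bar>"] unfolding min_inv_def by linarith
    next
      case False
      have "pw k * s \<le> 2 * pw (k + j)" using mult_left_mono[OF j(2), of "pw k"] by (simp add: pw_add mult_ac)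
      then show ?thesis using False by (simp add: min_inv_def add.commute)
    qed
    finally show ?thesis .
  qed
  then have "(\<Sum>k\<in>K. (min_inv (pw k * s))\<^sup>2) \<le> (\<Sum>k\<in>K. 2 * pw (- \<bar>k - (- j)\<bar>))" by (intro sum_mono)
  also have "\<dots> \<le> 2 * 4" using sum_pw_dist_le[OF K, of "- j"] unfolding sum_distrib_left[symmetric] by simp
  finally show ?thesis by simp
qed

lemma exp_minus_le_inverse:
  fixes x :: real assumes "x > 0" shows "exp (- x) \<le> 1 / x"
proof -
  have "x \<le> exp x" using exp_ge_add_one_self[of x] by linarith
  then have "1 / exp x \<le> 1 / x" using assms by (intro divide_left_mono) auto
  then show ?thesis by (simp add: exp_minus divide_inverse)
qed

lemma one_minus_exp_le: "1 - exp (- x) \<le> (x::real)"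
  using exp_ge_add_one_self[of "- x"] by linarith

text \<open>An exponential approximates a step function up to an error that is small away from the jump.\<close>

lemma step_minus_exp_le:
  assumes u: "r / 2 \<le> u" "u \<le> 2 * r" and r: "r \<ge> 0"
  shows "\<bar>(if r < 1 then 1 else 0) - exp (- 2 * pi * u)\<bar> \<le> 16 * min_inv r"
proof (cases "r < 1")
  case True
  have "1 - exp (- (2 * pi * u)) \<le> 2 * pi * u" by (rule one_minus_exp_le)
  also have "\<dots> \<le> 2 * 4 * (2 * r)" using u r pi_less_4 by (intro mult_mono) auto
  finally have "1 - exp (- (2 * pi * u)) \<le> 16 * r" by simp
  moreover have "min_inv r = r"
  proof (cases "r = 0")
    case False
    then have "r \<le> 1 / r" using True r mult_mono[of r 1 r 1] by (simp add: pos_le_divide_eq)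
    then show ?thesis by (simp add: min_inv_def)
  qed (simp add: min_inv_def)
  moreover have "exp (- (2 * pi * u)) \<le> 1" using u r by simp
  ultimately show ?thesis using True by simp
next
  case False
  have "exp (- (2 * pi * u)) \<le> 1 / (2 * pi * u)"
    using u False by (intro exp_minus_le_inverse) auto
  also have "\<dots> \<le> 1 / r"
  proof (intro divide_left_mono)
    have "2 * 3 * (r / 2) \<le> 2 * pi * u" using u r pi_gt3 by (intro mult_mono) auto
    then show "r \<le> 2 * pi * u" using r by linarith
  qed (use u False in auto)
  also have "1 / r = min_inv r"
  proof -
    have "1 / r \<le> 1" using False by simp
    then have "1 / r \<le> r" using False by linarith
    then show ?thesis by (simp add: min_inv_def min_def)
  qed
  finally have "exp (- (2 * pi * u)) \<le> min_inv r" .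
  moreover have "min_inv r \<ge> 0" using r by (rule min_inv_nonneg)
  ultimately show ?thesis using False by (simp add: abs_le_iff)
qed

section \<open>From the model operator to the sharp cutoff\<close>

text \<open>Let \<open>2^j \<le> \<bar>\<xi>\<bar> < 2^(j+1)\<close>. If \<open>- j \<le> k'\<close>, the model symbol consists of the damping in \<open>\<eta>\<close>, which approximates
  the sharp cutoff, and of an exponential in \<open>\<bar>\<xi>\<bar>\<close> with \<open>2^k \<bar>\<xi>\<bar> \<ge> 1/2\<close>, where it decays. Otherwise
  \<open>2^k \<bar>\<xi> \<eta>\<bar> \<le> 2^k \<bar>\<xi>\<bar> < 1\<close>, so the sharp symbol is \<open>1\<close>, and the model symbol is the exponential alone,
  close to \<open>1\<close>. The second option for \<open>k'\<close> is needed because the hat weights involve two neighbouring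
  scales.\<close>

lemma chi_minus_model_le:
  assumes k': "k' = k \<or> k' = k + 1" and J: "k' \<le> N" "J = {- N..R}"
    and \<zeta>: "\<bar>snd \<zeta>\<bar> < 1" "\<bar>fst \<zeta>\<bar> < pw R"
  shows "cmod (chi k \<zeta> - model J k' \<zeta>) \<le> 16 * min_inv (pw k * \<bar>fst \<zeta>\<bar>) + 16 * min_inv (pw k * \<bar>fst \<zeta> * snd \<zeta>\<bar>)"
proof (cases "fst \<zeta> = 0")
  case True
  have "\<not> pw j \<le> 0" for j using pw_pos[of j] by linarith
  then have "band j \<zeta> = 0" for j using True by (simp add: band_def)
  then show ?thesis using True by (simp add: chi_def model_def min_inv_def)
next
  case False
  define j where "j = \<lfloor>log 2 \<bar>fst \<zeta>\<bar>\<rfloor>"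
  define s where "s = pw k * \<bar>fst \<zeta>\<bar>"
  define r where "r = pw k * \<bar>fst \<zeta> * snd \<zeta>\<bar>"
  have j: "pw j \<le> \<bar>fst \<zeta>\<bar>" "\<bar>fst \<zeta>\<bar> < 2 * pw j"
  proof -
    have "of_int j \<le> log 2 \<bar>fst \<zeta>\<bar>" "log 2 \<bar>fst \<zeta>\<bar> < of_int j + 1" unfolding j_def by linarith+
    then have "2 powr of_int j \<le> \<bar>fst \<zeta>\<bar>" "\<bar>fst \<zeta>\<bar> < 2 powr (of_int j + 1)"
      using False by (simp_all add: le_log_iff log_less_iff)
    then show "pw j \<le> \<bar>fst \<zeta>\<bar>" "\<bar>fst \<zeta>\<bar> < 2 * pw j" by (simp_all add: pw_def powr_add)
  qed
  have b: "band j \<zeta> = 1" using j by (simp add: band_def pw_add mult.commute)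
  have b0: "band i \<zeta> = 0" if "i \<noteq> j" for i
    using band_unique[of i \<zeta> j] b that by force
  have s0: "s > 0" using False by (simp add: s_def)
  have rs: "r = s * \<bar>snd \<zeta>\<bar>" by (simp add: r_def s_def abs_mult)
  have r0: "r \<ge> 0" "r \<le> s" using s0 \<zeta> by (auto simp: rs mult_left_le)
  have chi: "chi k \<zeta> = of_real (if r < 1 then 1 else 0)" by (simp add: chi_def r_def)
  define s' where "s' = pw k' * \<bar>fst \<zeta>\<bar>"
  have s': "s \<le> s'" "s' \<le> 2 * s" using k' False by (auto simp: s_def s'_def pw_add)
  have mm0: "min_inv s \<ge> 0" "min_inv r \<ge> 0" using s0 r0 by (auto intro: min_inv_nonneg)
  show ?thesis
  proof (cases "- j \<le> k'")
    case True
    have "pw j < pw R" using j(1) \<zeta>(2) by linarith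
    then have jJ: "j \<in> {j\<in>J. - j \<le> k'}" using True J by auto
    define u where "u = pw (k' + j) * \<bar>snd \<zeta>\<bar>"
    have "(\<Sum>i\<in>{i\<in>J. - i \<le> k'}. damp (pw (k' + i)) (snd \<zeta>) * band i \<zeta>)
      = (\<Sum>i\<in>{j}. damp (pw (k' + i)) (snd \<zeta>) * band i \<zeta>)"
    proof (rule sum.mono_neutral_right)
      have "finite J" unfolding J(2) by simp
      then show "finite {i \<in> J. - i \<le> k'}" by simp
      show "{j} \<subseteq> {i \<in> J. - i \<le> k'}" using jJ by blast
    qed (use b0 in auto)
    then have model: "model J k' \<zeta> = of_real (exp (- 2 * pi * s') + exp (- 2 * pi * u))"
      by (simp add: model_def b u_def s'_def mult.assoc)
    have u: "r / 2 \<le> u" "u \<le> 2 * r"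
    proof -
      have 1: "pw k * pw j * \<bar>snd \<zeta>\<bar> \<le> r"
        unfolding rs s_def using j(1) by (intro mult_right_mono mult_left_mono) auto
      have "r \<le> pw k * (2 * pw j) * \<bar>snd \<zeta>\<bar>"
        unfolding rs s_def using j(2) by (intro mult_right_mono mult_left_mono) auto
      then have 2: "r / 2 \<le> pw k * pw j * \<bar>snd \<zeta>\<bar>" by simp
      have "u = pw k * pw j * \<bar>snd \<zeta>\<bar> \<or> u = 2 * (pw k * pw j * \<bar>snd \<zeta>\<bar>)"
        using k' by (auto simp: u_def pw_add)
      then show "r / 2 \<le> u" "u \<le> 2 * r" using 1 2 r0 by linarith+
    qed
    have 1: "\<bar>(if r < 1 then 1 else 0) - exp (- 2 * pi * u)\<bar> \<le> 16 * min_inv r"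
      by (rule step_minus_exp_le[OF u r0(1)])
    have 2: "exp (- 2 * pi * s') \<le> 16 * min_inv s"
    proof (cases "s < 1")
      case False
      have "\<bar>(if s < 1 then 1 else 0) - exp (- 2 * pi * s')\<bar> \<le> 16 * min_inv s"
        using s' s0 by (intro step_minus_exp_le) auto
      then show ?thesis using False by simp
    next
      case s1: True
      have "1 \<le> pw (k' + j)" using True pw_le_iff[of 0 "k' + j"] by simp
      also have "\<dots> \<le> s'" unfolding s'_def pw_add using j(1) by (intro mult_left_mono) auto
      finally have "1 \<le> s'" .
      then have half: "1 / 2 \<le> s" using s' by linarith
      have "1 / 2 \<le> 1 / s" using s0 s1 by (simp add: field_simps)
      with half have "1 / 2 \<le> min_inv s" by (simp add: min_inv_def)
      moreover have "exp (- 2 * pi * s') \<le> 1" using s' s0 by simp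
      ultimately show ?thesis by linarith
    qed
    have "chi k \<zeta> - model J k' \<zeta> = of_real (((if r < 1 then 1 else 0) - exp (- 2 * pi * u)) - exp (- 2 * pi * s'))"
      unfolding chi model by simp
    then have "cmod (chi k \<zeta> - model J k' \<zeta>) = \<bar>((if r < 1 then 1 else 0) - exp (- 2 * pi * u)) - exp (- 2 * pi * s')\<bar>"
      by (simp only: norm_of_real)
    also have "\<dots> \<le> 16 * min_inv r + 16 * min_inv s"
    proof -
      have "\<bar>a - b\<bar> \<le> x + y" if "\<bar>a\<bar> \<le> x" "0 \<le> b" "b \<le> y" for a b x y :: real
        using that by linarith
      from this[OF 1 _ 2] show ?thesis by simp
    qed
    finally show ?thesis by (simp add: s_def r_def)
  next
    case False
    have "(\<Sum>i\<in>{i\<in>J. - i \<le> k'}. damp (pw (k' + i)) (snd \<zeta>) * band i \<zeta>) = 0"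
      using False b0 by (intro sum.neutral) auto
    then have model: "model J k' \<zeta> = of_real (exp (- 2 * pi * s'))"
      by (simp add: model_def s'_def mult.assoc)
    have "s' < pw k' * (2 * pw j)" unfolding s'_def using j(2) by (intro mult_strict_left_mono) auto
    also have "\<dots> = pw (k' + j + 1)" by (simp add: pw_add)
    also have "\<dots> \<le> 1" using False pw_le_iff[of "k' + j + 1" 0] by simp
    finally have s1: "s < 1" "r < 1" using s' r0 by linarith+
    have "\<bar>(if s < 1 then 1 else 0) - exp (- 2 * pi * s')\<bar> \<le> 16 * min_inv s"
      using s' s0 by (intro step_minus_exp_le) auto
    then have 1: "\<bar>1 - exp (- 2 * pi * s')\<bar> \<le> 16 * min_inv s" using s1 by simp
    have "chi k \<zeta> - model J k' \<zeta> = of_real (1 - exp (- 2 * pi * s'))"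
      unfolding chi model using s1 by simp
    then have "cmod (chi k \<zeta> - model J k' \<zeta>) = \<bar>1 - exp (- 2 * pi * s')\<bar>"
      by (simp only: norm_of_real)
    then show ?thesis using 1 mm0 by (simp add: s_def r_def)
  qed
qed

text \<open>Plancherel's inequality for the sum of squares of the errors; \<open>8192 = 512 * (8 + 8)\<close>.\<close>

lemma square_function_bound:
  assumes g: "integrable lborel g" and supp: "\<And>\<zeta>. g \<zeta> \<noteq> 0 \<Longrightarrow> \<bar>snd \<zeta>\<bar> < 1 \<and> \<bar>fst \<zeta>\<bar> < pw R"
    and e: "e = 0 \<or> e = 1" and K: "finite K" "\<And>k. k \<in> K \<Longrightarrow> k + e \<le> N" and J: "J = {- N..R}"
  shows "(\<Sum>k\<in>K. l2sq (ift (\<lambda>\<zeta>. (chi k \<zeta> - model J (k + e) \<zeta>) * g \<zeta>))) \<le> 8192 * l2sq g"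
proof -
  have [measurable]: "g \<in> borel_measurable borel" using g by auto
  have fJ: "finite J" using J by simp
  have i: "integrable lborel (\<lambda>\<zeta>. (chi k \<zeta> - model J (k + e) \<zeta>) * g \<zeta>)" for k
  proof (rule integrable_mult_bounded[OF g])
    show "cmod (chi k \<zeta> - model J (k + e) \<zeta>) \<le> 1 + (1 + real (card J))" for \<zeta>
      by (intro order_trans[OF norm_triangle_ineq4] add_mono norm_model_le fJ) (simp add: chi_def)
  qed measurable
  have "(\<Sum>k\<in>K. l2sq (ift (\<lambda>\<zeta>. (chi k \<zeta> - model J (k + e) \<zeta>) * g \<zeta>))) \<le> (\<Sum>k\<in>K. l2sq (\<lambda>\<zeta>. (chi k \<zeta> - model J (k + e) \<zeta>) * g \<zeta>))"
    by (intro sum_mono plancherel_2d i)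
  also have "\<dots> = (\<integral>\<^sup>+\<zeta>. (\<Sum>k\<in>K. ennreal ((cmod ((chi k \<zeta> - model J (k + e) \<zeta>) * g \<zeta>))\<^sup>2)) \<partial>lborel)"
    unfolding l2sq_def by (rule nn_integral_sum[symmetric]) measurable
  also have "\<dots> \<le> (\<integral>\<^sup>+\<zeta>. 8192 * ennreal ((cmod (g \<zeta>))\<^sup>2) \<partial>lborel)"
  proof (rule nn_integral_mono)
    fix \<zeta>
    show "(\<Sum>k\<in>K. ennreal ((cmod ((chi k \<zeta> - model J (k + e) \<zeta>) * g \<zeta>))\<^sup>2)) \<le> 8192 * ennreal ((cmod (g \<zeta>))\<^sup>2)"
    proof (cases "g \<zeta> = 0")
      case False
      note s = supp[OF False]
      let ?a = "\<lambda>k. min_inv (pw k * \<bar>fst \<zeta>\<bar>)" and ?b = "\<lambda>k. min_inv (pw k * \<bar>fst \<zeta> * snd \<zeta>\<bar>)"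
      have "(\<Sum>k\<in>K. (cmod (chi k \<zeta> - model J (k + e) \<zeta>))\<^sup>2) \<le> (\<Sum>k\<in>K. 512 * (?a k)\<^sup>2 + 512 * (?b k)\<^sup>2)"
      proof (rule sum_mono)
        fix k assume "k \<in> K"
        then have "cmod (chi k \<zeta> - model J (k + e) \<zeta>) \<le> 16 * ?a k + 16 * ?b k"
          using e K(2) s by (intro chi_minus_model_le[OF _ _ J]) auto
        then have "(cmod (chi k \<zeta> - model J (k + e) \<zeta>))\<^sup>2 \<le> (16 * ?a k + 16 * ?b k)\<^sup>2"
          by (intro power_mono) auto
        also have "\<dots> \<le> 512 * (?a k)\<^sup>2 + 512 * (?b k)\<^sup>2"
          using sum_squares_bound[of "16 * ?a k" "16 * ?b k"] by (simp add: power2_sum power_mult_distrib)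
        finally show "(cmod (chi k \<zeta> - model J (k + e) \<zeta>))\<^sup>2 \<le> \<dots>" .
      qed
      also have "\<dots> = 512 * (\<Sum>k\<in>K. (?a k)\<^sup>2) + 512 * (\<Sum>k\<in>K. (?b k)\<^sup>2)"
        by (simp only: sum.distrib sum_distrib_left)
      also have "\<dots> \<le> 512 * 8 + 512 * 8"
        by (intro add_mono mult_left_mono sum_min_inv_le K) auto
      finally have "(\<Sum>k\<in>K. (cmod (chi k \<zeta> - model J (k + e) \<zeta>))\<^sup>2) \<le> 8192" by simp
      from mult_right_mono[OF this, of "(cmod (g \<zeta>))\<^sup>2"]
      have "(\<Sum>k\<in>K. (cmod ((chi k \<zeta> - model J (k + e) \<zeta>) * g \<zeta>))\<^sup>2) \<le> 8192 * (cmod (g \<zeta>))\<^sup>2"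
        by (simp add: sum_distrib_right norm_mult power_mult_distrib)
      from ennreal_leI[OF this] show ?thesis by (simp add: sum_ennreal ennreal_mult')
    qed simp
  qed
  also have "\<dots> = 8192 * l2sq g" unfolding l2sq_def by (rule nn_integral_cmult) measurable
  finally show ?thesis .
qed

text \<open>With \<open>\<kappa> = \<lfloor>log 2 (v z)\<rfloor>\<close>, the weights at \<open>\<kappa>\<close> and \<open>\<kappa> + 1\<close> add up to \<open>1\<close>, so the operator differs from the
  model operator by an average of the two errors \<open>E 0 \<kappa> z\<close> and \<open>E 1 \<kappa> z\<close>, each of which is bounded by
  its square function.\<close>

lemma truncated_operator_bound:
  fixes v :: "real \<times> real \<Rightarrow> real" and n R :: int
  assumes g: "integrable lborel g" "l2sq g < top" and supp: "\<And>\<zeta>. g \<zeta> \<noteq> 0 \<Longrightarrow> \<bar>snd \<zeta>\<bar> < 1 \<and> \<bar>fst \<zeta>\<bar> < pw R"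
    and v: "1-lipschitz_on UNIV v" "\<And>z. v z > 0"
  shows "(\<integral>\<^sup>+z. indicator {z. \<lfloor>log 2 (v z)\<rfloor> \<in> {1..n}} z * ennreal ((cmod (ift (\<lambda>\<zeta>. chi \<lfloor>log 2 (v z)\<rfloor> \<zeta> * g \<zeta>) z))\<^sup>2) \<partial>lborel)
    \<le> 92000 * l2sq g"
proof -
  have gm[measurable]: "g \<in> borel_measurable borel" and vm[measurable]: "v \<in> borel_measurable borel"
    using g lipschitz_measurable[OF v(1)] by auto
  define J where "J = {- (n + 1)..R}"
  have fJ: "finite J" by (simp add: J_def)
  define E where "E = (\<lambda>e k. ift (\<lambda>\<zeta>. (chi k \<zeta> - model J (k + e) \<zeta>) * g \<zeta>))"
  define U where "U = (\<lambda>z. \<Sum>k\<in>{1..n + 1}. of_real (hat (v z) k) * ift (\<lambda>\<zeta>. model J k \<zeta> * g \<zeta>) z)"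
  have [measurable]: "E e k \<in> borel_measurable borel" "U \<in> borel_measurable borel" for e k
    unfolding E_def U_def by measurable
  have i1: "integrable lborel (\<lambda>\<zeta>. chi k \<zeta> * g \<zeta>)" for k
    by (rule integrable_mult_bounded[OF g(1), where c = 1]) (auto simp: chi_def)
  have i2: "integrable lborel (\<lambda>\<zeta>. model J k \<zeta> * g \<zeta>)" for k
    by (rule integrable_mult_bounded[OF g(1)]) (measurable, rule norm_model_le[OF fJ])
  have Eeq: "E e k z = ift (\<lambda>\<zeta>. chi k \<zeta> * g \<zeta>) z - ift (\<lambda>\<zeta>. model J (k + e) \<zeta> * g \<zeta>) z" for e k z
    unfolding E_def left_diff_distrib by (rule ift_diff[OF i1 i2])
  have "(\<integral>\<^sup>+z. indicator {z. \<lfloor>log 2 (v z)\<rfloor> \<in> {1..n}} z * ennreal ((cmod (ift (\<lambda>\<zeta>. chi \<lfloor>log 2 (v z)\<rfloor> \<zeta> * g \<zeta>) z))\<^sup>2) \<partial>lborel)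
    \<le> (\<integral>\<^sup>+z. 3 * ((\<Sum>k\<in>{1..n}. ennreal ((cmod (E 0 k z))\<^sup>2)) + (\<Sum>k\<in>{1..n}. ennreal ((cmod (E 1 k z))\<^sup>2)) + ennreal ((cmod (U z))\<^sup>2)) \<partial>lborel)"
  proof (rule nn_integral_mono)
    fix z
    define \<kappa> where "\<kappa> = \<lfloor>log 2 (v z)\<rfloor>"
    define S where "S = ift (\<lambda>\<zeta>. chi \<kappa> \<zeta> * g \<zeta>) z"
    show "indicator {z. \<lfloor>log 2 (v z)\<rfloor> \<in> {1..n}} z * ennreal ((cmod (ift (\<lambda>\<zeta>. chi \<lfloor>log 2 (v z)\<rfloor> \<zeta> * g \<zeta>) z))\<^sup>2)
      \<le> 3 * ((\<Sum>k\<in>{1..n}. ennreal ((cmod (E 0 k z))\<^sup>2)) + (\<Sum>k\<in>{1..n}. ennreal ((cmod (E 1 k z))\<^sup>2)) + ennreal ((cmod (U z))\<^sup>2))"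
    proof (cases "\<kappa> \<in> {1..n}")
      case True
      let ?p = "hat (v z) \<kappa>" and ?q = "hat (v z) (\<kappa> + 1)"
      have pq: "?p + ?q = 1" unfolding \<kappa>_def by (rule hat_floor_sum)
      have U: "U z = of_real ?p * ift (\<lambda>\<zeta>. model J \<kappa> \<zeta> * g \<zeta>) z + of_real ?q * ift (\<lambda>\<zeta>. model J (\<kappa> + 1) \<zeta> * g \<zeta>) z"
        unfolding U_def \<kappa>_def using True by (intro sum_hat_eq) (auto simp: \<kappa>_def)
      have "S = of_real (?p + ?q) * S" using pq by simp
      also have "\<dots> = of_real ?p * E 0 \<kappa> z + of_real ?q * E 1 \<kappa> z + U z"
        unfolding Eeq U S_def by (simp add: algebra_simps)
      finally have S: "S = of_real ?p * E 0 \<kappa> z + of_real ?q * E 1 \<kappa> z + U z" .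
      have p1: "?p \<le> 1" "?q \<le> 1" using pq hat_nonneg[of "v z" \<kappa>] hat_nonneg[of "v z" "\<kappa> + 1"] by linarith+
      have "cmod S \<le> cmod (E 0 \<kappa> z) + cmod (E 1 \<kappa> z) + cmod (U z)"
        unfolding S using p1
        by (intro order_trans[OF norm_triangle_ineq] add_mono) (auto simp: norm_mult mult_left_le_one_le)
      then have "(cmod S)\<^sup>2 \<le> (cmod (E 0 \<kappa> z) + cmod (E 1 \<kappa> z) + cmod (U z))\<^sup>2"
        by (intro power_mono) auto
      also have "\<dots> \<le> 3 * ((cmod (E 0 \<kappa> z))\<^sup>2 + (cmod (E 1 \<kappa> z))\<^sup>2 + (cmod (U z))\<^sup>2)"
      proof -
        have "(a + b + c)\<^sup>2 \<le> 3 * (a\<^sup>2 + b\<^sup>2 + c\<^sup>2)" for a b c :: real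
          using sum_squares_bound[of a b] sum_squares_bound[of a c] sum_squares_bound[of b c]
          by (simp add: power2_eq_square algebra_simps)
        then show ?thesis .
      qed
      also have "\<dots> \<le> 3 * ((\<Sum>k\<in>{1..n}. (cmod (E 0 k z))\<^sup>2) + (\<Sum>k\<in>{1..n}. (cmod (E 1 k z))\<^sup>2) + (cmod (U z))\<^sup>2)"
      proof -
        have "(cmod (E e \<kappa> z))\<^sup>2 \<le> (\<Sum>k\<in>{1..n}. (cmod (E e k z))\<^sup>2)" for e
          by (rule member_le_sum[OF True]) auto
        then show ?thesis by (intro mult_left_mono add_mono) auto
      qed
      finally have "ennreal ((cmod S)\<^sup>2) \<le> ennreal (3 * ((\<Sum>k\<in>{1..n}. (cmod (E 0 k z))\<^sup>2) + (\<Sum>k\<in>{1..n}. (cmod (E 1 k z))\<^sup>2) + (cmod (U z))\<^sup>2))"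
        by (rule ennreal_leI)
      also have "\<dots> = 3 * ((\<Sum>k\<in>{1..n}. ennreal ((cmod (E 0 k z))\<^sup>2)) + (\<Sum>k\<in>{1..n}. ennreal ((cmod (E 1 k z))\<^sup>2)) + ennreal ((cmod (U z))\<^sup>2))"
        by (simp add: ennreal_mult' sum_ennreal sum_nonneg)
      finally show ?thesis using True by (simp add: S_def \<kappa>_def)
    qed (simp add: \<kappa>_def)
  qed
  also have "\<dots> = 3 * ((\<Sum>k\<in>{1..n}. l2sq (E 0 k)) + (\<Sum>k\<in>{1..n}. l2sq (E 1 k)) + l2sq U)"
    unfolding l2sq_def by (simp add: nn_integral_cmult nn_integral_add nn_integral_sum del: sum_ennreal)
  also have "\<dots> \<le> 3 * (8192 * l2sq g + 8192 * l2sq g + 14088 * l2sq g)"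
  proof (intro mult_left_mono add_mono)
    show "(\<Sum>k\<in>{1..n}. l2sq (E 0 k)) \<le> 8192 * l2sq g"
      unfolding E_def by (rule square_function_bound[OF g(1) supp _ _ _ J_def]) auto
    show "(\<Sum>k\<in>{1..n}. l2sq (E 1 k)) \<le> 8192 * l2sq g"
      unfolding E_def by (rule square_function_bound[OF g(1) supp _ _ _ J_def]) auto
    show "l2sq U \<le> 14088 * l2sq g"
      unfolding U_def by (rule model_operator_bound[OF g _ fJ v]) auto
  qed auto
  also have "\<dots> = 91416 * l2sq g"
    by (simp only: distrib_right[symmetric] mult.assoc[symmetric]) simp
  also have "\<dots> \<le> 92000 * l2sq g" by (intro mult_right_mono) auto
  finally show ?thesis .
qed

section \<open>Fourier decay of Schwartz functions\<close>

text \<open>An integrable weight on the plane that dominates all Schwartz functions up to constants.\<close>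

definition cauchy_wt :: "real \<times> real \<Rightarrow> real" where
  "cauchy_wt z = 1 / ((1 + (fst z)\<^sup>2) * (1 + (snd z)\<^sup>2))"

lemma one_plus_square_pos: "1 + (x::real)\<^sup>2 > 0" by (simp add: add_pos_nonneg)

lemma cauchy_wt_nonneg: "cauchy_wt z \<ge> 0" by (simp add: cauchy_wt_def)

lemma integrable_cauchy_wt: "integrable lborel cauchy_wt"
proof (rule integrable_lborel_pairI)
  show "cauchy_wt \<in> borel_measurable borel" unfolding cauchy_wt_def by measurable
  have i: "integrable lborel (\<lambda>x::real. inverse (1 + x\<^sup>2))"
    using integrable_inverse_1_plus_square by (simp add: set_integrable_def einterval_eq)
  then have f: "(\<integral>\<^sup>+x. ennreal (inverse (1 + x\<^sup>2)) \<partial>lborel) < \<infinity>"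
    by (simp add: integrable_iff_bounded add_nonneg_nonneg)
  have "ennreal (norm (cauchy_wt (x, y))) = ennreal (inverse (1 + x\<^sup>2)) * ennreal (inverse (1 + y\<^sup>2))" for x y
    by (simp add: cauchy_wt_def ennreal_mult'[symmetric] divide_inverse add_nonneg_nonneg)
  then show "(\<integral>\<^sup>+x. \<integral>\<^sup>+y. ennreal (norm (cauchy_wt (x, y))) \<partial>lborel \<partial>lborel) < \<infinity>"
    using f by (simp add: nn_integral_cmult nn_integral_multc ennreal_mult_less_top)
qed

lemma cauchy_wt_shift_le:
  assumes "\<bar>t\<bar> \<le> 1"
  shows "cauchy_wt ((t, 0) + z) \<le> 3 * cauchy_wt z"
proof -
  let ?x = "fst z"
  have "?x\<^sup>2 \<le> 2 * (t + ?x)\<^sup>2 + 2 * t\<^sup>2"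
    using zero_le_power2[of "?x + 2 * t"] by (simp add: power2_eq_square algebra_simps)
  moreover have "t\<^sup>2 \<le> 1" using assms by (simp add: abs_square_le_1)
  moreover have "(t + ?x)\<^sup>2 \<ge> 0" by simp
  ultimately have *: "1 + ?x\<^sup>2 \<le> 3 * (1 + (t + ?x)\<^sup>2)" unfolding distrib_left by linarith
  have "1 / (1 + (t + ?x)\<^sup>2) \<le> 3 / (1 + ?x\<^sup>2)"
    using * one_plus_square_pos[of ?x] one_plus_square_pos[of "t + ?x"] by (simp add: field_simps)
  from mult_right_mono[OF this, of "1 / (1 + (snd z)\<^sup>2)"] show ?thesis
    by (simp add: cauchy_wt_def)
qed

lemma rapid_decay_le_cauchy_wt:
  fixes F :: "real \<times> real \<Rightarrow> complex"
  assumes "\<And>N::nat. \<exists>B. \<forall>z. norm z ^ N * cmod (F z) \<le> B"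
  shows "\<exists>C\<ge>0. \<forall>z. cmod (F z) \<le> C * cauchy_wt z"
proof -
  obtain B0 where B0: "\<And>z. norm z ^ 0 * cmod (F z) \<le> B0" using assms by blast
  obtain B4 where B4: "\<And>z. norm z ^ 4 * cmod (F z) \<le> B4" using assms by blast
  have "B0 \<ge> 0" using order_trans[OF norm_ge_zero, of "F 0" B0] B0[of 0] by simp
  moreover have "B4 \<ge> 0" using B4[of 0] by simp
  moreover have "cmod (F z) \<le> (2 * B0 + 2 * B4) * cauchy_wt z" for z
  proof -
    have n: "(norm z)\<^sup>2 = (fst z)\<^sup>2 + (snd z)\<^sup>2" by (simp add: norm_prod_def)
    let ?P = "(1 + (fst z)\<^sup>2) * (1 + (snd z)\<^sup>2)"
    have "?P \<le> (1 + (norm z)\<^sup>2) * (1 + (norm z)\<^sup>2)"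
      unfolding n by (intro mult_mono) auto
    also have "\<dots> \<le> 2 + 2 * norm z ^ 4"
    proof -
      have "(1 + a) * (1 + a) \<le> 2 + 2 * a\<^sup>2" for a :: real
        using zero_le_power2[of "a - 1"] by (simp add: power2_eq_square algebra_simps)
      from this[of "(norm z)\<^sup>2"] show ?thesis by simp
    qed
    finally have "?P * cmod (F z) \<le> (2 + 2 * norm z ^ 4) * cmod (F z)" by (intro mult_right_mono) auto
    also have "\<dots> \<le> 2 * B0 + 2 * B4" using B0[of z] B4[of z] by (simp add: algebra_simps)
    finally have 1: "?P * cmod (F z) \<le> 2 * B0 + 2 * B4" .
    have "?P > 0" by (intro mult_pos_pos one_plus_square_pos)
    with 1 show ?thesis by (simp add: cauchy_wt_def field_simps)
  qed
  ultimately show ?thesis by (intro exI[of _ "2 * B0 + 2 * B4"]) auto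
qed

lemma schwartzD:
  assumes "schwartz f" "set us \<subseteq> Basis"
  shows "iterated_partial us f differentiable (at z)"
    and "\<exists>B. \<forall>z. norm z ^ N * norm (iterated_partial us f z) \<le> B"
  using assms by (simp_all add: schwartz_def)

lemma schwartz_measurable:
  assumes "schwartz (f :: real \<times> real \<Rightarrow> complex)"
  shows "f \<in> borel_measurable borel"
proof -
  have "f differentiable (at z)" for z
    using schwartzD(1)[OF assms, of "[]"] by simp
  then show ?thesis
    by (intro borel_measurable_continuous_onI continuous_at_imp_continuous_on)
       (auto intro: differentiable_imp_continuous_within)
qed

lemma schwartz_le_cauchy_wt:
  assumes "schwartz (f :: real \<times> real \<Rightarrow> complex)"
  shows "\<exists>C\<ge>0. \<forall>z. cmod (f z) \<le> C * cauchy_wt z"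
  using schwartzD(2)[OF assms, of "[]"] by (intro rapid_decay_le_cauchy_wt) simp

lemma schwartz_integrable:
  assumes "schwartz (f :: real \<times> real \<Rightarrow> complex)"
  shows "integrable lborel f"
proof -
  obtain C where C: "C \<ge> 0" "\<And>z. cmod (f z) \<le> C * cauchy_wt z" using schwartz_le_cauchy_wt[OF assms] by blast
  show ?thesis
  proof (rule Bochner_Integration.integrable_bound)
    show "integrable lborel (\<lambda>z. C * cauchy_wt z)" using integrable_cauchy_wt by simp
    show "f \<in> borel_measurable lborel" using schwartz_measurable[OF assms] by simp
    show "AE z in lborel. cmod (f z) \<le> norm (C * cauchy_wt z)"
      using C cauchy_wt_nonneg by (auto simp: abs_mult)
  qed
qed

lemma schwartz_square_integrable:
  assumes "schwartz (f :: real \<times> real \<Rightarrow> complex)"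
  shows "integrable lborel (\<lambda>z. (cmod (f z))\<^sup>2)"
proof -
  obtain C where C: "C \<ge> 0" "\<And>z. cmod (f z) \<le> C * cauchy_wt z" using schwartz_le_cauchy_wt[OF assms] by blast
  have [measurable]: "f \<in> borel_measurable borel" by (rule schwartz_measurable[OF assms])
  have w1: "cauchy_wt z \<le> 1" for z
  proof -
    have "1 * 1 \<le> (1 + (fst z)\<^sup>2) * (1 + (snd z)\<^sup>2)" by (intro mult_mono) auto
    then show ?thesis by (simp add: cauchy_wt_def)
  qed
  show ?thesis
  proof (rule Bochner_Integration.integrable_bound)
    show "integrable lborel (\<lambda>z. C * cmod (f z))" using schwartz_integrable[OF assms] by simp
    show "AE z in lborel. norm ((cmod (f z))\<^sup>2) \<le> norm (C * cmod (f z))"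
    proof (intro always_eventually allI)
      fix z
      have "cmod (f z) \<le> C" using C(2)[of z] mult_left_mono[OF w1[of z] C(1)] by simp
      then show "norm ((cmod (f z))\<^sup>2) \<le> norm (C * cmod (f z))"
        using C(1) by (simp add: power2_eq_square mult_right_mono)
    qed
  qed measurable
qed

lemma schwartz_diff_le:
  assumes f: "schwartz (f :: real \<times> real \<Rightarrow> complex)"
  shows "\<exists>C\<ge>0. \<forall>s z. \<bar>s\<bar> \<le> 1 \<longrightarrow> cmod (f ((s, 0) + z) - f ((- s, 0) + z)) \<le> C * \<bar>s\<bar> * cauchy_wt z"
proof -
  let ?D = "\<lambda>z. frechet_derivative f (at z) (1, 0)"
  have d: "f differentiable (at z)" for z
    using schwartzD(1)[OF f, of "[]"] by simp
  have "\<exists>B. \<forall>z. norm z ^ N * cmod (?D z) \<le> B" for N :: nat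
  proof -
    have "(1, 0) \<in> (Basis :: (real \<times> real) set)" by (simp add: Basis_prod_def)
    then show ?thesis using schwartzD(2)[OF f, of "[(1, 0)]" N] by simp
  qed
  from rapid_decay_le_cauchy_wt[OF this] obtain C where C: "C \<ge> 0" "\<And>z. cmod (?D z) \<le> C * cauchy_wt z" by blast
  have "cmod (f ((s, 0) + z) - f ((- s, 0) + z)) \<le> (6 * C) * \<bar>s\<bar> * cauchy_wt z" if s: "\<bar>s\<bar> \<le> 1" for s z
  proof -
    have der: "((\<lambda>t. f ((t, 0) + z)) has_derivative (\<lambda>h. h *\<^sub>R ?D ((t, 0) + z))) (at t within {- \<bar>s\<bar>..\<bar>s\<bar>})" for t
    proof -
      let ?w = "(t, 0) + z"
      have fd: "(f has_derivative frechet_derivative f (at ?w)) (at ?w)"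
        using d frechet_derivative_works by blast
      have "((\<lambda>t. (t, 0::real) + z) has_derivative (\<lambda>h. (h, 0))) (at t within {- \<bar>s\<bar>..\<bar>s\<bar>})"
        by (auto intro!: derivative_eq_intros)
      from has_derivative_compose[OF this fd]
      have 1: "((\<lambda>t. f ((t, 0) + z)) has_derivative (\<lambda>h. frechet_derivative f (at ?w) (h, 0))) (at t within {- \<bar>s\<bar>..\<bar>s\<bar>})" .
      have "frechet_derivative f (at ?w) (h, 0) = h *\<^sub>R ?D ?w" for h
        using linear_scale[OF has_derivative_linear[OF fd], of h "(1, 0)"] by simp
      from has_derivative_eq_rhs[OF 1 ext[OF this]] show ?thesis .
    qed
    have "cmod (f ((s, 0) + z) - f ((- s, 0) + z)) \<le> (C * (3 * cauchy_wt z)) * norm (s - (- s))"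
    proof (rule differentiable_bound[OF _ der])
      fix t assume "t \<in> {- \<bar>s\<bar>..\<bar>s\<bar>}"
      then have t: "\<bar>t\<bar> \<le> 1" using s by auto
      show "onorm (\<lambda>h. h *\<^sub>R ?D ((t, 0) + z)) \<le> C * (3 * cauchy_wt z)"
      proof (rule onorm_le)
        fix h
        have "cmod (?D ((t, 0) + z)) \<le> C * (3 * cauchy_wt z)"
          using C(2)[of "(t, 0) + z"] mult_left_mono[OF cauchy_wt_shift_le[OF t, of z] C(1)] by linarith
        from mult_left_mono[OF this, of "\<bar>h\<bar>"]
        show "norm (h *\<^sub>R ?D ((t, 0) + z)) \<le> C * (3 * cauchy_wt z) * norm h" by (simp add: mult_ac)
      qed
    qed auto
    then show ?thesis by (simp add: abs_mult mult_ac)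
  qed
  then show ?thesis using C(1) by (intro exI[of _ "6 * C"]) auto
qed

text \<open>A translate by \<open>1 / (4 \<xi>)\<close> multiplies the Fourier integral by \<open>\<plusminus> i\<close>, so the difference of two opposite
  translates reproduces it up to the factor \<open>2\<close> in modulus, while its \<open>L\<^sup>1\<close> norm is \<open>O(1 / \<bar>\<xi>\<bar>)\<close>.\<close>

lemma ift_decay:
  assumes f: "schwartz (f :: real \<times> real \<Rightarrow> complex)"
  shows "\<exists>M\<ge>0. \<forall>w. cmod (ift f w) \<le> M \<and> \<bar>fst w\<bar> * cmod (ift f w) \<le> M"
proof -
  have fi: "integrable lborel f" by (rule schwartz_integrable[OF f])
  have fm[measurable]: "f \<in> borel_measurable borel" by (rule schwartz_measurable[OF f])
  obtain C where C: "C \<ge> 0" "\<And>s z. \<bar>s\<bar> \<le> 1 \<Longrightarrow> cmod (f ((s, 0) + z) - f ((- s, 0) + z)) \<le> C * \<bar>s\<bar> * cauchy_wt z"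
    using schwartz_diff_le[OF f] by blast
  define M where "M = (LINT z|lborel. cmod (f z))"
  define W where "W = (LINT z|lborel. cauchy_wt z)"
  have M0: "M \<ge> 0" by (simp add: M_def)
  have W0: "W \<ge> 0" unfolding W_def by (simp add: cauchy_wt_nonneg)
  have i: "integrable lborel (\<lambda>\<zeta>. f \<zeta> * ch (fst w * fst \<zeta> + snd w * snd \<zeta>))" for w
    using integrable_mult_bounded[OF fi, of "\<lambda>\<zeta>. ch (fst w * fst \<zeta> + snd w * snd \<zeta>)" 1]
    by (simp add: mult.commute)
  have bM: "cmod (ift f w) \<le> M" for w
    unfolding ift_def M_def by (rule order_trans[OF integral_norm_bound]) (simp add: norm_mult)
  have decay: "\<bar>fst w\<bar> * cmod (ift f w) \<le> C * W" if w: "\<bar>fst w\<bar> \<ge> 1 / 4" for w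
  proof -
    define s where "s = 1 / (4 * fst w)"
    have w0: "fst w \<noteq> 0" using w by auto
    have s1: "\<bar>s\<bar> \<le> 1" using w w0 by (simp add: s_def abs_mult field_simps)
    have sw: "fst w * s = 1 / 4" using w0 by (simp add: s_def)
    let ?e = "\<lambda>\<zeta>. ch (fst w * fst \<zeta> + snd w * snd \<zeta>)"
    have shift: "integrable lborel (\<lambda>\<zeta>. f ((c, 0) + \<zeta>) * ?e \<zeta>)"
      "(LINT \<zeta>|lborel. f ((c, 0) + \<zeta>) * ?e \<zeta>) = ch (- (fst w * c)) * ift f w" for c
    proof -
      have e: "f ((c, 0) + \<zeta>) * ?e \<zeta> = ch (- (fst w * c)) * (f ((c, 0) + \<zeta>) * ?e ((c, 0) + \<zeta>))" for \<zeta>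
      proof -
        have "?e \<zeta> = ch (- (fst w * c)) * ?e ((c, 0) + \<zeta>)"
          by (simp add: ch_add[symmetric] algebra_simps)
        then show ?thesis by (simp add: mult_ac)
      qed
      show "integrable lborel (\<lambda>\<zeta>. f ((c, 0) + \<zeta>) * ?e \<zeta>)"
        unfolding e using integrable_translate[of "\<lambda>\<zeta>. f \<zeta> * ?e \<zeta>" "(c, 0)"] i[of w] by simp
      show "(LINT \<zeta>|lborel. f ((c, 0) + \<zeta>) * ?e \<zeta>) = ch (- (fst w * c)) * ift f w"
        unfolding e using integral_translate[of "\<lambda>\<zeta>. f \<zeta> * ?e \<zeta>" "(c, 0)"] by (simp add: ift_def)
    qed
    have "(ch (- (1 / 4)) - ch (1 / 4)) * ift f w = (LINT \<zeta>|lborel. (f ((s, 0) + \<zeta>) - f ((- s, 0) + \<zeta>)) * ?e \<zeta>)"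
      using shift(1)[of s] shift(1)[of "- s"] shift(2)[of s] shift(2)[of "- s"] sw
      by (simp add: left_diff_distrib)
    then have "cmod (ch (- (1 / 4)) - ch (1 / 4)) * cmod (ift f w) = cmod (LINT \<zeta>|lborel. (f ((s, 0) + \<zeta>) - f ((- s, 0) + \<zeta>)) * ?e \<zeta>)"
      by (metis norm_mult)
    also have "\<dots> \<le> (LINT \<zeta>|lborel. C * \<bar>s\<bar> * cauchy_wt \<zeta>)"
    proof (rule order_trans[OF integral_norm_bound integral_mono])
      show "integrable lborel (\<lambda>\<zeta>. norm ((f ((s, 0) + \<zeta>) - f ((- s, 0) + \<zeta>)) * ?e \<zeta>))"
        using shift(1)[of s] shift(1)[of "- s"] by (simp add: left_diff_distrib)
      show "integrable lborel (\<lambda>\<zeta>. C * \<bar>s\<bar> * cauchy_wt \<zeta>)" using integrable_cauchy_wt by simp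
    qed (use C(2)[OF s1] in \<open>simp add: norm_mult\<close>)
    also have "\<dots> = C * \<bar>s\<bar> * W" by (simp add: W_def)
    also have "cmod (ch (- (1 / 4)) - ch (1 / 4)) = 2"
      using norm_ch_diff[of "1 / 4"] by (simp add: norm_minus_commute)
    finally have "2 * cmod (ift f w) \<le> C * \<bar>s\<bar> * W" .
    from mult_left_mono[OF this, of "4 * \<bar>fst w\<bar>"]
    have "8 * (\<bar>fst w\<bar> * cmod (ift f w)) \<le> 4 * (C * \<bar>fst w * s\<bar> * W)" by (simp add: abs_mult mult_ac)
    also have "\<dots> = C * W" by (simp add: sw)
    finally show ?thesis using mult_nonneg_nonneg[OF abs_ge_zero norm_ge_zero, of "fst w" "ift f w"] by linarith
  qed
  have "\<bar>fst w\<bar> * cmod (ift f w) \<le> M + C * W" for w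
  proof (cases "\<bar>fst w\<bar> \<ge> 1 / 4")
    case True
    then show ?thesis using decay M0 by fastforce
  next
    case False
    then have "\<bar>fst w\<bar> * cmod (ift f w) \<le> 1 * M" using bM by (intro mult_mono) auto
    then show ?thesis using C(1) W0 by (simp add: add_increasing2)
  qed
  moreover have "cmod (ift f w) \<le> M + C * W" for w
    using bM[of w] C(1) W0 by (simp add: add_increasing2)
  ultimately show ?thesis using M0 C(1) W0 by (intro exI[of _ "M + C * W"]) auto
qed

lemma ch_eq_exp: "exp (2 * of_real pi * \<i> * of_real s) = ch s"
  by (simp add: ch_def cis_conv_exp mult_ac)

lemma fourier_eq_ift: "fourier f \<zeta> = ift f (- \<zeta>)"
proof -
  have e: "exp (- 2 * of_real pi * \<i> * of_real s) = ch (- s)" for s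
    using ch_eq_exp[of "- s"] by simp
  have "fourier f \<zeta> = (LINT z|lborel. f z * exp (- 2 * of_real pi * \<i> * of_real (fst z * fst \<zeta> + snd z * snd \<zeta>)))"
    by (simp only: fourier_def split_beta' prod.collapse prod.case_eq_if prod.sel)
  also have "\<dots> = ift f (- \<zeta>)"
    unfolding ift_def e by (simp add: algebra_simps)
  finally show ?thesis .
qed

section \<open>Boundedness on Schwartz functions\<close>

lemma T_op_eq_ift:
  assumes "\<And>z. V z = 2 powr of_int \<lfloor>log 2 (v z)\<rfloor>"
  shows "T_op V f z = ift (\<lambda>\<zeta>. chi \<lfloor>log 2 (v z)\<rfloor> \<zeta> * ((if \<bar>snd \<zeta>\<bar> < 1 then 1 else 0) * fourier f \<zeta>)) z"
proof -
  have V: "V z = pw \<lfloor>log 2 (v z)\<rfloor>" by (simp add: assms pw_def)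
  have "T_op V f z = (LINT \<zeta>|lborel. indicator {0..<1} \<bar>snd \<zeta>\<bar> * indicator {0..<1} (V z * \<bar>fst \<zeta> * snd \<zeta>\<bar>) * fourier f \<zeta>
      * exp (2 * of_real pi * \<i> * of_real (fst z * fst \<zeta> + snd z * snd \<zeta>)))"
    by (simp only: T_op_def split_beta' prod.collapse prod.case_eq_if prod.sel)
  also have "\<dots> = ift (\<lambda>\<zeta>. chi \<lfloor>log 2 (v z)\<rfloor> \<zeta> * ((if \<bar>snd \<zeta>\<bar> < 1 then 1 else 0) * fourier f \<zeta>)) z"
    unfolding ift_def ch_eq_exp by (intro Bochner_Integration.integral_cong) (auto simp: chi_def V indicator_def)
  finally show ?thesis .
qed

lemma measurable_ift_chi:
  assumes [measurable]: "g \<in> borel_measurable borel" "v \<in> borel_measurable borel"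
  shows "(\<lambda>z. ift (\<lambda>\<zeta>. chi \<lfloor>log 2 (v z)\<rfloor> \<zeta> * g \<zeta>) z) \<in> borel_measurable borel"
  unfolding ift_def
proof (rule lborel.borel_measurable_lebesgue_integral)
  show "(\<lambda>(z, \<zeta>). chi \<lfloor>log 2 (v z)\<rfloor> \<zeta> * g \<zeta> * ch (fst z * fst \<zeta> + snd z * snd \<zeta>)) \<in> borel_measurable (borel \<Otimes>\<^sub>M lborel)"
    unfolding chi_def pw_def by measurable
qed

lemma integrable_band_limited:
  fixes g :: "real \<times> real \<Rightarrow> complex"
  assumes [measurable]: "g \<in> borel_measurable borel" and M: "\<And>\<zeta>. cmod (g \<zeta>) \<le> M"
    and supp: "\<And>\<zeta>. g \<zeta> \<noteq> 0 \<Longrightarrow> \<bar>snd \<zeta>\<bar> < 1 \<and> \<bar>fst \<zeta>\<bar> < R"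
  shows "integrable lborel g"
proof (rule Bochner_Integration.integrable_bound)
  let ?B = "cbox (- R, - 1) (R, 1) :: (real \<times> real) set"
  show "integrable lborel (\<lambda>\<zeta>. indicator ?B \<zeta> *\<^sub>R M)"
    using emeasure_bounded_finite[OF bounded_cbox, of "(- R, - 1)" "(R, 1)"]
    by (intro integrable_scaleR_left integrable_real_indicator) auto
  have "cmod (g \<zeta>) \<le> norm (indicator ?B \<zeta> *\<^sub>R M)" for \<zeta>
  proof (cases "g \<zeta> = 0")
    case False
    then have "\<zeta> \<in> ?B" using supp[of \<zeta>] by (cases \<zeta>) (auto simp: cbox_Pair_eq)
    then show ?thesis using M[of \<zeta>] by simp
  qed simp
  then show "AE \<zeta> in lborel. cmod (g \<zeta>) \<le> norm (indicator ?B \<zeta> *\<^sub>R M)" by simp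
qed measurable

text \<open>On the unbounded region cut out by \<open>chi k\<close> the section at \<open>\<xi>\<close> has length \<open>O(1 / \<bar>\<xi>\<bar>)\<close>, so decay like
  \<open>1 / \<bar>\<xi>\<bar>\<close> suffices.\<close>

lemma integrable_chi_mult:
  fixes g :: "real \<times> real \<Rightarrow> complex"
  assumes [measurable]: "g \<in> borel_measurable borel" and M: "\<And>\<zeta>. cmod (g \<zeta>) \<le> M" "\<And>\<zeta>. \<bar>fst \<zeta>\<bar> * cmod (g \<zeta>) \<le> M"
    and supp: "\<And>\<zeta>. g \<zeta> \<noteq> 0 \<Longrightarrow> \<bar>snd \<zeta>\<bar> < 1"
  shows "integrable lborel (\<lambda>\<zeta>. chi k \<zeta> * g \<zeta>)"
proof (rule integrable_lborel_pairI)
  have M0: "M \<ge> 0" using order_trans[OF norm_ge_zero M(1)] .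
  define c where "c = 4 * M * (1 + 1 / pw k)"
  have c0: "c \<ge> 0" using M0 by (simp add: c_def)
  have ind: "(\<integral>\<^sup>+y. ennreal (a * indicator {- r..r} y) \<partial>lborel) = ennreal (a * (2 * r))" if "a \<ge> 0" "r \<ge> 0" for a r :: real
  proof -
    have "(\<integral>\<^sup>+y. ennreal (a * indicator {- r..r} y) \<partial>lborel) = (\<integral>\<^sup>+y. ennreal a * indicator {- r..r} y \<partial>lborel)"
      using that by (intro nn_integral_cong) (auto simp: indicator_def)
    also have "\<dots> = ennreal a * emeasure lborel {- r..r}" by (rule nn_integral_cmult_indicator) simp
    also have "\<dots> = ennreal (a * (2 * r))" using that by (simp add: ennreal_mult')
    finally show ?thesis .
  qed
  have sec: "(\<integral>\<^sup>+y. ennreal (norm (chi k (x, y) * g (x, y))) \<partial>lborel) \<le> ennreal (c * inverse (1 + x\<^sup>2))" for x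
  proof (cases "\<bar>x\<bar> \<le> 1")
    case True
    have "(\<integral>\<^sup>+y. ennreal (norm (chi k (x, y) * g (x, y))) \<partial>lborel) \<le> (\<integral>\<^sup>+(y::real). ennreal (M * indicator {- 1..1} y) \<partial>lborel)"
    proof (intro nn_integral_mono ennreal_leI)
      fix y
      show "norm (chi k (x, y) * g (x, y)) \<le> M * indicator {- 1..1} y"
        using M(1)[of "(x, y)"] supp[of "(x, y)"] M0 by (cases "g (x, y) = 0") (auto simp: norm_mult chi_def indicator_def)
    qed
    also have "\<dots> = ennreal (M * (2 * 1))" using M0 by (intro ind) auto
    also have "\<dots> \<le> ennreal (c * inverse (1 + x\<^sup>2))"
    proof (rule ennreal_leI)
      have "x\<^sup>2 \<le> 1" using True by (simp add: abs_square_le_1)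
      then have "1 / 2 \<le> inverse (1 + x\<^sup>2)" using one_plus_square_pos[of x] by (simp add: field_simps)
      moreover have "4 * M * 1 \<le> c" unfolding c_def using M0 by (intro mult_left_mono) auto
      ultimately have "4 * M * (1 / 2) \<le> c * inverse (1 + x\<^sup>2)" using M0 c0 by (intro mult_mono) auto
      then show "M * (2 * 1) \<le> c * inverse (1 + x\<^sup>2)" by simp
    qed
    finally show ?thesis .
  next
    case False
    then have x: "\<bar>x\<bar> > 1" by simp
    let ?r = "1 / (pw k * \<bar>x\<bar>)"
    have r0: "?r \<ge> 0" by simp
    have "(\<integral>\<^sup>+y. ennreal (norm (chi k (x, y) * g (x, y))) \<partial>lborel) \<le> (\<integral>\<^sup>+y. ennreal ((M / \<bar>x\<bar>) * indicator {- ?r..?r} y) \<partial>lborel)"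
    proof (intro nn_integral_mono ennreal_leI)
      fix y
      show "norm (chi k (x, y) * g (x, y)) \<le> (M / \<bar>x\<bar>) * indicator {- ?r..?r} y"
      proof (cases "pw k * \<bar>x * y\<bar> < 1")
        case True
        have "\<bar>y\<bar> * (pw k * \<bar>x\<bar>) \<le> 1" using True by (simp add: abs_mult mult_ac)
        then have "\<bar>y\<bar> \<le> ?r" using x by (simp add: pos_le_divide_eq)
        then have y: "y \<in> {- ?r..?r}" by (simp add: abs_le_iff)
        have "cmod (g (x, y)) \<le> M / \<bar>x\<bar>" using M(2)[of "(x, y)"] x by (simp add: pos_le_divide_eq mult.commute)
        then show ?thesis using y True by (simp add: norm_mult chi_def)
      next
        case False
        then show ?thesis using M0 by (simp add: chi_def indicator_def)
      qed
    qed
    also have "\<dots> = ennreal ((M / \<bar>x\<bar>) * (2 * ?r))" using M0 r0 by (intro ind) auto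
    also have "\<dots> \<le> ennreal (c * inverse (1 + x\<^sup>2))"
    proof (rule ennreal_leI)
      have x2: "1 \<le> x\<^sup>2" using x by (metis abs_square_less_1 less_imp_le not_le)
      have "(M / \<bar>x\<bar>) * (2 * ?r) = (2 * M / pw k) * (1 / x\<^sup>2)"
        unfolding power2_abs[of x, symmetric] by (simp add: power2_eq_square mult_ac)
      also have "\<dots> \<le> (2 * M / pw k) * (2 * inverse (1 + x\<^sup>2))"
      proof (intro mult_left_mono)
        have "1 / a \<le> 2 * inverse (1 + a)" if "a \<ge> 1" for a :: real
          using that by (simp add: field_simps)
        then show "1 / x\<^sup>2 \<le> 2 * inverse (1 + x\<^sup>2)" using x2 .
      qed (use M0 in auto)
      also have "\<dots> = (4 * M * (1 / pw k)) * inverse (1 + x\<^sup>2)" by simp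
      also have "\<dots> \<le> c * inverse (1 + x\<^sup>2)"
        unfolding c_def using M0 one_plus_square_pos[of x] by (intro mult_right_mono mult_left_mono) auto
      finally show "(M / \<bar>x\<bar>) * (2 * ?r) \<le> c * inverse (1 + x\<^sup>2)" .
    qed
    finally show ?thesis .
  qed
  have i: "integrable lborel (\<lambda>x::real. inverse (1 + x\<^sup>2))"
    using integrable_inverse_1_plus_square by (simp add: set_integrable_def einterval_eq)
  have "(\<integral>\<^sup>+x. \<integral>\<^sup>+y. ennreal (norm (chi k (x, y) * g (x, y))) \<partial>lborel \<partial>lborel) \<le> (\<integral>\<^sup>+x. ennreal (c * inverse (1 + x\<^sup>2)) \<partial>lborel)"
    by (intro nn_integral_mono sec)
  also have "\<dots> = (\<integral>\<^sup>+x. ennreal (norm (c * inverse (1 + x\<^sup>2))) \<partial>lborel)"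
    using c0 by (simp add: abs_mult add_nonneg_nonneg)
  also have "\<dots> < \<infinity>"
    using integrable_mult_right[OF i, of c] unfolding integrable_iff_bounded by simp
  finally show "(\<integral>\<^sup>+x. \<integral>\<^sup>+y. ennreal (norm (chi k (x, y) * g (x, y))) \<partial>lborel \<partial>lborel) < \<infinity>" .
qed measurable

text \<open>The limit \<open>n \<longlonglongrightarrow> \<infinity>\<close> of the truncations to \<open>\<bar>\<xi>\<bar> < 2^n\<close> and to the points with
  \<open>\<lfloor>log 2 (v z)\<rfloor> \<le> n\<close>.\<close>

lemma operator_bound:
  fixes v :: "real \<times> real \<Rightarrow> real"
  assumes [measurable]: "g \<in> borel_measurable borel" and M: "\<And>\<zeta>. cmod (g \<zeta>) \<le> M" "\<And>\<zeta>. \<bar>fst \<zeta>\<bar> * cmod (g \<zeta>) \<le> M"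
    and supp: "\<And>\<zeta>. g \<zeta> \<noteq> 0 \<Longrightarrow> \<bar>snd \<zeta>\<bar> < 1" and fin: "l2sq g < top"
    and v: "1-lipschitz_on UNIV v" "\<And>z. v z > 0" "\<And>z. \<lfloor>log 2 (v z)\<rfloor> \<ge> 1"
  shows "l2sq (\<lambda>z. ift (\<lambda>\<zeta>. chi \<lfloor>log 2 (v z)\<rfloor> \<zeta> * g \<zeta>) z) \<le> 92000 * l2sq g"
proof -
  have vm[measurable]: "v \<in> borel_measurable borel" by (rule lipschitz_measurable[OF v(1)])
  define \<kappa> where "\<kappa> = (\<lambda>z. \<lfloor>log 2 (v z)\<rfloor>)"
  define G where "G = (\<lambda>(n::nat) \<zeta>. if \<bar>fst \<zeta>\<bar> < pw (int n) then g \<zeta> else 0)"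
  define H where "H = (\<lambda>(n::nat) z. indicator {z. \<kappa> z \<in> {1..int n}} z * ennreal ((cmod (ift (\<lambda>\<zeta>. chi (\<kappa> z) \<zeta> * G n \<zeta>) z))\<^sup>2))"
  have Gm[measurable]: "G n \<in> borel_measurable borel" for n unfolding G_def by measurable
  have Gle: "cmod (G n \<zeta>) \<le> cmod (g \<zeta>)" for n \<zeta> by (simp add: G_def)
  have Gi: "integrable lborel (G n)" for n
    by (rule integrable_band_limited[where M = M and R = "pw (int n)"])
       (use supp in \<open>auto simp: G_def intro: order_trans[OF norm_ge_zero M(1)] M(1) split: if_splits\<close>)
  have Gs: "l2sq (G n) \<le> l2sq g" for n by (rule l2sq_mono[OF Gle])
  have Hle: "(\<integral>\<^sup>+z. H n z \<partial>lborel) \<le> 92000 * l2sq g" for n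
  proof -
    have "(\<integral>\<^sup>+z. H n z \<partial>lborel) \<le> 92000 * l2sq (G n)"
      unfolding H_def \<kappa>_def
      by (rule truncated_operator_bound[OF Gi order.strict_trans1[OF Gs fin] _ v(1,2), where R = "int n"])
         (use supp in \<open>auto simp: G_def split: if_splits\<close>)
    also have "\<dots> \<le> 92000 * l2sq g" by (intro mult_left_mono Gs) auto
    finally show ?thesis .
  qed
  have Hm: "H n \<in> borel_measurable lborel" for n
  proof -
    have "(\<lambda>z. ift (\<lambda>\<zeta>. chi (\<kappa> z) \<zeta> * G n \<zeta>) z) \<in> borel_measurable borel"
      unfolding \<kappa>_def by (rule measurable_ift_chi) measurable
    moreover have "{z. \<kappa> z \<in> {1..int n}} \<in> sets borel"
    proof -
      have "{z. \<kappa> z \<in> {1..int n}} = {z \<in> space borel. (1::real) \<le> of_int \<lfloor>log 2 (v z)\<rfloor> \<and> of_int \<lfloor>log 2 (v z)\<rfloor> \<le> real n}"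
        by (auto simp: \<kappa>_def)
      also have "\<dots> \<in> sets borel" by measurable
      finally show ?thesis .
    qed
    ultimately show ?thesis unfolding H_def by measurable
  qed
  have "l2sq (\<lambda>z. ift (\<lambda>\<zeta>. chi \<lfloor>log 2 (v z)\<rfloor> \<zeta> * g \<zeta>) z) = (\<integral>\<^sup>+z. liminf (\<lambda>n. H n z) \<partial>lborel)"
    unfolding l2sq_def
  proof (rule nn_integral_cong)
    fix z
    have i: "integrable lborel (\<lambda>\<zeta>. chi (\<kappa> z) \<zeta> * g \<zeta>)"
      by (rule integrable_chi_mult[OF _ M supp]) measurable
    have lim: "(\<lambda>n. ift (\<lambda>\<zeta>. chi (\<kappa> z) \<zeta> * G n \<zeta>) z) \<longlonglongrightarrow> ift (\<lambda>\<zeta>. chi (\<kappa> z) \<zeta> * g \<zeta>) z"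
      unfolding ift_def
    proof (rule integral_dominated_convergence)
      show "integrable lborel (\<lambda>\<zeta>. norm (chi (\<kappa> z) \<zeta> * g \<zeta>))" using i by simp
      show "AE \<zeta> in lborel. (\<lambda>n. chi (\<kappa> z) \<zeta> * G n \<zeta> * ch (fst z * fst \<zeta> + snd z * snd \<zeta>))
          \<longlonglongrightarrow> chi (\<kappa> z) \<zeta> * g \<zeta> * ch (fst z * fst \<zeta> + snd z * snd \<zeta>)"
      proof (intro always_eventually allI)
        fix \<zeta> :: "real \<times> real"
        have "\<forall>\<^sub>F n in sequentially. g \<zeta> = G n \<zeta>"
          using eventually_ge_at_top[of "nat \<lceil>\<bar>fst \<zeta>\<bar>\<rceil>"]
        proof eventually_elim
          case (elim n)
          have "\<bar>fst \<zeta>\<bar> \<le> real n" using elim by linarith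
          also have "real n < 2 ^ n" by (rule of_nat_less_two_power)
          also have "(2::real) ^ n = pw (int n)" by (simp add: pw_def powr_realpow)
          finally show ?case by (simp add: G_def)
        qed
        then have "(\<lambda>n. G n \<zeta>) \<longlonglongrightarrow> g \<zeta>" by (rule Lim_transform_eventually[rotated]) simp
        then show "(\<lambda>n. chi (\<kappa> z) \<zeta> * G n \<zeta> * ch (fst z * fst \<zeta> + snd z * snd \<zeta>))
          \<longlonglongrightarrow> chi (\<kappa> z) \<zeta> * g \<zeta> * ch (fst z * fst \<zeta> + snd z * snd \<zeta>)"
          by (intro tendsto_intros)
      qed
      show "AE \<zeta> in lborel. cmod (chi (\<kappa> z) \<zeta> * G n \<zeta> * ch (fst z * fst \<zeta> + snd z * snd \<zeta>)) \<le> norm (chi (\<kappa> z) \<zeta> * g \<zeta>)" for n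
        by (intro always_eventually allI) (simp add: norm_mult mult_left_mono Gle)
    qed (auto intro!: borel_measurable_times)
    have "\<forall>\<^sub>F n in sequentially. ennreal ((cmod (ift (\<lambda>\<zeta>. chi (\<kappa> z) \<zeta> * G n \<zeta>) z))\<^sup>2) = H n z"
      using eventually_ge_at_top[of "nat (\<kappa> z)"]
    proof eventually_elim
      case (elim n)
      then have "\<kappa> z \<in> {1..int n}" using v(3)[of z] by (auto simp: \<kappa>_def)
      then show ?case by (simp add: H_def)
    qed
    then have "(\<lambda>n. H n z) \<longlonglongrightarrow> ennreal ((cmod (ift (\<lambda>\<zeta>. chi (\<kappa> z) \<zeta> * g \<zeta>) z))\<^sup>2)"
      by (rule Lim_transform_eventually[rotated]) (intro tendsto_ennrealI tendsto_intros lim)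
    then show "ennreal ((cmod (ift (\<lambda>\<zeta>. chi \<lfloor>log 2 (v z)\<rfloor> \<zeta> * g \<zeta>) z))\<^sup>2) = liminf (\<lambda>n. H n z)"
      unfolding \<kappa>_def by (intro lim_imp_Liminf[symmetric]) auto
  qed
  also have "\<dots> \<le> liminf (\<lambda>n. \<integral>\<^sup>+z. H n z \<partial>lborel)"
    by (rule nn_integral_liminf[OF Hm])
  also have "\<dots> \<le> 92000 * l2sq g"
    by (rule Liminf_le) (auto simp: Hle)
  finally show ?thesis .
qed

theorem theorem1p3:
  fixes V v :: "real \<times> real \<Rightarrow> real"
  assumes "\<And>z. V z \<in> {2 ^ k | k :: nat. k \<ge> 1}"
    and "\<And>z. v z > 0"
    and "1-lipschitz_on UNIV v"
    and "\<And>z. V z = 2 powr of_int \<lfloor>log 2 (v z)\<rfloor>"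
  shows "\<exists>C::real. \<forall>f. schwartz f \<longrightarrow>
           in_L2 (T_op V f) \<and> norm_L2 (T_op V f) \<le> C * norm_L2 f"
proof (intro exI allI impI)
  fix f :: "real \<times> real \<Rightarrow> complex"
  assume f: "schwartz f"
  have fi: "integrable lborel f" by (rule schwartz_integrable[OF f])
  have [measurable]: "f \<in> borel_measurable borel" by (rule schwartz_measurable[OF f])
  have vm[measurable]: "v \<in> borel_measurable borel" by (rule lipschitz_measurable[OF assms(3)])
  have \<kappa>: "\<lfloor>log 2 (v z)\<rfloor> \<ge> 1" for z
  proof -
    obtain k :: nat where k: "V z = 2 ^ k" "k \<ge> 1" using assms(1)[of z] by auto
    have "2 powr real k = 2 powr of_int \<lfloor>log 2 (v z)\<rfloor>"
      using k assms(4)[of z] by (simp add: powr_realpow)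
    then have "real k = of_int \<lfloor>log 2 (v z)\<rfloor>" by (simp add: powr_inj)
    then show ?thesis using k(2) by linarith
  qed
  define g where "g = (\<lambda>\<zeta>. (if \<bar>snd \<zeta>\<bar> < 1 then 1 else 0) * fourier f \<zeta>)"
  have neg: "(\<lambda>z::real \<times> real. - z) \<in> borel_measurable borel"
    by (intro borel_measurable_continuous_onI continuous_intros)
  have Fm[measurable]: "fourier f \<in> borel_measurable borel"
    unfolding fourier_eq_ift[abs_def] by (rule measurable_compose[OF neg measurable_ift]) measurable
  have gm[measurable]: "g \<in> borel_measurable borel" unfolding g_def by measurable
  obtain M where M: "\<And>w. cmod (ift f w) \<le> M" "\<And>w. \<bar>fst w\<bar> * cmod (ift f w) \<le> M"
    using ift_decay[OF f] by blast
  have gF: "cmod (g \<zeta>) \<le> cmod (fourier f \<zeta>)" for \<zeta> by (simp add: g_def)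
  have M1: "cmod (g \<zeta>) \<le> M" for \<zeta>
    using order_trans[OF gF M(1)[of "- \<zeta>", folded fourier_eq_ift]] .
  have M2: "\<bar>fst \<zeta>\<bar> * cmod (g \<zeta>) \<le> M" for \<zeta>
    using mult_left_mono[OF gF, of "\<bar>fst \<zeta>\<bar>" \<zeta>] M(2)[of "- \<zeta>"] by (simp add: fourier_eq_ift)
  have supp: "\<bar>snd \<zeta>\<bar> < 1" if "g \<zeta> \<noteq> 0" for \<zeta>
    using that by (simp add: g_def split: if_splits)
  have sf: "l2sq f = ennreal ((norm_L2 f)\<^sup>2)"
    unfolding l2sq_def norm_L2_def using schwartz_square_integrable[OF f]
    by (subst nn_integral_eq_integral) (auto simp: integral_nonneg_AE)
  have "l2sq g \<le> l2sq (fourier f)" by (rule l2sq_mono[OF gF])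
  also have "l2sq (fourier f) = l2sq (ift (\<lambda>z. cnj (f z)))"
  proof -
    \<comment> \<open>Conjugation turns the Fourier integral into the inverse one.\<close>
    have "cnj (ift f (- \<zeta>)) = ift (\<lambda>z. cnj (f z)) \<zeta>" for \<zeta>
      unfolding ift_def Bochner_Integration.integral_cnj[symmetric] by (simp add: cnj_ch algebra_simps)
    then have "cmod (fourier f \<zeta>) = cmod (ift (\<lambda>z. cnj (f z)) \<zeta>)" for \<zeta>
      unfolding fourier_eq_ift by (metis complex_mod_cnj)
    then show ?thesis by (simp add: l2sq_def)
  qed
  also have "\<dots> \<le> l2sq (\<lambda>z. cnj (f z))" using fi by (intro plancherel_2d) simp
  also have "\<dots> = l2sq f" by (simp add: l2sq_def)
  finally have sg: "l2sq g \<le> l2sq f" .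
  have fin: "l2sq g < top" using sg by (rule order.strict_trans1) (simp add: sf)
  have T: "T_op V f = (\<lambda>z. ift (\<lambda>\<zeta>. chi \<lfloor>log 2 (v z)\<rfloor> \<zeta> * g \<zeta>) z)"
    unfolding g_def by (rule ext) (rule T_op_eq_ift[OF assms(4)])
  have Tm[measurable]: "T_op V f \<in> borel_measurable borel"
    unfolding T by (rule measurable_ift_chi) measurable
  have "l2sq (T_op V f) \<le> 92000 * l2sq g"
    unfolding T by (rule operator_bound[OF gm M1 M2 supp fin assms(3) assms(2) \<kappa>])
  also have "\<dots> \<le> 92000 * l2sq f" by (intro mult_left_mono sg) auto
  also have "\<dots> = ennreal (92000 * (norm_L2 f)\<^sup>2)" by (simp add: sf ennreal_mult')
  finally have Tle: "l2sq (T_op V f) \<le> ennreal (92000 * (norm_L2 f)\<^sup>2)" .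
  have Ti: "integrable lborel (\<lambda>z. (cmod (T_op V f z))\<^sup>2)"
    using Tle by (intro integrableI_bounded) (auto simp: l2sq_def elim!: order.strict_trans1)
  then have L2: "in_L2 (T_op V f)" by (simp add: in_L2_def)
  have "l2sq (T_op V f) = ennreal (LINT z|lborel. (cmod (T_op V f z))\<^sup>2)"
    unfolding l2sq_def using Ti by (intro nn_integral_eq_integral) auto
  with Tle have "(LINT z|lborel. (cmod (T_op V f z))\<^sup>2) \<le> 92000 * (norm_L2 f)\<^sup>2"
    by (simp add: ennreal_le_iff)
  then have "norm_L2 (T_op V f) \<le> sqrt (92000 * (norm_L2 f)\<^sup>2)"
    unfolding norm_L2_def[of "T_op V f"] by (rule real_sqrt_le_mono)
  also have "\<dots> = sqrt 92000 * norm_L2 f"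
    by (simp add: real_sqrt_mult norm_L2_def integral_nonneg_AE)
  finally show "in_L2 (T_op V f) \<and> norm_L2 (T_op V f) \<le> sqrt 92000 * norm_L2 f" using L2 by simp
qed

end
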